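(* Assume that $\inf_{(x,y,z)\in\Omega}\sqrt{x^2+y^2}>0$. Let $H:(0,\infty)\to[0,\infty)$ be a $C^1$ convex function satisfying $\lim_{t\to+\infty}H(t)/t=\lim_{s\to0^+}H(s)=+\infty$. Assume furthermore that there exist $s>0$, $c_1,c_2>0$, $d_0>0$ such that $$c_1t^{-s-k}\le(-1)^k\frac{d^k}{dt^k}H(t)\le c_2t^{-s-k}\quad\text{for }k=0,1\text{ and }0<t<d_0,$$ and there exist $\tau>0$, $c_3,c_4>0$, $d_1>0$ such that $$c_3t^{\tau+1}\le H'(t)\le c_4t^{\tau+1}\quad\text{for }t\ge d_1.$$ Let $u$ be a minimizer of $E$ in $\mathcal{A}_{nc}^{axi}$. Then, in the sense of distributions in $\Omega$, $$\operatorname{Div}\Big(2Du^TDu+\big[H'(\det Du)\det Du-|Du|^2-H(\det Du)\big]I\Big)=0,$$ that is, $$\sum_{i=1}^3\partial_i\Big[2\,\partial_iu\cdot\partial_ju+\big(H'(\det Du)\det Du-|Du|^2-H(\det Du)\big)\delta_{ij}\Big]=0\quad\text{for }j=1,2,3.$$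
   Context: $\Omega,\Omega'\subset\mathbb{R}^3$ are smooth bounded domains, axisymmetric with respect to the $z$-axis. $g:\overline{\Omega}\to\overline{\Omega'}$ is a $C^1$ axisymmetric diffeomorphism, and $M>0$. The energy is $$E(u)=\int_\Omega |Du|^2+H(\det Du)\,dx .$$ Let $\Omega_0=\{(r,z): r>0,\ (r,0,z)\in\Omega\}$. A map $u:\Omega\to\mathbb{R}^3$ is axisymmetric if there is $v=(v_1,v_2):\Omega_0\to\mathbb{R}^2$ with $v_1\ge0$ a.e. and $u(r\cos\theta,r\sin\theta,z)=v_1(r,z)(\cos\theta\, e_x+\sin\theta\, e_y)+v_2(r,z)e_z$. For $u\in W^{1,2}(\Omega,\mathbb{R}^3)$ with $\det Du\in L^1(\Omega)$ and $f\in C^\infty_c(\Omega\times\mathbb{R}^3,\mathbb{R}^3)$ set $$\mathcal{E}_u(f)=\int_\Omega \langle\operatorname{cof}Du(x),D_xf(x,u(x))\rangle+\det Du(x)\,\operatorname{div}_yf(x,u(x))\,dx,\qquad \mathcal{E}(u)=\sup\{\mathcal{E}_u(f): \|f\|_\infty\le1\},$$ where $\langle A,B\rangle=\operatorname{tr}(A^TB)$ and $A^T\operatorname{cof}A=(\det A)I$. $\mathcal{A}$ is the set of $u\in W^{1,2}\cap L^\infty(\Omega,\mathbb{R}^3)$ with $u|_{\partial\Omega}=g|_{\partial\Omega}$, $\|u\|_\infty\le M$, $\det Du>0$ a.e. and $u$ one-to-one a.e. $\mathcal{A}_{nc}=\{u\in\mathcal{A}:\mathcal{E}(u)=0\}$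 and $\mathcal{A}_{nc}^{axi}=\{u\in\mathcal{A}_{nc}:u\text{ axisymmetric}\}$. It is assumed that $0<\inf\{E(w):w\in\mathcal{A}_{nc}^{axi}\}<+\infty$. *)

theory Defs
  imports "HOL-Analysis.Analysis"
begin

subsection \<open>Smooth functions and test functions\<close>

(* Meant for open S.  In finite dimensions, continuity of x |-> f'(x) v for every fixed v is
   continuity of x |-> f'(x), so this is the usual class C^k. *)
fun Ck_on :: "nat \<Rightarrow> 'a::real_normed_vector set \<Rightarrow> ('a \<Rightarrow> 'b::real_normed_vector) \<Rightarrow> bool" where
  "Ck_on 0 S f \<longleftrightarrow> continuous_on S f"
| "Ck_on (Suc k) S f \<longleftrightarrow>
     (\<forall>x\<in>S. f differentiable (at x)) \<and> (\<forall>v. Ck_on k S (\<lambda>x. frechet_derivative f (at x) v))"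

definition smooth_on :: "'a::real_normed_vector set \<Rightarrow> ('a \<Rightarrow> 'b::real_normed_vector) \<Rightarrow> bool" where
  "smooth_on S f \<longleftrightarrow> (\<forall>k. Ck_on k S f)"

(* The elements are functions on the whole space (extension by zero). *)
definition test_functions :: "'a::real_normed_vector set \<Rightarrow> ('a \<Rightarrow> 'b::real_normed_vector) set" where
  "test_functions S =
     {f. smooth_on UNIV f \<and> compact (closure {x. f x \<noteq> 0}) \<and> closure {x. f x \<noteq> 0} \<subseteq> S}"

definition partial_deriv :: "'n::finite \<Rightarrow> (real^'n \<Rightarrow> real) \<Rightarrow> real^'n \<Rightarrow> real" where
  "partial_deriv j f x = frechet_derivative f (at x) (axis j 1)"

definition C1_on_closed :: "(real^3) set \<Rightarrow> (real^3 \<Rightarrow> real^3) \<Rightarrow> bool" where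
  "C1_on_closed S f \<longleftrightarrow>
     (\<exists>D :: real^3 \<Rightarrow> real^3^3. continuous_on S D \<and>
        (\<forall>x\<in>S. (f has_derivative (\<lambda>h. D x *v h)) (at x within S)))"

definition C1_diffeomorphism :: "(real^3) set \<Rightarrow> (real^3) set \<Rightarrow> (real^3 \<Rightarrow> real^3) \<Rightarrow> bool" where
  "C1_diffeomorphism S T g \<longleftrightarrow>
     (\<exists>h. homeomorphism S T g h \<and> C1_on_closed S g \<and> C1_on_closed T h)"


subsection \<open>Domains and axial symmetry\<close>

(* Smoothness of the boundary is expressed by local defining functions; as the gradient does not
   vanish on U, the set {x : U. rho x = 0} is the part of the boundary in U, and the domain lies
   on one side of it. *)
definition smooth_bounded_domain :: "(real^3) set \<Rightarrow> bool" where
  "smooth_bounded_domain \<Omega> \<longleftrightarrow>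
     open \<Omega> \<and> connected \<Omega> \<and> bounded \<Omega> \<and> \<Omega> \<noteq> {} \<and>
     (\<forall>p\<in>frontier \<Omega>. \<exists>U (\<rho> :: real^3 \<Rightarrow> real).
        open U \<and> p \<in> U \<and> smooth_on U \<rho> \<and>
        (\<forall>x\<in>U. \<exists>v. frechet_derivative \<rho> (at x) v \<noteq> 0) \<and>
        \<Omega> \<inter> U = {x \<in> U. \<rho> x < 0})"

definition rot_z :: "real \<Rightarrow> real^3 \<Rightarrow> real^3" where
  "rot_z \<theta> x = vector [cos \<theta> * x$1 - sin \<theta> * x$2, sin \<theta> * x$1 + cos \<theta> * x$2, x$3]"

definition axisymmetric_set :: "(real^3) set \<Rightarrow> bool" where
  "axisymmetric_set \<Omega> \<longleftrightarrow> (\<forall>\<theta>. rot_z \<theta> ` \<Omega> = \<Omega>)"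

definition meridian :: "(real^3) set \<Rightarrow> (real \<times> real) set" where
  "meridian \<Omega> = {(r, z). r > 0 \<and> vector [r, 0, z] \<in> \<Omega>}"

(* Sobolev maps are only defined up to null sets, hence the identity is required for almost
   every point.  For continuous maps it then holds at every point off the axis. *)
definition axisymmetric_map :: "(real^3) set \<Rightarrow> (real^3 \<Rightarrow> real^3) \<Rightarrow> bool" where
  "axisymmetric_map \<Omega> u \<longleftrightarrow>
     (\<exists>v1 v2 :: real \<times> real \<Rightarrow> real.
        (AE p in lebesgue_on (meridian \<Omega>). v1 p \<ge> 0) \<and>
        (AE x in lebesgue_on \<Omega>. \<forall>r \<theta> z.
           r > 0 \<and> x = vector [r * cos \<theta>, r * sin \<theta>, z] \<longrightarrow>
           u x = v1 (r, z) *\<^sub>R (cos \<theta> *\<^sub>R axis 1 1 + sin \<theta> *\<^sub>R axis 2 1) + v2 (r, z) *\<^sub>R axis 3 1))"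


subsection \<open>Sobolev maps\<close>

definition locally_integrable :: "(real^3) set \<Rightarrow> (real^3 \<Rightarrow> 'b::euclidean_space) \<Rightarrow> bool" where
  "locally_integrable \<Omega> f \<longleftrightarrow> (\<forall>K. compact K \<and> K \<subseteq> \<Omega> \<longrightarrow> integrable (lebesgue_on K) f)"

(* Entry (i, j) of D is the j-th weak partial derivative of the i-th component of u. *)
definition has_weak_gradient ::
  "(real^3) set \<Rightarrow> (real^3 \<Rightarrow> real^3) \<Rightarrow> (real^3 \<Rightarrow> real^3^3) \<Rightarrow> bool" where
  "has_weak_gradient \<Omega> u D \<longleftrightarrow>
     locally_integrable \<Omega> u \<and> locally_integrable \<Omega> D \<and>
     (\<forall>\<phi> \<in> test_functions \<Omega>. \<forall>i j.
        (LINT x|lebesgue_on \<Omega>. u x $ i * partial_deriv j \<phi> x) =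
        - (LINT x|lebesgue_on \<Omega>. D x $ i $ j * \<phi> x))"

(* Determined up to null sets. *)
definition weak_gradient :: "(real^3) set \<Rightarrow> (real^3 \<Rightarrow> real^3) \<Rightarrow> real^3 \<Rightarrow> real^3^3" where
  "weak_gradient \<Omega> u = (SOME D. has_weak_gradient \<Omega> u D)"

(* The norm of real^3^3 is the Frobenius norm. *)
definition W12 :: "(real^3) set \<Rightarrow> (real^3 \<Rightarrow> real^3) set" where
  "W12 \<Omega> = {u. u \<in> borel_measurable (lebesgue_on \<Omega>) \<and>
               integrable (lebesgue_on \<Omega>) (\<lambda>x. (norm (u x))\<^sup>2) \<and>
               (\<exists>D. has_weak_gradient \<Omega> u D) \<and>
               integrable (lebesgue_on \<Omega>) (\<lambda>x. (norm (weak_gradient \<Omega> u x))\<^sup>2)}"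

definition W12_zero :: "(real^3) set \<Rightarrow> (real^3 \<Rightarrow> real^3) set" where
  "W12_zero \<Omega> = {w \<in> W12 \<Omega>. \<exists>\<phi> :: nat \<Rightarrow> real^3 \<Rightarrow> real^3.
      (\<forall>n. \<phi> n \<in> test_functions \<Omega>) \<and>
      (\<lambda>n. LINT x|lebesgue_on \<Omega>. (norm (\<phi> n x - w x))\<^sup>2) \<longlonglongrightarrow> 0 \<and>
      (\<lambda>n. LINT x|lebesgue_on \<Omega>. (norm (jacobian (\<phi> n) (at x) - weak_gradient \<Omega> w x))\<^sup>2)
        \<longlonglongrightarrow> 0}"

(* Equality of boundary values of Sobolev maps. *)
definition same_trace :: "(real^3) set \<Rightarrow> (real^3 \<Rightarrow> real^3) \<Rightarrow> (real^3 \<Rightarrow> real^3) \<Rightarrow> bool" where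
  "same_trace \<Omega> u g \<longleftrightarrow> (\<lambda>x. u x - g x) \<in> W12_zero \<Omega>"

definition one_to_one_ae :: "(real^3) set \<Rightarrow> (real^3 \<Rightarrow> real^3) \<Rightarrow> bool" where
  "one_to_one_ae \<Omega> u \<longleftrightarrow> (\<exists>N. negligible N \<and> inj_on u (\<Omega> - N))"


subsection \<open>Energies and admissible classes\<close>

(* H is only given on (0, infinity); the energy is only used for maps with positive Jacobian
   almost everywhere. *)
definition energy :: "(real^3) set \<Rightarrow> (real \<Rightarrow> real) \<Rightarrow> (real^3 \<Rightarrow> real^3) \<Rightarrow> ennreal" where
  "energy \<Omega> H u =
     (\<integral>\<^sup>+x. ennreal ((norm (weak_gradient \<Omega> u x))\<^sup>2 + H (det (weak_gradient \<Omega> u x))) \<partial>lebesgue_on \<Omega>)"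

(* Entry (i, j) is the determinant of A with its j-th column replaced by the i-th unit vector. *)
definition cof :: "real^3^3 \<Rightarrow> real^3^3" where
  "cof A = (\<chi> i j. det (\<chi> k l. if l = j then (if k = i then 1 else 0) else A$k$l))"

lemma transpose_mult_cof: "transpose A ** cof A = mat (det A)"
  by (simp add: vec_eq_iff forall_3 matrix_matrix_mult_def transpose_def cof_def mat_def det_3
      sum_3 algebra_simps)

definition surface_functional ::
  "(real^3) set \<Rightarrow> (real^3 \<Rightarrow> real^3) \<Rightarrow> ((real^3) \<times> (real^3) \<Rightarrow> real^3) \<Rightarrow> real" where
  "surface_functional \<Omega> u f =
     (LINT x|lebesgue_on \<Omega>.
        trace (transpose (cof (weak_gradient \<Omega> u x)) ** jacobian (\<lambda>x'. f (x', u x)) (at x)) +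
        det (weak_gradient \<Omega> u x) * trace (jacobian (\<lambda>y. f (x, y)) (at (u x))))"

definition surface_energy :: "(real^3) set \<Rightarrow> (real^3 \<Rightarrow> real^3) \<Rightarrow> ereal" where
  "surface_energy \<Omega> u =
     (SUP f \<in> {f \<in> test_functions (\<Omega> \<times> UNIV). \<forall>p. norm (f p) \<le> 1}. ereal (surface_functional \<Omega> u f))"

definition admissible :: "(real^3) set \<Rightarrow> (real^3 \<Rightarrow> real^3) \<Rightarrow> real \<Rightarrow> (real^3 \<Rightarrow> real^3) set" where
  "admissible \<Omega> g M = {u \<in> W12 \<Omega>.
     same_trace \<Omega> u g \<and>
     (AE x in lebesgue_on \<Omega>. norm (u x) \<le> M) \<and>
     (AE x in lebesgue_on \<Omega>. det (weak_gradient \<Omega> u x) > 0) \<and>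
     one_to_one_ae \<Omega> u}"

(* The surface energy is only defined for maps with integrable Jacobian.  By the area formula
   this holds for every admissible map (bounded and one-to-one almost everywhere). *)
definition admissible_nc :: "(real^3) set \<Rightarrow> (real^3 \<Rightarrow> real^3) \<Rightarrow> real \<Rightarrow> (real^3 \<Rightarrow> real^3) set" where
  "admissible_nc \<Omega> g M = {u \<in> admissible \<Omega> g M.
     integrable (lebesgue_on \<Omega>) (\<lambda>x. det (weak_gradient \<Omega> u x)) \<and> surface_energy \<Omega> u = 0}"

definition admissible_nc_axi :: "(real^3) set \<Rightarrow> (real^3 \<Rightarrow> real^3) \<Rightarrow> real \<Rightarrow> (real^3 \<Rightarrow> real^3) set" where
  "admissible_nc_axi \<Omega> g M = {u \<in> admissible_nc \<Omega> g M. axisymmetric_map \<Omega> u}"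

definition is_minimizer :: "('a \<Rightarrow> ennreal) \<Rightarrow> 'a set \<Rightarrow> 'a \<Rightarrow> bool" where
  "is_minimizer F A u \<longleftrightarrow> u \<in> A \<and> (\<forall>w\<in>A. F u \<le> F w)"


subsection \<open>Divergence in the sense of distributions\<close>

(* The j-th component of Div T is the sum over i of the i-th derivatives of T_ij.  Local
   integrability makes T a distribution. *)
definition distributional_Div_zero :: "(real^3) set \<Rightarrow> (real^3 \<Rightarrow> real^3^3) \<Rightarrow> bool" where
  "distributional_Div_zero \<Omega> T \<longleftrightarrow>
     locally_integrable \<Omega> T \<and>
     (\<forall>j. \<forall>\<phi> \<in> test_functions \<Omega>.
        (\<Sum>i\<in>UNIV. LINT x|lebesgue_on \<Omega>. T x $ i $ j * partial_deriv i \<phi> x) = 0)"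

end

(* Precomposing the minimizer u with the inverses of the diffeomorphisms psi_t = id + t X, where X is
   smooth with compact support in Omega, preserves every condition defining the admissible class
   except axial symmetry: by Piola's identity, the surface functional of u o psi_t^-1 at f is the one
   of u at f(psi_t(x), y). If X commutes with the rotations about the axis and with a reflection in a
   plane containing the axis, then axial symmetry is preserved as well, and differentiating the energy
   at t = 0, where the growth conditions on H give |t H'(t)| <= C (1 + H(t)) and hence a dominating
   function, yields that the integral of T . DX vanishes, T being the energy-momentum tensor.
   For arbitrary X, the equivariance of u makes T equivariant, so that this integral does not change
   when X is averaged over the rotations and the reflection. *)

theory Submission
  imports Defs
begin

section \<open>Calculus of smooth functions\<close>

text \<open>An axisymmetric map keeps the angle: it has no swirl. Equivariance under rotations alone
  still admits swirling fields X, and these push the minimizer out of the class; a field that also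
  commutes with the reflection is tangent to the half planes through the axis. The main obstacles
  concern regularity. \<open>weak_gradient\<close> is a choice, fixed only up to null sets, so the
  gradient of a competitor is constructed explicitly and then identified almost everywhere. The
  inverse of id + t X is only used as a differentiable map, so a test function composed with it need
  not be a test function; the boundary condition, defined through approximation by test functions,
  is recovered by mollification. H blows up at 0, so the dominating function has to be a multiple of
  1 + H(det Du) itself. The bound on t H'(t) makes ln (1 + H (exp x)) Lipschitz in x, so a factor in
  [1/2, 2] in the argument of H costs only a constant factor. Finally, T . DX contracts the second
  index of T with the derivatives of X, whereas Div contracts the first; the symmetry of T
  reconciles the two.\<close>

lemma Ck_on_SucI:
  assumes "\<And>x. (f has_derivative f' x) (at x)" "\<And>v. Ck_on k UNIV (\<lambda>x. f' x v)"
  shows "Ck_on (Suc k) UNIV f"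
proof -
  have "frechet_derivative f (at x) = f' x" for x
    using assms(1) frechet_derivative_at by metis
  then show ?thesis
    using assms by (auto simp: differentiable_def)
qed

lemma Ck_on_SucD:
  assumes "Ck_on (Suc k) UNIV f"
  shows "(f has_derivative frechet_derivative f (at x)) (at x)"
    and "Ck_on k UNIV (\<lambda>x. frechet_derivative f (at x) v)"
  using assms frechet_derivative_works by auto

lemma Ck_on_Suc_imp: "Ck_on (Suc k) UNIV f \<Longrightarrow> Ck_on k UNIV f"
proof (induction k arbitrary: f)
  case 0
  then show ?case
    by (auto intro!: continuous_at_imp_continuous_on differentiable_imp_continuous_within)
next
  case (Suc k)
  then show ?case
    by (metis Ck_on.simps(2))
qed

lemma Ck_on_imp_continuous: "Ck_on k UNIV f \<Longrightarrow> continuous_on UNIV f"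
  by (induction k arbitrary: f) (use Ck_on_Suc_imp in auto)

lemma Ck_on_const: "Ck_on k UNIV (\<lambda>x. c)"
  by (induction k arbitrary: c) (auto intro!: Ck_on_SucI[where f' = "\<lambda>x v. 0"] simp del: Ck_on.simps(2))

lemma Ck_on_bounded_linear:
  assumes "bounded_linear h"
  shows "Ck_on k UNIV f \<Longrightarrow> Ck_on k UNIV (\<lambda>x. h (f x))"
proof (induction k arbitrary: f)
  case 0
  then show ?case
    using assms by (auto intro: bounded_linear.continuous_on)
next
  case (Suc k)
  show ?case
    by (rule Ck_on_SucI[where f' = "\<lambda>x v. h (frechet_derivative f (at x) v)"])
      (intro bounded_linear.has_derivative[OF assms] Suc.IH Ck_on_SucD[OF Suc.prems])+
qed

lemma Ck_on_linear: "bounded_linear h \<Longrightarrow> Ck_on k UNIV h"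
proof (cases k)
  case (Suc n)
  then show "bounded_linear h \<Longrightarrow> ?thesis"
    by (simp del: Ck_on.simps(2), intro Ck_on_SucI[where f' = "\<lambda>x v. h v"] Ck_on_const)
      (simp add: bounded_linear_imp_has_derivative)
qed (auto intro: linear_continuous_on)

lemma Ck_on_add: "Ck_on k UNIV f \<Longrightarrow> Ck_on k UNIV g \<Longrightarrow> Ck_on k UNIV (\<lambda>x. f x + g x)"
proof (induction k arbitrary: f g)
  case (Suc k)
  show ?case
    by (rule Ck_on_SucI[where f' = "\<lambda>x v. frechet_derivative f (at x) v + frechet_derivative g (at x) v"])
      (intro has_derivative_add Suc.IH Ck_on_SucD[OF Suc.prems(1)] Ck_on_SucD[OF Suc.prems(2)])+
qed (auto intro: continuous_on_add)

lemma Ck_on_bilinear: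
  assumes "bounded_bilinear B"
  shows "Ck_on k UNIV f \<Longrightarrow> Ck_on k UNIV g \<Longrightarrow> Ck_on k UNIV (\<lambda>x. B (f x) (g x))"
proof -
  interpret bounded_bilinear B by fact
  show "Ck_on k UNIV f \<Longrightarrow> Ck_on k UNIV g \<Longrightarrow> Ck_on k UNIV (\<lambda>x. B (f x) (g x))"
  proof (induction k arbitrary: f g)
    case 0
    then show ?case by (auto intro: continuous_on)
  next
    case (Suc k)
    show ?case
    proof (rule Ck_on_SucI)
      show "((\<lambda>x. B (f x) (g x)) has_derivative
          (\<lambda>v. B (f x) (frechet_derivative g (at x) v) + B (frechet_derivative f (at x) v) (g x))) (at x)" for x
        by (rule FDERIV) (use Ck_on_SucD[OF Suc.prems(1)] Ck_on_SucD[OF Suc.prems(2)] in auto)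
    next
      show "Ck_on k UNIV (\<lambda>x. B (f x) (frechet_derivative g (at x) v) + B (frechet_derivative f (at x) v) (g x))" for v
        by (intro Ck_on_add Suc.IH Ck_on_Suc_imp[OF Suc.prems(1)] Ck_on_Suc_imp[OF Suc.prems(2)]
            Ck_on_SucD[OF Suc.prems(1)] Ck_on_SucD[OF Suc.prems(2)])
    qed
  qed
qed

lemma Ck_on_sum:
  "(\<And>i. i \<in> I \<Longrightarrow> Ck_on k UNIV (f i)) \<Longrightarrow> Ck_on k UNIV (\<lambda>x. \<Sum>i\<in>I. f i x)"
  by (induction I rule: infinite_finite_induct) (auto intro: Ck_on_add Ck_on_const)

text \<open>The chain rule feeds Df the moving direction Dg(x) v, while smoothness of Df is known
  for fixed directions only. Expanding the direction in the basis separates the two and lets the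
  induction hypothesis apply.\<close>

lemma Ck_on_compose:
  fixes f :: "'b::euclidean_space \<Rightarrow> 'c::real_normed_vector" and g :: "'a::real_normed_vector \<Rightarrow> 'b"
  shows "Ck_on k UNIV f \<Longrightarrow> Ck_on k UNIV g \<Longrightarrow> Ck_on k UNIV (\<lambda>x. f (g x))"
proof (induction k arbitrary: f g)
  case 0
  then show ?case by (auto intro: continuous_on_compose2)
next
  case (Suc k)
  have lin: "linear (frechet_derivative f (at y))" for y
    using Ck_on_SucD(1)[OF Suc.prems(1)] has_derivative_linear by blast
  have eq: "frechet_derivative f (at y) w = (\<Sum>b\<in>Basis. (w \<bullet> b) *\<^sub>R frechet_derivative f (at y) b)" for y w
  proof -
    have "frechet_derivative f (at y) w = frechet_derivative f (at y) (\<Sum>b\<in>Basis. (w \<bullet> b) *\<^sub>R b)"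
      by (simp add: euclidean_representation)
    then show ?thesis
      by (simp add: linear_sum[OF lin] linear_cmul[OF lin])
  qed
  show ?case
  proof (rule Ck_on_SucI)
    show "((\<lambda>x. f (g x)) has_derivative
       (\<lambda>v. \<Sum>b\<in>Basis. (frechet_derivative g (at x) v \<bullet> b) *\<^sub>R frechet_derivative f (at (g x)) b)) (at x)" for x
      using has_derivative_compose[OF Ck_on_SucD(1)[OF Suc.prems(2)] Ck_on_SucD(1)[OF Suc.prems(1)], of x]
      by (subst (asm) eq)
  next
    show "Ck_on k UNIV (\<lambda>x. \<Sum>b\<in>Basis. (frechet_derivative g (at x) v \<bullet> b) *\<^sub>R frechet_derivative f (at (g x)) b)" for v
    proof (intro Ck_on_sum Ck_on_bilinear[OF bounded_bilinear_scaleR])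
      fix b :: 'b
      show "Ck_on k UNIV (\<lambda>x. frechet_derivative f (at (g x)) b)"
        using Suc.IH[OF Ck_on_SucD(2)[OF Suc.prems(1)] Ck_on_Suc_imp[OF Suc.prems(2)]] .
      show "Ck_on k UNIV (\<lambda>x. frechet_derivative g (at x) v \<bullet> b)"
        using Ck_on_bounded_linear[OF bounded_linear_inner_left Ck_on_SucD(2)[OF Suc.prems(2)]] .
    qed
  qed
qed

lemma smooth_continuous: "smooth_on UNIV f \<Longrightarrow> continuous_on UNIV f"
  using Ck_on_imp_continuous smooth_on_def by blast

lemma smooth_has_derivative:
  "smooth_on UNIV f \<Longrightarrow> (f has_derivative frechet_derivative f (at x)) (at x)"
  using Ck_on_SucD(1) smooth_on_def by blast

lemma smooth_derivative: "smooth_on UNIV f \<Longrightarrow> smooth_on UNIV (\<lambda>x. frechet_derivative f (at x) v)"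
  using Ck_on_SucD(2) smooth_on_def by blast

lemma smooth_const: "smooth_on UNIV (\<lambda>x. c)"
  by (simp add: smooth_on_def Ck_on_const)

lemma smooth_linear: "bounded_linear h \<Longrightarrow> smooth_on UNIV h"
  by (simp add: smooth_on_def Ck_on_linear)

lemma smooth_bounded_linear: "bounded_linear h \<Longrightarrow> smooth_on UNIV f \<Longrightarrow> smooth_on UNIV (\<lambda>x. h (f x))"
  by (simp add: smooth_on_def Ck_on_bounded_linear)

lemma smooth_bilinear:
  "bounded_bilinear B \<Longrightarrow> smooth_on UNIV f \<Longrightarrow> smooth_on UNIV g \<Longrightarrow> smooth_on UNIV (\<lambda>x. B (f x) (g x))"
  by (simp add: smooth_on_def Ck_on_bilinear)

lemmas smooth_mult = smooth_bilinear[OF bounded_bilinear_mult]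
lemmas smooth_scaleR = smooth_bilinear[OF bounded_bilinear_scaleR]

lemma smooth_add: "smooth_on UNIV f \<Longrightarrow> smooth_on UNIV g \<Longrightarrow> smooth_on UNIV (\<lambda>x. f x + g x)"
  by (simp add: smooth_on_def Ck_on_add)

lemma smooth_diff: "smooth_on UNIV f \<Longrightarrow> smooth_on UNIV g \<Longrightarrow> smooth_on UNIV (\<lambda>x. f x - g x)"
  using smooth_add[OF _ smooth_bounded_linear[OF bounded_linear_minus[OF bounded_linear_ident]], of f g] by simp

lemma smooth_sum: "(\<And>i. i \<in> I \<Longrightarrow> smooth_on UNIV (f i)) \<Longrightarrow> smooth_on UNIV (\<lambda>x. \<Sum>i\<in>I. f i x)"
  by (simp add: smooth_on_def Ck_on_sum)

lemma smooth_prod: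
  fixes f :: "'i \<Rightarrow> 'a::real_normed_vector \<Rightarrow> real"
  shows "(\<And>i. i \<in> I \<Longrightarrow> smooth_on UNIV (f i)) \<Longrightarrow> smooth_on UNIV (\<lambda>x. \<Prod>i\<in>I. f i x)"
  by (induction I rule: infinite_finite_induct) (auto intro: smooth_mult smooth_const)

lemma smooth_compose:
  fixes f :: "'b::euclidean_space \<Rightarrow> 'c::real_normed_vector"
  shows "smooth_on UNIV f \<Longrightarrow> smooth_on UNIV g \<Longrightarrow> smooth_on UNIV (\<lambda>x. f (g x))"
  by (simp add: smooth_on_def Ck_on_compose)

lemma smooth_vec_lambda:
  fixes f :: "'n::finite \<Rightarrow> 'a::real_normed_vector \<Rightarrow> 'b::euclidean_space"
  assumes "\<And>i. smooth_on UNIV (f i)"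
  shows "smooth_on UNIV (\<lambda>x. \<chi> i. f i x)"
proof -
  have "bounded_linear (axis i :: 'b \<Rightarrow> 'b^'n)" for i
    unfolding linear_conv_bounded_linear[symmetric] by (rule linearI) (auto simp: axis_def vec_eq_iff)
  then have "smooth_on UNIV (\<lambda>x. \<Sum>i\<in>UNIV. axis i (f i x))"
    by (intro smooth_sum smooth_bounded_linear[OF _ assms])
  moreover have "(\<Sum>i\<in>UNIV. axis i (f i x)) = (\<chi> i. f i x)" for x
    by (simp add: vec_eq_iff axis_def if_distrib cong: if_cong)
  ultimately show ?thesis by simp
qed

section \<open>Differentiation under the integral sign and symmetry of second derivatives\<close>

lemma parametric_integral_derivative:
  fixes F :: "'a::euclidean_space \<Rightarrow> 'b::euclidean_space \<Rightarrow> 'c::euclidean_space"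
  assumes h: "continuous_on (cbox a b) h"
    and F: "\<And>x t. t \<in> cbox a b \<Longrightarrow> ((\<lambda>x. F x t) has_derivative F' x t) (at x)"
    and cF: "\<And>x. continuous_on (cbox a b) (F x)"
    and F': "\<And>v. continuous_on (UNIV \<times> cbox a b) (\<lambda>(x,t). F' x t v)"
  shows "((\<lambda>x. integral (cbox a b) (\<lambda>t. h t *\<^sub>R F x t)) has_derivative
      (\<lambda>v. integral (cbox a b) (\<lambda>t. h t *\<^sub>R F' x t v))) (at x)"
proof -
  \<comment> \<open>\<open>leibniz_rule\<close> takes the derivative as a continuous map into the
    bounded linear functions. In finite dimensions its continuity follows from continuity in each
    basis direction, which is what the assumption on \<open>F'\<close> gives.\<close>
  define B where "B = (\<lambda>x t. Blinfun (\<lambda>v. h t *\<^sub>R F' x t v))"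
  have B: "blinfun_apply (B x t) = (\<lambda>v. h t *\<^sub>R F' x t v)" if "t \<in> cbox a b" for x t
    unfolding B_def
    by (intro bounded_linear_Blinfun_apply bounded_linear_scaleR_right[THEN bounded_linear_compose]
        has_derivative_bounded_linear[OF F[OF that]])
  have contB: "continuous_on (UNIV \<times> cbox a b) (\<lambda>(x,t). B x t)"
  proof (rule continuous_on_blinfun_componentwise)
    fix i :: 'a
    have "continuous_on (UNIV \<times> cbox a b) (\<lambda>(x,t). h t *\<^sub>R F' x t i)"
      using F'[of i] unfolding split_beta
      by (intro continuous_on_scaleR continuous_on_compose2[OF h] continuous_intros) auto
    then show "continuous_on (UNIV \<times> cbox a b) (\<lambda>x. blinfun_apply (case x of (x, t) \<Rightarrow> B x t) i)"
      by (rule continuous_on_eq) (auto simp: B)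
  qed
  have *: "((\<lambda>x. integral (cbox a b) (\<lambda>t. h t *\<^sub>R F x t)) has_derivative integral (cbox a b) (B x)) (at x within UNIV)"
  proof (rule leibniz_rule[OF _ _ contB])
    show "((\<lambda>x. h t *\<^sub>R F x t) has_derivative blinfun_apply (B x t)) (at x within UNIV)" if "t \<in> cbox a b" for x t
      unfolding B[OF that] by (rule has_derivative_scaleR_right[OF F[OF that]])
    show "(\<lambda>t. h t *\<^sub>R F x t) integrable_on cbox a b" for x
      by (intro integrable_continuous continuous_on_scaleR h cF)
  qed auto
  have "blinfun_apply (integral (cbox a b) (B x)) v = integral (cbox a b) (\<lambda>t. h t *\<^sub>R F' x t v)" for v
  proof -
    have "B x integrable_on cbox a b"
      using continuous_on_compose2[OF contB continuous_on_Pair[OF continuous_on_const continuous_on_id], of x "cbox a b"]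
      by (intro integrable_continuous) auto
    then have "blinfun_apply (integral (cbox a b) (B x)) v = integral (cbox a b) (\<lambda>t. blinfun_apply (B x t) v)"
      using integral_linear[of "B x" "cbox a b" "\<lambda>f. blinfun_apply f v"] by (simp add: o_def blinfun.bounded_linear_left)
    also have "\<dots> = integral (cbox a b) (\<lambda>t. h t *\<^sub>R F' x t v)"
      by (intro integral_cong) (simp add: B)
    finally show ?thesis .
  qed
  then have "blinfun_apply (integral (cbox a b) (B x)) = (\<lambda>v. integral (cbox a b) (\<lambda>t. h t *\<^sub>R F' x t v))"
    by auto
  then show ?thesis using * by simp
qed

lemma smooth_partial_derivative:
  assumes "(f has_derivative f') (at (x,t))"
  shows "((\<lambda>x. f (x,t)) has_derivative (\<lambda>v. f' (v,0))) (at x)"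
proof -
  have "((\<lambda>x. (x,t)) has_derivative (\<lambda>v. (v,0))) (at x)"
    by (auto intro!: derivative_eq_intros)
  from has_derivative_compose[OF this assms] show ?thesis .
qed

text \<open>The derivative in x is F differentiated in the direction (v, 0), again a jointly regular
  integrand, so the induction closes. The weight \<open>h\<close> is never differentiated and may be
  merely continuous: in the mollification it is the function being smoothed.\<close>

lemma Ck_on_parametric_integral:
  fixes F :: "'a::euclidean_space \<times> 'b::euclidean_space \<Rightarrow> 'c::euclidean_space"
  assumes h: "continuous_on (cbox a b) h"
  shows "Ck_on k UNIV F \<Longrightarrow> Ck_on k UNIV (\<lambda>x. integral (cbox a b) (\<lambda>t. h t *\<^sub>R F (x,t)))"
proof (induction k arbitrary: F)
  case 0
  then have "continuous_on (UNIV \<times> cbox a b) (\<lambda>(x,t). h t *\<^sub>R F (x,t))"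
    unfolding split_beta
    by (intro continuous_on_scaleR continuous_on_compose2[OF h] continuous_intros)
      (auto intro: continuous_on_subset)
  then show ?case
    using integral_continuous_on_param[of UNIV a b "\<lambda>x t. h t *\<^sub>R F (x,t)"] by auto
next
  case (Suc k)
  show ?case
  proof (rule Ck_on_SucI)
    show "((\<lambda>x. integral (cbox a b) (\<lambda>t. h t *\<^sub>R F (x,t))) has_derivative
      (\<lambda>v. integral (cbox a b) (\<lambda>t. h t *\<^sub>R frechet_derivative F (at (x,t)) (v,0)))) (at x)" for x
    proof (rule parametric_integral_derivative[OF h])
      show "((\<lambda>x. F (x, t)) has_derivative (\<lambda>v. frechet_derivative F (at (x, t)) (v, 0))) (at x)" for x t
        using Ck_on_SucD(1)[OF Suc.prems] by (rule smooth_partial_derivative)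
      show "continuous_on (cbox a b) (\<lambda>t. F (x, t))" for x
        using Ck_on_imp_continuous[OF Suc.prems] by (rule continuous_on_compose2) (auto intro!: continuous_intros)
      show "continuous_on (UNIV \<times> cbox a b) (\<lambda>(x, t). frechet_derivative F (at (x, t)) (v, 0))" for v
        using Ck_on_imp_continuous[OF Ck_on_SucD(2)[OF Suc.prems, of "(v,0)"]]
        by (auto simp: split_beta intro: continuous_on_subset)
    qed
    show "Ck_on k UNIV (\<lambda>x. integral (cbox a b) (\<lambda>t. h t *\<^sub>R frechet_derivative F (at (x, t)) (v, 0)))" for v
      by (rule Suc.IH) (rule Ck_on_SucD(2)[OF Suc.prems])
  qed
qed

lemma smooth_parametric_integral:
  fixes F :: "'a::euclidean_space \<times> 'b::euclidean_space \<Rightarrow> 'c::euclidean_space"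
  shows "continuous_on (cbox a b) h \<Longrightarrow> smooth_on UNIV F \<Longrightarrow>
    smooth_on UNIV (\<lambda>x. integral (cbox a b) (\<lambda>t. h t *\<^sub>R F (x,t)))"
  by (simp add: smooth_on_def Ck_on_parametric_integral)

lemma has_derivative_along_line:
  assumes "(f has_derivative f') (at (x + s *\<^sub>R v))"
  shows "((\<lambda>s. f (x + s *\<^sub>R v)) has_vector_derivative f' v) (at s)"
proof -
  have "((\<lambda>s. x + s *\<^sub>R v) has_derivative (\<lambda>h. h *\<^sub>R v)) (at s)"
    by (auto intro!: derivative_eq_intros)
  from has_derivative_compose[OF this assms]
  have "((\<lambda>s. f (x + s *\<^sub>R v)) has_derivative (\<lambda>h. f' (h *\<^sub>R v))) (at s)" .
  moreover have "f' (h *\<^sub>R v) = h *\<^sub>R f' v" for h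
    using has_derivative_linear[OF assms] by (simp add: linear_cmul)
  ultimately show ?thesis by (simp add: has_vector_derivative_def)
qed

lemma has_derivative_shift:
  assumes "(f has_derivative f') (at (x + c))"
  shows "((\<lambda>x. f (x + c)) has_derivative f') (at x)"
proof -
  have "((\<lambda>x. x + c) has_derivative (\<lambda>h. h)) (at x)"
    by (auto intro!: derivative_eq_intros)
  from has_derivative_compose[OF this assms] show ?thesis .
qed

text \<open>Differentiate \<open>f (x + t v) - f x = \<integral>\<^sub>0\<^sup>t D\<^sub>v f (x + s v) ds\<close> in the direction
  \<open>w\<close> under the integral, and then with respect to \<open>t\<close> at \<open>0\<close>.\<close>

lemma smooth_second_derivative_symmetric:
  fixes f :: "'a::euclidean_space \<Rightarrow> 'c::euclidean_space"
  assumes f: "smooth_on UNIV f"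
  shows "frechet_derivative (\<lambda>x. frechet_derivative f (at x) w) (at x) v =
         frechet_derivative (\<lambda>x. frechet_derivative f (at x) v) (at x) w"
proof -
  let ?D = "\<lambda>f v x. frechet_derivative f (at x) v"
  have fundamental: "((\<lambda>s. ?D g v (x + s *\<^sub>R v)) has_integral (g (x + t *\<^sub>R v) - g x)) {0..t}"
    if "0 \<le> t" "smooth_on UNIV g" for g :: "'a \<Rightarrow> 'c" and x t
    using fundamental_theorem_of_calculus[OF that(1), of "\<lambda>s. g (x + s *\<^sub>R v)" "\<lambda>s. ?D g v (x + s *\<^sub>R v)"]
      has_derivative_along_line[OF smooth_has_derivative[OF that(2)]]
    by (auto intro: has_vector_derivative_at_within)
  define G where "G = (\<lambda>p. ?D f v (fst p + (snd p :: real) *\<^sub>R v))"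
  have G: "smooth_on UNIV G"
    unfolding G_def
    by (intro smooth_compose[OF smooth_derivative[OF f]] smooth_add smooth_scaleR smooth_linear smooth_const
        bounded_linear_fst bounded_linear_snd)
  have eq1: "?D (?D f v) w (x + s *\<^sub>R v) = frechet_derivative G (at (x,s)) (w,0)" for s
  proof -
    have d1: "((\<lambda>y. G (y,s)) has_derivative (\<lambda>h. ?D (?D f v) h (x + s *\<^sub>R v))) (at x)"
      unfolding G_def fst_conv snd_conv
      by (rule has_derivative_shift[OF smooth_has_derivative[OF smooth_derivative[OF f]]])
    have d2: "((\<lambda>y. G (y,s)) has_derivative (\<lambda>h. frechet_derivative G (at (x,s)) (h,0))) (at x)"
      by (rule smooth_partial_derivative[OF smooth_has_derivative[OF G]])
    from fun_cong[OF has_derivative_unique[OF d1 d2], of w] show ?thesis .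
  qed
  have eq2: "?D f w (x + t *\<^sub>R v) - ?D f w x = integral {0..t} (\<lambda>s. ?D (?D f v) w (x + s *\<^sub>R v))" if t: "t \<ge> 0" for t
  proof -
    have "((\<lambda>y. integral (cbox 0 t) (\<lambda>s. (1::real) *\<^sub>R G (y,s))) has_derivative
        (\<lambda>h. integral (cbox 0 t) (\<lambda>s. (1::real) *\<^sub>R frechet_derivative G (at (x,s)) (h,0)))) (at x)"
    proof (rule parametric_integral_derivative)
      show "((\<lambda>x. G (x, t)) has_derivative (\<lambda>v. frechet_derivative G (at (x, t)) (v, 0))) (at x)" for x t
        by (rule smooth_partial_derivative[OF smooth_has_derivative[OF G]])
      show "continuous_on (cbox 0 t) (\<lambda>t. G (x, t))" for x
        using smooth_continuous[OF G] by (rule continuous_on_compose2) (auto intro!: continuous_intros)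
      show "continuous_on (UNIV \<times> cbox 0 t) (\<lambda>(x, t). frechet_derivative G (at (x, t)) (v, 0))" for v
        using smooth_continuous[OF smooth_derivative[OF G, of "(v,0)"]]
        by (auto simp: split_beta intro: continuous_on_subset)
    qed auto
    moreover have "integral (cbox 0 t) (\<lambda>s. (1::real) *\<^sub>R G (y,s)) = f (y + t *\<^sub>R v) - f y" for y
      using fundamental[OF t f, of y] by (simp add: G_def integral_unique)
    moreover have "((\<lambda>y. f (y + t *\<^sub>R v) - f y) has_derivative (\<lambda>h. ?D f h (x + t *\<^sub>R v) - ?D f h x)) (at x)"
      by (intro has_derivative_diff has_derivative_shift smooth_has_derivative f)
    ultimately have "(\<lambda>h. integral (cbox 0 t) (\<lambda>s. (1::real) *\<^sub>R frechet_derivative G (at (x,s)) (h,0))) = (\<lambda>h. ?D f h (x + t *\<^sub>R v) - ?D f h x)"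
      by (simp only: has_derivative_unique)
    from fun_cong[OF this, of w] show ?thesis by (simp add: eq1)
  qed
  \<comment> \<open>The formula \<open>eq2\<close> is available for t \<ge> 0 only, so the
    derivatives at 0 are one-sided; they are still unique within the interval [0, 1].\<close>
  have "((\<lambda>t. integral {0..t} (\<lambda>s. ?D (?D f v) w (x + s *\<^sub>R v))) has_vector_derivative ?D (?D f v) w x) (at 0 within {0..1})"
  proof -
    have "continuous_on {0..1} (\<lambda>s. ?D (?D f v) w (x + s *\<^sub>R v))"
      by (rule continuous_on_compose2[OF smooth_continuous[OF smooth_derivative[OF smooth_derivative[OF f]]]])
        (auto intro!: continuous_intros)
    from integral_has_vector_derivative[OF this, of 0] show ?thesis by simp
  qed
  then have "((\<lambda>t. ?D f w (x + t *\<^sub>R v) - ?D f w x) has_vector_derivative ?D (?D f v) w x) (at 0 within {0..1})"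
    by (rule has_vector_derivative_transform[rotated 2]) (auto simp: eq2)
  then have d1: "((\<lambda>t. ?D f w (x + t *\<^sub>R v) - ?D f w x) has_vector_derivative ?D (?D f v) w x) (at 0 within cbox 0 1)"
    by simp
  have "((\<lambda>t. ?D f w (x + t *\<^sub>R v)) has_vector_derivative ?D (?D f w) v (x + 0 *\<^sub>R v)) (at 0)"
    by (rule has_derivative_along_line[OF smooth_has_derivative[OF smooth_derivative[OF f]]])
  from has_vector_derivative_diff[OF has_vector_derivative_at_within[OF this] has_vector_derivative_const[of "?D f w x"]]
  have d2: "((\<lambda>t. ?D f w (x + t *\<^sub>R v) - ?D f w x) has_vector_derivative ?D (?D f w) v x) (at 0 within cbox 0 1)"
    by simp
  show ?thesis
    by (rule vector_derivative_unique_within_closed_interval[OF _ _ d2 d1]) auto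
qed

section \<open>Bump functions and the fundamental lemma\<close>

text \<open>The factor \<open>(1 / t) ^ n\<close> makes the family closed under differentiation up
  to linear combinations, so smoothness of exp(-1/t), extended by 0, follows by an induction over
  all n at once.\<close>

definition flat_exp :: "nat \<Rightarrow> real \<Rightarrow> real" where
  "flat_exp n t = (if t > 0 then (1 / t) ^ n * exp (- (1 / t)) else 0)"

text \<open>The term of order n + 2 of the exponential series at 1/t is at most exp(1/t); its two
  extra powers leave the factor \<open>t\<^sup>2\<close>, so that difference quotients at 0 tend to
  0.\<close>

lemma flat_exp_bound: "\<bar>flat_exp n t\<bar> \<le> fact (n + 2) * t\<^sup>2"
proof (cases "t > 0")
  case True
  define x where "x = 1 / t"
  have x: "x > 0" using True by (simp add: x_def)
  have "(\<Sum>i\<in>{n+2}. x ^ i /\<^sub>R fact i) \<le> exp x"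
    unfolding exp_def using x
    by (intro sum_le_suminf summable_exp_generic) auto
  then have "x ^ (n + 2) \<le> fact (n + 2) * exp x"
    by (simp add: divide_simps mult.commute del: fact_Suc power_Suc power_add)
  then have "x ^ (n + 2) * exp (- x) \<le> fact (n + 2)"
    by (simp add: exp_minus field_simps)
  then have "x ^ n * exp (- x) * (x\<^sup>2 * t\<^sup>2) \<le> fact (n + 2) * t\<^sup>2"
    using mult_right_mono[of "x ^ (n + 2) * exp (- x)" "fact (n + 2)" "t\<^sup>2"]
    by (simp add: power_add algebra_simps power2_eq_square)
  moreover have "x\<^sup>2 * t\<^sup>2 = 1" using True by (simp add: x_def power_divide)
  ultimately show ?thesis
    using True x by (simp add: flat_exp_def x_def[symmetric] abs_of_nonneg)
qed (simp add: flat_exp_def)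

lemma flat_exp_has_derivative:
  "(flat_exp n has_real_derivative (flat_exp (n + 2) t - real n * flat_exp (n + 1) t)) (at t)"
proof -
  consider "t > 0" | "t < 0" | "t = 0" by linarith
  then show ?thesis
  proof cases
    case 1
    have "((\<lambda>t. (1 / t) ^ n * exp (- (1 / t))) has_real_derivative
        (1 / t) ^ (n + 2) * exp (- (1 / t)) - real n * ((1 / t) ^ (n + 1) * exp (- (1 / t)))) (at t)"
    proof (cases n)
      case 0
      then show ?thesis using 1
        by (auto intro!: derivative_eq_intros simp: power2_eq_square)
    next
      case (Suc m)
      have "((\<lambda>t. (1 / t) ^ n * exp (- (1 / t))) has_real_derivative
        (1 / t) ^ n * (exp (- (1 / t)) * (1 / t)\<^sup>2) + real n * (1 / t) ^ m * (- ((1 / t)\<^sup>2)) * exp (- (1 / t))) (at t)"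
      proof -
        have d: "((\<lambda>t. 1 / t) has_real_derivative - ((1 / t)\<^sup>2)) (at t)"
          using 1 by (auto intro!: derivative_eq_intros simp: power2_eq_square)
        have "((\<lambda>t. (1 / t) ^ n * exp (- (1 / t))) has_real_derivative
          (1 / t) ^ n * (exp (- (1 / t)) * - (- ((1 / t)\<^sup>2))) +
          (real n * (- ((1 / t)\<^sup>2) * (1 / t) ^ (n - Suc 0))) * exp (- (1 / t))) (at t)"
          by (intro DERIV_mult' DERIV_power DERIV_fun_exp DERIV_minus d)
        then show ?thesis by (simp add: Suc algebra_simps)
      qed
      then show ?thesis
        by (simp add: Suc power_add power2_eq_square algebra_simps add_divide_distrib)
    qed
    then have "(flat_exp n has_real_derivative
        (1 / t) ^ (n + 2) * exp (- (1 / t)) - real n * ((1 / t) ^ (n + 1) * exp (- (1 / t)))) (at t)"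
      by (rule has_field_derivative_transform_within_open[of _ _ _ "{0<..}"]) (use 1 in \<open>auto simp: flat_exp_def\<close>)
    then show ?thesis using 1 by (simp add: flat_exp_def)
  next
    case 2
    have "((\<lambda>t. 0) has_real_derivative 0) (at t)" by simp
    then have "(flat_exp n has_real_derivative 0) (at t)"
      by (rule has_field_derivative_transform_within_open[of _ _ _ "{..<0}"]) (use 2 in \<open>auto simp: flat_exp_def\<close>)
    then show ?thesis using 2 by (simp add: flat_exp_def)
  next
    case 3
    have "((\<lambda>h. flat_exp n h / h) \<longlongrightarrow> 0) (at 0)"
    proof (rule Lim_null_comparison)
      show "\<forall>\<^sub>F h in at 0. norm (flat_exp n h / h) \<le> fact (n + 2) * \<bar>h\<bar>"
      proof (rule eventually_at_filter[THEN iffD2], rule always_eventually, intro allI impI)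
        fix h :: real assume "h \<noteq> 0"
        then have "\<bar>h\<bar> > 0" by simp
        then show "norm (flat_exp n h / h) \<le> fact (n + 2) * \<bar>h\<bar>"
          using flat_exp_bound[of n h]
          by (simp add: pos_divide_le_eq mult.assoc power2_eq_square del: fact_Suc flip: abs_mult)
      qed
      show "((\<lambda>h. fact (n + 2) * \<bar>h\<bar>) \<longlongrightarrow> (0::real)) (at 0)"
        by (auto intro!: tendsto_eq_intros simp del: fact_Suc)
    qed
    then have "(flat_exp n has_real_derivative 0) (at 0)"
      by (simp add: DERIV_def flat_exp_def)
    then show ?thesis using 3 by (simp add: flat_exp_def)
  qed
qed

lemma smooth_flat_exp: "smooth_on UNIV (flat_exp n)"
proof -
  have "Ck_on k UNIV (flat_exp n)" for k
  proof (induction k arbitrary: n)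
    case 0
    show ?case
      using flat_exp_has_derivative[of n]
      by (auto intro!: continuous_at_imp_continuous_on intro: DERIV_isCont)
  next
    case (Suc k)
    show ?case
    proof (rule Ck_on_SucI)
      show "(flat_exp n has_derivative (\<lambda>v. (flat_exp (n + 2) x - real n * flat_exp (n + 1) x) * v)) (at x)" for x
        using flat_exp_has_derivative[of n x] by (simp add: has_field_derivative_def)
      have "Ck_on k UNIV (\<lambda>x. v * flat_exp (n + 2) x + (- v * real n) * flat_exp (n + 1) x)" for v
        by (intro Ck_on_add Ck_on_bilinear[OF bounded_bilinear_mult] Ck_on_const Suc)
      then show "Ck_on k UNIV (\<lambda>x. (flat_exp (n + 2) x - real n * flat_exp (n + 1) x) * v)" for v
        by (simp add: algebra_simps)
    qed
  qed
  then show ?thesis by (simp add: smooth_on_def)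
qed

text \<open>As \<open>m\<close> grows, the bump tends to the indicator of the open box while staying
  between 0 and 1, so indicators of boxes are reached from test functions by dominated convergence.
  With \<open>m\<close> = 1 it is the kernel of the mollification.\<close>

definition box_bump :: "real \<Rightarrow> 'a::euclidean_space \<Rightarrow> 'a \<Rightarrow> 'a \<Rightarrow> real" where
  "box_bump m a b x =
     (\<Prod>i\<in>Basis. flat_exp 0 (m * ((x - a) \<bullet> i)) * flat_exp 0 (m * ((b - x) \<bullet> i)))"

lemma smooth_box_bump: "smooth_on UNIV (box_bump m a b)"
  unfolding box_bump_def
  by (intro smooth_prod smooth_mult smooth_compose[OF smooth_flat_exp] smooth_const
      smooth_bounded_linear[OF bounded_linear_inner_left] smooth_diff smooth_linear bounded_linear_ident)

lemma flat_exp_0: "0 \<le> flat_exp 0 t" "flat_exp 0 t \<le> 1" "t \<le> 0 \<Longrightarrow> flat_exp 0 t = 0" "t > 0 \<Longrightarrow> flat_exp 0 t > 0"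
  by (auto simp: flat_exp_def)

lemma box_bump_bounds: "0 \<le> box_bump m a b x" "box_bump m a b x \<le> 1"
  unfolding box_bump_def
  by (auto intro!: prod_nonneg prod_le_1 mult_nonneg_nonneg mult_le_one flat_exp_0)

lemma box_bump_eq_0: "x \<notin> box a b \<Longrightarrow> m \<ge> 0 \<Longrightarrow> box_bump m a b x = 0"
  unfolding box_bump_def
  by (force simp: mem_box not_less inner_diff_left intro!: flat_exp_0 mult_nonneg_nonpos)

lemma box_bump_pos: "x \<in> box a b \<Longrightarrow> m > 0 \<Longrightarrow> box_bump m a b x > 0"
  unfolding box_bump_def
  by (intro prod_pos) (auto simp: mem_box inner_diff_left intro!: flat_exp_0 mult_pos_pos)

lemma box_bump_tendsto: "(\<lambda>n. box_bump (real n) a b x) \<longlonglongrightarrow> indicator (box a b) x"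
proof (cases "x \<in> box a b")
  case False
  then show ?thesis by (simp add: box_bump_eq_0)
next
  case True
  have flat: "(\<lambda>n. flat_exp 0 (real n * c)) \<longlonglongrightarrow> 1" if "c > 0" for c
  proof -
    have "(\<lambda>n. exp (- ((1 / c) * inverse (real n)))) \<longlonglongrightarrow> exp (- ((1 / c) * 0))"
      by (intro tendsto_intros lim_inverse_n)
    then have "(\<lambda>n. exp (- ((1 / c) * inverse (real n)))) \<longlonglongrightarrow> 1" by simp
    then show ?thesis
      by (rule Lim_transform_eventually)
        (use eventually_gt_at_top[of 0] in eventually_elim, use that in \<open>auto simp: flat_exp_def field_simps\<close>)
  qed
  have "(\<lambda>n. box_bump (real n) a b x) \<longlonglongrightarrow> (\<Prod>i\<in>(Basis::'a set). 1 * 1)"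
    unfolding box_bump_def using True
    by (intro tendsto_prod tendsto_mult flat) (auto simp: mem_box inner_diff_left)
  then show ?thesis using True by simp
qed

text \<open>A compact set outside of which f vanishes is easier to carry through images and
  compositions than the closure of the support itself.\<close>

lemma test_functionsI:
  assumes "smooth_on UNIV f" "compact C" "C \<subseteq> S" "\<And>x. x \<notin> C \<Longrightarrow> f x = 0"
  shows "f \<in> test_functions S"
proof -
  have "closure {x. f x \<noteq> 0} \<subseteq> C"
    by (rule closure_minimal) (use assms compact_imp_closed in auto)
  moreover from this have "compact (closure {x. f x \<noteq> 0})"
    using assms(2) closed_Int_compact[of "closure {x. f x \<noteq> 0}" C] by (simp add: inf.absorb1)
  ultimately show ?thesis
    using assms by (auto simp: test_functions_def)
qed

lemma test_functionsE:
  assumes "f \<in> test_functions S"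
  obtains C where "smooth_on UNIV f" "compact C" "C \<subseteq> S" "\<And>x. x \<notin> C \<Longrightarrow> f x = 0"
proof
  show "f x = 0" if "x \<notin> closure {x. f x \<noteq> 0}" for x
    using that closure_subset[of "{x. f x \<noteq> 0}"] by auto
qed (use assms in \<open>auto simp: test_functions_def\<close>)

lemma box_bump_test_function:
  "cbox a b \<subseteq> S \<Longrightarrow> m \<ge> 0 \<Longrightarrow> box_bump m a b \<in> test_functions S"
  by (rule test_functionsI[of _ "cbox a b"])
    (use box_subset_cbox[of a b] in \<open>auto intro: smooth_box_bump box_bump_eq_0\<close>)

text \<open>Open boxes form an intersection-stable generator of the Borel sets, so vanishing of the
  integral passes from boxes to all Borel sets. As h is only Lebesgue measurable, a Borel
  representative \<open>h'\<close> takes its place.\<close>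

lemma AE_zero_if_box_integrals_zero:
  fixes h :: "'a::euclidean_space \<Rightarrow> real"
  assumes int: "integrable lebesgue h"
    and zero: "\<And>a b. (LINT x|lebesgue. indicator (box a b) x * h x) = 0"
  shows "AE x in lebesgue. h x = 0"
proof -
  obtain h' where h'[measurable]: "h' \<in> borel_measurable lborel" and eq: "AE x in lborel. h x = h' x"
    using completion_ex_borel_measurable_real[of h lborel] int by auto
  have eq': "AE x in lebesgue. h x = h' x" using AE_completion[OF eq] .
  have h'_leb: "h' \<in> borel_measurable lebesgue"
    using h' by (rule measurable_completion)
  have int': "integrable lborel h'"
    using Bochner_Integration.integrable_cong_AE[OF _ h'_leb eq'] int
    by (subst integrable_completion[symmetric]) auto
  have zero': "(LINT x|lborel. indicator (box a b) x * h' x) = 0" for a b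
  proof -
    have "(LINT x|lborel. indicator (box a b) x * h' x) = (LINT x|lebesgue. indicator (box a b) x * h' x)"
      by (rule integral_completion[symmetric]) measurable
    also have "\<dots> = (LINT x|lebesgue. indicator (box a b) x * h x)"
      using int h'_leb eq' by (intro integral_cong_AE borel_measurable_times borel_measurable_indicator) (auto elim: eventually_mono)
    finally show ?thesis using zero by simp
  qed
  have int_A: "integrable lborel (\<lambda>x. indicator A x * h' x)" if "A \<in> sets borel" for A
    using integrable_mult_indicator[OF _ int', of A] that by simp
  have all: "(LINT x|lborel. indicator A x * h' x) = 0" if "A \<in> sets borel" for A
  proof -
    have "Int_stable (range (\<lambda>(a, b). box a b :: 'a set))"
      by (auto simp: Int_stable_def box_Int_box)
    moreover have "range (\<lambda>(a, b). box a b :: 'a set) \<subseteq> Pow UNIV" by simp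
    moreover have "A \<in> sigma_sets UNIV (range (\<lambda>(a, b). box a b :: 'a set))"
      using that unfolding borel_eq_box by simp
    ultimately show ?thesis
    proof (induction rule: sigma_sets_induct_disjoint)
      case (basic A)
      then show ?case using zero' by auto
    next
      case empty
      then show ?case by simp
    next
      case (compl A)
      then have A: "A \<in> sets borel" by (simp add: borel_eq_box)
      \<comment> \<open>Complements require the integral over the whole space, obtained as the limit
        of the integrals over growing boxes.\<close>
      have UN: "(LINT x|lborel. h' x) = 0"
      proof -
        have "(\<lambda>n. LINT x|lborel. indicator (box (- real n *\<^sub>R One) (real n *\<^sub>R One)) x * h' x) \<longlonglongrightarrow> (LINT x|lborel. h' x)"
        proof (rule integral_dominated_convergence[where w = "\<lambda>x. \<bar>h' x\<bar>"])
          show "AE x in lborel. (\<lambda>n. indicator (box (- real n *\<^sub>R One) (real n *\<^sub>R One)) x * h' x) \<longlonglongrightarrow> h' x"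
          proof (rule AE_I2)
            fix x :: 'a
            obtain N where N: "x \<in> box (- real N *\<^sub>R One) (real N *\<^sub>R One)"
              using UNIV_I[of x, folded UN_box_eq_UNIV] by auto
            have "\<forall>\<^sub>F n in sequentially. indicator (box (- real n *\<^sub>R One) (real n *\<^sub>R One)) x * h' x = h' x"
              using eventually_ge_at_top[of N]
            proof eventually_elim
              case (elim n)
              then have "x \<in> box (- real n *\<^sub>R One) (real n *\<^sub>R One)"
                using N by (force simp: mem_box)
              then show ?case by simp
            qed
            then show "(\<lambda>n. indicator (box (- real n *\<^sub>R One) (real n *\<^sub>R One)) x * h' x) \<longlonglongrightarrow> h' x"
              by (rule tendsto_eventually)
          qed
          show "AE x in lborel. norm (indicator (box (- real n *\<^sub>R One) (real n *\<^sub>R One)) x * h' x) \<le> \<bar>h' x\<bar>" for n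
            by (auto simp: indicator_def)
        qed (use int' in auto)
        then show ?thesis using LIMSEQ_unique tendsto_const by (simp only: zero') blast
      qed
      have "(LINT x|lborel. indicator (UNIV - A) x * h' x) = (LINT x|lborel. h' x - indicator A x * h' x)"
        by (intro Bochner_Integration.integral_cong) (auto simp: indicator_def)
      also have "\<dots> = 0"
        using compl A by (subst Bochner_Integration.integral_diff) (auto intro: int' int_A simp: UN)
      finally show ?case .
    next
      case (union F)
      then have F: "F i \<in> sets borel" for i by (auto simp: borel_eq_box)
      have "(LINT x:(\<Union>i. F i)|lborel. h' x) = (\<Sum>i. (LINT x:(F i)|lborel. h' x))"
        by (rule lebesgue_integral_countable_add)
          (use F union.hyps int_A[of "\<Union>i. F i"] in \<open>auto simp: disjoint_family_on_def set_integrable_def\<close>)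
      then show ?case using union.IH by (simp add: set_lebesgue_integral_def)
    qed
  qed
  have "AE x in lborel. h' x = 0"
    by (rule density_unique_real) (use int' all in \<open>auto simp: set_lebesgue_integral_def\<close>)
  with eq have "AE x in lborel. h x = 0" by eventually_elim auto
  then show ?thesis by (rule AE_completion)
qed

section \<open>Locally integrable functions and uniqueness of weak gradients\<close>

lemma AE_lebesgue_on_iff:
  "S \<in> sets lebesgue \<Longrightarrow> (AE x in lebesgue_on S. P x) \<longleftrightarrow> (AE x in lebesgue. x \<in> S \<longrightarrow> P x)"
  by (subst AE_restrict_space_iff) auto

lemma integrable_lebesgue_on_iff:
  fixes f :: "'a::euclidean_space \<Rightarrow> 'b::{banach, second_countable_topology}"
  shows "S \<in> sets lebesgue \<Longrightarrow> integrable (lebesgue_on S) f \<longleftrightarrow> integrable lebesgue (\<lambda>x. indicator S x *\<^sub>R f x)"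
  by (rule integrable_restrict_space) simp

lemma integral_lebesgue_on_eq:
  fixes f :: "'a::euclidean_space \<Rightarrow> 'b::{banach, second_countable_topology}"
  shows "S \<in> sets lebesgue \<Longrightarrow> integral\<^sup>L (lebesgue_on S) f = (LINT x|lebesgue. indicator S x *\<^sub>R f x)"
  by (rule integral_restrict_space) simp

text \<open>Bumps supported in \<Omega> converge to indicators of boxes, so h integrates to 0 over
  every box whose closure lies in \<Omega>.\<close>

lemma fundamental_lemma_calculus_of_variations:
  fixes h :: "real^3 \<Rightarrow> real"
  assumes "open \<Omega>" "locally_integrable \<Omega> h"
    and zero: "\<And>\<phi>. \<phi> \<in> test_functions \<Omega> \<Longrightarrow> (LINT x|lebesgue_on \<Omega>. h x * \<phi> x) = 0"
  shows "AE x in lebesgue_on \<Omega>. h x = 0"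
proof -
  have \<Omega>: "\<Omega> \<in> sets lebesgue" using assms(1) by (simp add: borel_open)
  \<comment> \<open>Local integrability controls h on compact subsets only, so h is cut off to a box
    with closure inside \<Omega>. An arbitrary box is intersected with it, which again gives a
    box.\<close>
  have box: "AE x in lebesgue. indicator (box c d) x * h x = 0" if cd: "cbox c d \<subseteq> \<Omega>" for c d
  proof (rule AE_zero_if_box_integrals_zero)
    have "integrable lebesgue (\<lambda>x. indicator (cbox c d) x *\<^sub>R h x)"
      using assms(2) cd unfolding locally_integrable_def
      by (subst integrable_lebesgue_on_iff[symmetric]) auto
    then have int: "integrable lebesgue (\<lambda>x. indicator (cbox c d) x * h x)" by simp
    have ind: "indicator (box c d) x * (indicator (cbox c d) x * h x) = indicator (box c d) x * h x" for x
      using box_subset_cbox[of c d] by (auto simp: indicator_def)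
    show "integrable lebesgue (\<lambda>x. indicator (box c d) x * h x)"
      using integrable_mult_indicator[OF _ int, of "box c d"] by (simp add: ind)
    fix a b :: "real^3"
    obtain p q where pq: "box a b \<inter> box c d = box p q" using box_Int_box by blast
    show "(LINT x|lebesgue. indicator (box a b) x * (indicator (box c d) x * h x)) = 0"
    proof (cases "box p q = {}")
      case True
      then have "(\<lambda>x. indicator (box a b) x * (indicator (box c d) x * h x)) = (\<lambda>x. 0)"
        using pq by (intro ext) (force simp: indicator_def)
      then show ?thesis by (simp only: Bochner_Integration.integral_zero)
    next
      case False
      have pq_cd: "cbox p q \<subseteq> cbox c d"
        using pq False closure_box[OF False] box_subset_cbox[of c d]
        using closure_minimal[of "box p q" "cbox c d"] by auto
      have "(\<lambda>n. LINT x|lebesgue. box_bump (real n) p q x * (indicator (cbox c d) x * h x))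
          \<longlonglongrightarrow> (LINT x|lebesgue. indicator (box p q) x * (indicator (cbox c d) x * h x))"
      proof (rule integral_dominated_convergence[where w = "\<lambda>x. \<bar>indicator (cbox c d) x * h x\<bar>"])
        have bm: "box_bump m p q \<in> borel_measurable lebesgue" for m
          using borel_measurable_continuous_onI[OF smooth_continuous[OF smooth_box_bump[of m p q]]]
          by (simp add: measurable_completion)
        note meas = borel_measurable_integrable[OF int]
        show "(\<lambda>x. box_bump (real n) p q x * (indicator (cbox c d) x * h x)) \<in> borel_measurable lebesgue" for n
          by (rule borel_measurable_times[OF bm meas])
        show "(\<lambda>x. indicator (box p q) x * (indicator (cbox c d) x * h x)) \<in> borel_measurable lebesgue"
          by (intro borel_measurable_times[OF _ meas] borel_measurable_indicator) auto
        show "integrable lebesgue (\<lambda>x. \<bar>indicator (cbox c d) x * h x\<bar>)"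
          using int by (rule integrable_abs)
        show "AE x in lebesgue. (\<lambda>n. box_bump (real n) p q x * (indicator (cbox c d) x * h x))
            \<longlonglongrightarrow> indicator (box p q) x * (indicator (cbox c d) x * h x)"
          by (intro AE_I2 tendsto_mult box_bump_tendsto tendsto_const)
        show "AE x in lebesgue. norm (box_bump (real n) p q x * (indicator (cbox c d) x * h x)) \<le> \<bar>indicator (cbox c d) x * h x\<bar>" for n
          using box_bump_bounds[of "real n" p q]
          by (intro AE_I2) (simp add: abs_mult mult_left_le_one_le)
      qed
      moreover have "(LINT x|lebesgue. box_bump (real n) p q x * (indicator (cbox c d) x * h x)) = 0" for n
      proof -
        have "box_bump (real n) p q x * (indicator (cbox c d) x * h x) = indicator \<Omega> x *\<^sub>R (h x * box_bump (real n) p q x)" for x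
          using cd pq_cd box_subset_cbox[of p q] box_bump_eq_0[of x p q "real n"] by (auto simp: indicator_def)
        then have "(LINT x|lebesgue. box_bump (real n) p q x * (indicator (cbox c d) x * h x)) = (LINT x|lebesgue_on \<Omega>. h x * box_bump (real n) p q x)"
          by (simp only: integral_lebesgue_on_eq[OF \<Omega>])
        also have "\<dots> = 0"
          using pq_cd cd by (intro zero box_bump_test_function) auto
        finally show ?thesis .
      qed
      ultimately have "(LINT x|lebesgue. indicator (box p q) x * (indicator (cbox c d) x * h x)) = 0"
        by (simp add: LIMSEQ_const_iff)
      moreover have "(\<lambda>x. indicator (box a b) x * (indicator (box c d) x * h x)) = (\<lambda>x. indicator (box p q) x * (indicator (cbox c d) x * h x))"
        using pq box_subset_cbox[of c d] by (intro ext) (force simp: indicator_def)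
      ultimately show ?thesis by (simp only:)
    qed
  qed
  \<comment> \<open>Countably many closed boxes exhaust \<Omega>, and their faces are null
    sets.\<close>
  obtain D where D: "countable D" "D \<subseteq> Pow \<Omega>" "\<And>X. X \<in> D \<Longrightarrow> \<exists>a b. X = cbox a b" "\<Union>D = \<Omega>"
    by (rule open_countable_Union_open_cbox[OF assms(1)]) blast
  have "AE x in lebesgue. x \<in> X \<longrightarrow> h x = 0" if "X \<in> D" for X
  proof -
    obtain a b where X: "X = cbox a b" using D(3)[OF \<open>X \<in> D\<close>] by blast
    have "cbox a b - box a b \<in> null_sets lebesgue"
      using negligible_frontier_interval negligible_iff_null_sets by blast
    then have "AE x in lebesgue. x \<notin> cbox a b - box a b" by (rule AE_not_in)
    moreover have "AE x in lebesgue. indicator (box a b) x * h x = 0"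
      using D(2) that X by (intro box) auto
    ultimately show ?thesis
      unfolding X by eventually_elim (auto simp: indicator_def split: if_splits)
  qed
  then have "AE x in lebesgue. \<forall>X\<in>D. x \<in> X \<longrightarrow> h x = 0"
    by (intro AE_ball_countable[OF D(1), THEN iffD2] ballI)
  then show ?thesis
    unfolding AE_lebesgue_on_iff[OF \<Omega>] by eventually_elim (use D(4) in auto)
qed

text \<open>Since \<open>weak_gradient\<close> is a choice, an explicitly computed gradient can be
  identified with it only through this lemma, applied entry by entry from the fundamental
  lemma.\<close>

lemma has_weak_gradient_unique:
  assumes "open \<Omega>" "has_weak_gradient \<Omega> u D" "has_weak_gradient \<Omega> u D'"
  shows "AE x in lebesgue_on \<Omega>. D x = D' x"
proof -
  have \<Omega>: "\<Omega> \<in> sets lebesgue" using assms(1) by (simp add: borel_open)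
  have comp: "locally_integrable \<Omega> (\<lambda>x. E x $ i $ j)" if "locally_integrable \<Omega> E" for E :: "real^3 \<Rightarrow> real^3^3" and i j
    using that unfolding locally_integrable_def
    by (auto intro!: integrable_bounded_linear[OF bounded_linear_vec_nth])
  have "AE x in lebesgue_on \<Omega>. D x $ i $ j - D' x $ i $ j = 0" for i j
  proof (rule fundamental_lemma_calculus_of_variations[OF assms(1)])
    have c: "locally_integrable \<Omega> (\<lambda>x. D x $ i $ j)" "locally_integrable \<Omega> (\<lambda>x. D' x $ i $ j)"
      using assms comp by (auto simp: has_weak_gradient_def)
    then show "locally_integrable \<Omega> (\<lambda>x. D x $ i $ j - D' x $ i $ j)"
      by (auto simp: locally_integrable_def)
    fix \<phi> :: "real^3 \<Rightarrow> real" assume \<phi>: "\<phi> \<in> test_functions \<Omega>"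
    then obtain C where C: "smooth_on UNIV \<phi>" "compact C" "C \<subseteq> \<Omega>" "\<And>x. x \<notin> C \<Longrightarrow> \<phi> x = 0"
      by (rule test_functionsE) blast
    \<comment> \<open>Integrability is needed to split the integral of the difference, because a
      Bochner integral is 0 when the integrand is not integrable.\<close>
    have int: "integrable (lebesgue_on \<Omega>) (\<lambda>x. k x * \<phi> x)" if "locally_integrable \<Omega> k" for k :: "real^3 \<Rightarrow> real"
    proof -
      have Cs: "C \<in> sets lebesgue" using C(2) by (simp add: compact_imp_closed borel_closed)
      obtain B where B: "\<And>x. \<bar>\<phi> x\<bar> \<le> B"
      proof -
        have "bounded (\<phi> ` C)"
          using C(1,2) by (intro compact_imp_bounded compact_continuous_image) (auto intro: continuous_on_subset[OF smooth_continuous])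
        then obtain B where "\<forall>x\<in>C. \<bar>\<phi> x\<bar> \<le> B" by (auto simp: bounded_iff)
        then have "\<bar>\<phi> x\<bar> \<le> max B 0" for x using C(4)[of x] by (cases "x \<in> C") force+
        then show ?thesis using that by blast
      qed
      have ik: "integrable lebesgue (\<lambda>x. indicator C x *\<^sub>R k x)"
        using that C unfolding locally_integrable_def
        by (subst integrable_lebesgue_on_iff[symmetric, OF Cs]) auto
      have m: "\<phi> \<in> borel_measurable lebesgue"
        using borel_measurable_continuous_onI[OF smooth_continuous[OF C(1)]] by (simp add: measurable_completion)
      have "integrable lebesgue (\<lambda>x. \<phi> x * (indicator C x *\<^sub>R k x))"
      proof (rule Bochner_Integration.integrable_bound[OF integrable_mult_right[OF ik, of B]])
        show "(\<lambda>x. \<phi> x * (indicator C x *\<^sub>R k x)) \<in> borel_measurable lebesgue"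
          by (intro borel_measurable_times[OF m] borel_measurable_integrable[OF ik])
        have "norm (\<phi> x * y) \<le> norm (B * y)" for x y
          using B[of x] mult_right_mono[of "\<bar>\<phi> x\<bar>" "\<bar>B\<bar>" "\<bar>y\<bar>"] by (simp add: abs_mult)
        then show "AE x in lebesgue. norm (\<phi> x * (indicator C x *\<^sub>R k x)) \<le> norm (B * (indicator C x *\<^sub>R k x))"
          by (intro AE_I2)
      qed
      moreover have "\<phi> x * (indicator C x *\<^sub>R k x) = indicator \<Omega> x *\<^sub>R (k x * \<phi> x)" for x
        using C(3,4) by (auto simp: indicator_def)
      ultimately show ?thesis by (simp only: integrable_lebesgue_on_iff[OF \<Omega>])
    qed
    have "(LINT x|lebesgue_on \<Omega>. D x $ i $ j * \<phi> x) = (LINT x|lebesgue_on \<Omega>. D' x $ i $ j * \<phi> x)"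
    proof -
      have "- (LINT x|lebesgue_on \<Omega>. D x $ i $ j * \<phi> x) = - (LINT x|lebesgue_on \<Omega>. D' x $ i $ j * \<phi> x)"
        using assms(2,3) \<phi> unfolding has_weak_gradient_def by auto
      then show ?thesis by simp
    qed
    then show "(LINT x|lebesgue_on \<Omega>. (D x $ i $ j - D' x $ i $ j) * \<phi> x) = 0"
      using int[OF c(1)] int[OF c(2)] by (simp add: left_diff_distrib)
  qed
  then have "AE x in lebesgue_on \<Omega>. \<forall>i j. D x $ i $ j - D' x $ i $ j = 0"
    by (simp add: AE_all_countable)
  then show ?thesis by eventually_elim (simp add: vec_eq_iff)
qed

section \<open>Mollification\<close>

lemma compact_subset_symmetric_cbox:
  fixes C :: "'a::euclidean_space set"
  assumes "compact C"
  obtains R where "R > 0" "C \<subseteq> cbox (- R *\<^sub>R One) (R *\<^sub>R One)"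
proof -
  have "bounded C" using assms compact_imp_bounded by blast
  from bounded_subset_cbox_symmetric[OF this] obtain a where a: "C \<subseteq> cbox (-a) a" by blast
  define R where "R = norm a + 1"
  have "\<bar>a \<bullet> i\<bar> \<le> R" if "i \<in> Basis" for i
    using Basis_le_norm[OF that, of a] by (simp add: R_def)
  then have "cbox (-a) a \<subseteq> cbox (- R *\<^sub>R One) (R *\<^sub>R One)"
    by (intro subset_box_imp) (force simp: abs_le_iff)
  with a show ?thesis using that[of R] by (auto simp: R_def add_nonneg_pos)
qed

lemma has_integral_compact_support_shift:
  fixes f :: "'a::euclidean_space \<Rightarrow> 'b::euclidean_space"
  assumes "continuous_on UNIV f" "\<And>x. x \<notin> cbox a b \<Longrightarrow> f x = 0" "cbox (a - c) (b - c) \<subseteq> S"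
  shows "((\<lambda>x. f (x + c)) has_integral integral (cbox a b) f) S"
proof -
  have "(f has_integral integral (cbox a b) f) (cbox a b)"
    by (intro integrable_integral integrable_continuous) (rule continuous_on_subset[OF assms(1) subset_UNIV])
  from has_integral_affinity'[OF this, of 1 c]
  have "((\<lambda>x. f (x + c)) has_integral integral (cbox a b) f) (cbox (a - c) (b - c))" by simp
  then show ?thesis
  proof (rule has_integral_on_superset[OF _ _ assms(3)])
    fix x assume "x \<notin> cbox (a - c) (b - c)"
    then have "x + c \<notin> cbox a b" by (auto simp: mem_box algebra_simps inner_diff_left)
    then show "f (x + c) = 0" by (rule assms(2))
  qed
qed

lemma derivative_zero_outside_support:
  fixes f :: "'a::real_normed_vector \<Rightarrow> 'b::real_normed_vector"
  assumes "(f has_derivative f') (at x)" "closed C" "\<And>x. x \<notin> C \<Longrightarrow> f x = 0" "x \<notin> C"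
  shows "f' = (\<lambda>h. 0)"
proof -
  have "(f has_derivative (\<lambda>h. 0)) (at x)"
    by (rule has_derivative_transform_within_open[OF has_derivative_const, where s = "- C"])
      (use assms in auto)
  from has_derivative_unique[OF assms(1) this] show ?thesis .
qed

text \<open>The integral of f(x + s v) does not depend on s, by translation invariance;
  differentiating it under the integral sign at s = 0 gives the claim.\<close>

lemma integral_derivative_compact_support:
  fixes f :: "'a::euclidean_space \<Rightarrow> 'b::euclidean_space"
  assumes f: "\<And>x. (f has_derivative f' x) (at x)" and f': "\<And>v. continuous_on UNIV (\<lambda>x. f' x v)"
    and "compact C" "\<And>x. x \<notin> C \<Longrightarrow> f x = 0"
  shows "(LINT x|lebesgue. f' x v) = 0"
proof -
  obtain R where R: "R > 0" "C \<subseteq> cbox (- R *\<^sub>R One) (R *\<^sub>R One)"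
    using compact_subset_symmetric_cbox assms(3) by blast
  \<comment> \<open>The box of this half-width contains every translate of the support box by -s v
    with |s| < 1, so that one domain of integration serves for all s.\<close>
  define Q where "Q = R + norm v"
  have zero: "f x = 0" if "x \<notin> cbox (- R *\<^sub>R One) (R *\<^sub>R One)" for x
    using R(2) assms(4) that by blast
  have cont: "continuous_on UNIV f"
    using f by (intro continuous_at_imp_continuous_on) (auto intro: has_derivative_continuous)
  have const: "integral (cbox (- Q *\<^sub>R One) (Q *\<^sub>R One)) (\<lambda>x. f (x + s *\<^sub>R v)) = integral (cbox (- R *\<^sub>R One) (R *\<^sub>R One)) f"
    if "s \<in> {-1<..<1}" for s
  proof (rule integral_unique, rule has_integral_compact_support_shift[OF cont zero])
    have "\<bar>s * (v \<bullet> i)\<bar> \<le> norm v" if "i \<in> Basis" for i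
    proof -
      have "\<bar>s\<bar> \<le> 1" using \<open>s \<in> {-1<..<1}\<close> by auto
      then show ?thesis
        using mult_mono[of "\<bar>s\<bar>" 1 "\<bar>v \<bullet> i\<bar>" "norm v"] Basis_le_norm[OF that, of v] by (simp add: abs_mult)
    qed
    then show "cbox (- R *\<^sub>R One - s *\<^sub>R v) (R *\<^sub>R One - s *\<^sub>R v) \<subseteq> cbox (- Q *\<^sub>R One) (Q *\<^sub>R One)"
      by (intro subset_box_imp) (force simp: Q_def inner_diff_left abs_le_iff algebra_simps)
  qed
  have "((\<lambda>s. integral (cbox (- Q *\<^sub>R One) (Q *\<^sub>R One)) (\<lambda>x. (1::real) *\<^sub>R f (x + s *\<^sub>R v))) has_derivative
      (\<lambda>h. integral (cbox (- Q *\<^sub>R One) (Q *\<^sub>R One)) (\<lambda>x. (1::real) *\<^sub>R (h *\<^sub>R f' (x + 0 *\<^sub>R v) v)))) (at (0::real))"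
  proof (rule parametric_integral_derivative)
    show "((\<lambda>s. f (x + s *\<^sub>R v)) has_derivative (\<lambda>h. h *\<^sub>R f' (x + s *\<^sub>R v) v)) (at s)" for s x
      using has_derivative_along_line[OF f] by (simp add: has_vector_derivative_def)
    show "continuous_on (cbox (- Q *\<^sub>R One) (Q *\<^sub>R One)) (\<lambda>x. f (x + s *\<^sub>R v))" for s
      by (rule continuous_on_compose2[OF cont]) (auto intro!: continuous_intros)
    show "continuous_on (UNIV \<times> cbox (- Q *\<^sub>R One) (Q *\<^sub>R One)) (\<lambda>(s, x). h *\<^sub>R f' (x + s *\<^sub>R v) v)" for h
      unfolding split_beta
      by (intro continuous_on_scaleR continuous_on_compose2[OF f'] continuous_intros) auto
  qed auto
  moreover have "((\<lambda>s. integral (cbox (- Q *\<^sub>R One) (Q *\<^sub>R One)) (\<lambda>x. (1::real) *\<^sub>R f (x + s *\<^sub>R v))) has_derivative (\<lambda>h. 0)) (at (0::real))"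
  proof (rule has_derivative_transform_within_open[OF has_derivative_const])
    show "integral (cbox (- R *\<^sub>R One) (R *\<^sub>R One)) f =
        integral (cbox (- Q *\<^sub>R One) (Q *\<^sub>R One)) (\<lambda>x. (1::real) *\<^sub>R f (x + s *\<^sub>R v))" if "s \<in> {-1<..<1}" for s
      by (simp only: scaleR_one const[OF that])
  qed auto
  ultimately have "(\<lambda>h. integral (cbox (- Q *\<^sub>R One) (Q *\<^sub>R One)) (\<lambda>x. (1::real) *\<^sub>R (h *\<^sub>R f' (x + 0 *\<^sub>R v) v))) = (\<lambda>h::real. 0)"
    by (rule has_derivative_unique)
  from fun_cong[OF this, of 1] have int0: "integral (cbox (- Q *\<^sub>R One) (Q *\<^sub>R One)) (\<lambda>x. f' x v) = 0" by simp
  have zero': "f' x v = 0" if "x \<notin> cbox (- R *\<^sub>R One) (R *\<^sub>R One)" for x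
    using derivative_zero_outside_support[OF f closed_cbox zero that] by simp
  have sub: "cbox (- R *\<^sub>R One) (R *\<^sub>R One :: 'a) \<subseteq> cbox (- Q *\<^sub>R One) (Q *\<^sub>R One)"
    by (intro subset_box_imp) (auto simp: Q_def)
  have "(\<lambda>x. f' x v) absolutely_integrable_on cbox (- Q *\<^sub>R One) (Q *\<^sub>R One)"
    by (intro absolutely_integrable_continuous continuous_on_subset[OF f']) auto
  then have "(LINT x:cbox (- Q *\<^sub>R One) (Q *\<^sub>R One)|lebesgue. f' x v) = 0"
    using int0 set_lebesgue_integral_eq_integral(2) by metis
  moreover have "indicator (cbox (- Q *\<^sub>R One) (Q *\<^sub>R One)) x *\<^sub>R f' x v = f' x v" for x
    using zero' sub by (auto simp: indicator_def)
  ultimately show ?thesis by (simp add: set_lebesgue_integral_def)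
qed

text \<open>For |y| < 1, either both points lie in the ball of radius r + 1, where f is uniformly
  continuous, or both lie outside the ball of radius r, where f vanishes.\<close>

lemma compact_support_uniformly_continuous:
  fixes f :: "'a::euclidean_space \<Rightarrow> 'b::real_normed_vector"
  assumes "continuous_on UNIV f" "compact C" "\<And>x. x \<notin> C \<Longrightarrow> f x = 0" "e > 0"
  obtains d where "d > 0" "\<And>x y. norm y < d \<Longrightarrow> norm (f (x + y) - f x) < e"
proof -
  obtain r where r: "r > 0" "C \<subseteq> cball 0 r"
    using bounded_subset_ballD[OF compact_imp_bounded[OF assms(2)], of 0] ball_subset_cball by blast
  have "uniformly_continuous_on (cball 0 (r + 1)) f"
    by (intro compact_uniformly_continuous continuous_on_subset[OF assms(1)]) auto
  then obtain d where d: "d > 0" "\<And>x y. x \<in> cball 0 (r+1) \<Longrightarrow> y \<in> cball 0 (r+1) \<Longrightarrow> dist y x < d \<Longrightarrow> dist (f y) (f x) < e"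
    using assms(4) unfolding uniformly_continuous_on_def by meson
  show ?thesis
  proof (rule that[of "min d 1"])
    fix x y :: 'a assume y: "norm y < min d 1"
    show "norm (f (x + y) - f x) < e"
    proof (cases "norm x \<le> r + 1 \<and> norm (x + y) \<le> r + 1")
      case True
      then have "x \<in> cball 0 (r + 1)" "x + y \<in> cball 0 (r + 1)" by (simp_all only: mem_cball_0)
      from d(2)[OF this] show ?thesis using y by (simp add: dist_norm)
    next
      case False
      then have "norm x > r" "norm (x + y) > r"
        using y norm_triangle_ineq[of x y] norm_triangle_ineq4[of "x + y" y] by auto
      then show ?thesis using r(2) assms(3,4) by (metis diff_self mem_cball_0 not_le norm_zero subsetD)
    qed
  qed (use d in auto)
qed

lemma weighted_average_close:
  fixes f :: "'a::euclidean_space \<Rightarrow> real"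
  assumes \<rho>: "continuous_on UNIV \<rho>" "\<And>y. \<rho> y \<ge> 0" and c: "c = integral (cbox a b) \<rho>" "c > 0"
    and f: "continuous_on UNIV f" "\<And>y. y \<in> cbox a b \<Longrightarrow> \<bar>f (x + y) - f x\<bar> \<le> e"
  shows "\<bar>integral (cbox a b) (\<lambda>y. \<rho> y * f (x + y)) / c - f x\<bar> \<le> e"
proof -
  have cf: "continuous_on (cbox a b) (\<lambda>y. f (x + y))"
    by (rule continuous_on_compose2[OF f(1)]) (auto intro!: continuous_intros)
  have c\<rho>: "continuous_on (cbox a b) \<rho>"
    using \<rho>(1) continuous_on_subset by blast
  have "integral (cbox a b) (\<lambda>y. \<rho> y * f (x + y)) - c * f x = integral (cbox a b) (\<lambda>y. \<rho> y * (f (x + y) - f x))"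
    unfolding c(1) using cf c\<rho>
    by (simp add: right_diff_distrib Henstock_Kurzweil_Integration.integral_diff integrable_continuous continuous_on_mult)
  also have "\<bar>\<dots>\<bar> \<le> integral (cbox a b) (\<lambda>y. \<rho> y * e)"
    unfolding real_norm_def[symmetric]
  proof (rule integral_norm_bound_integral)
    show "norm (\<rho> y * (f (x + y) - f x)) \<le> \<rho> y * e" if "y \<in> cbox a b" for y
      using f(2)[OF that] \<rho>(2)[of y] by (simp add: abs_mult mult_left_mono)
  qed (use cf c\<rho> in \<open>auto intro!: integrable_continuous continuous_intros\<close>)
  also have "\<dots> = e * c"
    unfolding c(1) using c\<rho> by (simp add: mult.commute)
  finally have "\<bar>integral (cbox a b) (\<lambda>y. \<rho> y * f (x + y)) - c * f x\<bar> \<le> e * c" .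
  moreover have "integral (cbox a b) (\<lambda>y. \<rho> y * f (x + y)) / c - f x = (integral (cbox a b) (\<lambda>y. \<rho> y * f (x + y)) - c * f x) / c"
    using c(2) by (simp add: field_simps)
  ultimately show ?thesis
    using c(2) by (simp add: pos_divide_le_eq)
qed

text \<open>The local average of f is written in two ways. With the parameter in f, differentiation
  falls on f and shows that the derivatives are close; with the parameter in the kernel,
  differentiation falls on \<open>\<rho>\<close> and shows smoothness.\<close>

lemma mollification:
  fixes f :: "'a::euclidean_space \<Rightarrow> real"
  assumes f: "\<And>x. (f has_derivative f' x) (at x)" and f': "\<And>v. continuous_on UNIV (\<lambda>x. f' x v)"
    and C: "compact C" "C \<subseteq> S" "open S" "\<And>x. x \<notin> C \<Longrightarrow> f x = 0" and e: "e > 0"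
  shows "\<exists>\<eta>\<in>test_functions S. \<forall>x. \<bar>\<eta> x - f x\<bar> \<le> e \<and> (\<forall>v\<in>Basis. \<bar>frechet_derivative \<eta> (at x) v - f' x v\<bar> \<le> e)"
proof -
  have cont: "continuous_on UNIV f"
    using f by (intro continuous_at_imp_continuous_on) (auto intro: has_derivative_continuous)
  have f'_0: "f' x v = 0" if "x \<notin> C" for x v
    using derivative_zero_outside_support[OF f compact_imp_closed[OF C(1)] C(4) that] by simp
  obtain d0 where d0: "d0 > 0" "\<And>x y. norm y < d0 \<Longrightarrow> norm (f (x + y) - f x) < e"
    using compact_support_uniformly_continuous[OF cont C(1,4) e] by blast
  have "\<forall>v. \<exists>d>0. \<forall>x y. norm y < d \<longrightarrow> norm (f' (x + y) v - f' x v) < e"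
    using compact_support_uniformly_continuous[OF f' C(1) f'_0 e] by metis
  then obtain dv where dv: "\<And>v. dv v > 0" "\<And>v x y. norm y < dv v \<Longrightarrow> norm (f' (x + y) v - f' x v) < e"
    by metis
  obtain d1 where d1: "d1 > 0" "(\<Union>x\<in>C. cball x d1) \<subseteq> S"
    using compact_subset_open_imp_cball_epsilon_subset[OF C(1,3,2)] by blast
  \<comment> \<open>The smallest of finitely many scales: closeness of f, room around the support
    inside S, and closeness of f' in each basis direction.\<close>
  define d where "d = Min (insert d0 (insert d1 (dv ` Basis)))"
  have d: "d > 0" "d \<le> d0" "d \<le> d1" "\<And>v. v \<in> Basis \<Longrightarrow> d \<le> dv v"
    unfolding d_def using d0(1) d1(1) dv(1) by (simp_all add: min.coboundedI2)
  \<comment> \<open>A point of the cube \<open>B\<close> has coordinates of modulus at most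
    \<delta>, hence norm at most d / 2.\<close>
  define \<delta> where "\<delta> = d / (2 * DIM('a))"
  have \<delta>: "\<delta> > 0" using d(1) by (simp add: \<delta>_def)
  define B where "B = cbox (- \<delta> *\<^sub>R One) (\<delta> *\<^sub>R One :: 'a)"
  have B_norm: "norm y < d" if "y \<in> B" for y
  proof -
    have "norm y \<le> (\<Sum>i\<in>Basis. \<bar>y \<bullet> i\<bar>)" by (rule norm_le_l1)
    also have "\<dots> \<le> (\<Sum>i\<in>(Basis::'a set). \<delta>)"
      using that by (intro sum_mono) (force simp: B_def mem_box abs_le_iff)
    also have "\<dots> = d / 2" by (simp add: \<delta>_def)
    finally show ?thesis using d(1) by simp
  qed
  define \<rho> where "\<rho> = box_bump 1 (- \<delta> *\<^sub>R One) (\<delta> *\<^sub>R One :: 'a)"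
  have \<rho>: "smooth_on UNIV \<rho>" "\<And>y. \<rho> y \<ge> 0" "\<And>y. y \<notin> B \<Longrightarrow> \<rho> y = 0" "\<rho> 0 > 0"
    using \<delta> box_subset_cbox[of "- \<delta> *\<^sub>R One" "\<delta> *\<^sub>R One :: 'a"]
    by (auto simp: \<rho>_def B_def smooth_box_bump box_bump_bounds mem_box intro!: box_bump_eq_0 box_bump_pos)
  have \<rho>c: "continuous_on X \<rho>" for X
    using smooth_continuous[OF \<rho>(1)] continuous_on_subset by blast
  define c where "c = integral B \<rho>"
  have c: "c > 0"
  proof -
    have "c \<ge> 0"
      unfolding c_def B_def by (intro Henstock_Kurzweil_Integration.integral_nonneg integrable_continuous \<rho>c \<rho>(2))
    moreover have "c \<noteq> 0"
    proof
      assume "c = 0"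
      then have "\<rho> 0 = 0"
        unfolding c_def B_def using \<rho>(2) \<delta>
        by (subst (asm) integral_cbox_eq_0_iff) (auto simp: mem_box box_ne_empty \<rho>c)
      then show False using \<rho>(4) by simp
    qed
    ultimately show ?thesis by simp
  qed
  define \<eta> where "\<eta> = (\<lambda>x. integral B (\<lambda>y. \<rho> y *\<^sub>R f (x + y)) / c)"
  have der: "(\<eta> has_derivative (\<lambda>v. integral B (\<lambda>y. \<rho> y *\<^sub>R f' (x + y) v) / c)) (at x)" for x
  proof -
    have "((\<lambda>x. integral B (\<lambda>y. \<rho> y *\<^sub>R f (x + y))) has_derivative (\<lambda>v. integral B (\<lambda>y. \<rho> y *\<^sub>R f' (x + y) v))) (at x)"
      unfolding B_def
    proof (rule parametric_integral_derivative[OF \<rho>c])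
      show "((\<lambda>x. f (x + t)) has_derivative f' (x + t)) (at x)" for x t by (rule has_derivative_shift[OF f])
      show "continuous_on X (\<lambda>t. f (x + t))" for x X
        by (rule continuous_on_compose2[OF cont]) (auto intro!: continuous_intros)
      show "continuous_on (UNIV \<times> X) (\<lambda>(x, t). f' (x + t) v)" for v X
        unfolding split_beta by (rule continuous_on_compose2[OF f']) (auto intro!: continuous_intros)
    qed
    then show ?thesis
      unfolding \<eta>_def by (rule bounded_linear.has_derivative[OF bounded_linear_divide])
  qed
  obtain R where R: "R > 0" "C \<subseteq> cbox (- R *\<^sub>R One) (R *\<^sub>R One)"
    using compact_subset_symmetric_cbox C(1) by blast
  \<comment> \<open>Substituting y - x for y moves the parameter from f to the kernel, and f becomes
    the continuous weight of \<open>smooth_parametric_integral\<close>.\<close>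
  have alt: "\<eta> x = integral (cbox (- R *\<^sub>R One) (R *\<^sub>R One)) (\<lambda>y. f y *\<^sub>R \<rho> (y - x)) / c" for x
  proof -
    define G where "G = (\<lambda>y. f y * \<rho> (y - x))"
    have cG: "continuous_on UNIV G"
      unfolding G_def by (intro continuous_intros cont continuous_on_compose2[OF \<rho>c[of UNIV]]) auto
    have G0: "G y = 0" if "y \<notin> cbox (- R *\<^sub>R One) (R *\<^sub>R One)" for y
      using that R(2) C(4)[of y] by (auto simp: G_def)
    have "((\<lambda>y. G (y + x)) has_integral integral (cbox (- R *\<^sub>R One) (R *\<^sub>R One)) G) UNIV"
      by (rule has_integral_compact_support_shift[OF cG G0]) auto
    moreover have "((\<lambda>y. G (y + x)) has_integral integral B (\<lambda>y. G (y + x))) UNIV"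
    proof (rule has_integral_on_superset[OF integrable_integral])
      show "(\<lambda>y. G (y + x)) integrable_on B"
        unfolding B_def by (intro integrable_continuous continuous_on_compose2[OF cG]) (auto intro!: continuous_intros)
      show "G (y + x) = 0" if "y \<notin> B" for y using \<rho>(3)[OF that] by (simp add: G_def)
    qed auto
    ultimately have "integral B (\<lambda>y. G (y + x)) = integral (cbox (- R *\<^sub>R One) (R *\<^sub>R One)) G"
      using has_integral_unique by blast
    then show ?thesis by (simp add: \<eta>_def G_def algebra_simps)
  qed
  have "smooth_on UNIV (\<lambda>x. (1 / c) *\<^sub>R integral (cbox (- R *\<^sub>R One) (R *\<^sub>R One)) (\<lambda>y. f y *\<^sub>R (\<lambda>p. \<rho> (snd p - fst p)) (x, y)))"
    by (intro smooth_scaleR smooth_const smooth_parametric_integral continuous_on_subset[OF cont]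
        smooth_compose[OF \<rho>(1)] smooth_diff smooth_linear bounded_linear_fst bounded_linear_snd) auto
  then have smooth: "smooth_on UNIV \<eta>"
    by (simp add: alt[abs_def])
  have "\<eta> \<in> test_functions S"
  proof (rule test_functionsI[OF smooth compact_sums[OF C(1) compact_cball[of 0 d]]])
    have "x + y \<in> S" if "x \<in> C" "y \<in> cball 0 d" for x y
    proof -
      have "x + y \<in> cball x d1" using that d(3) by (simp add: dist_norm)
      then show ?thesis using that(1) d1(2) by blast
    qed
    then show "{x + y |x y. x \<in> C \<and> y \<in> cball 0 d} \<subseteq> S" by blast
    fix x assume x: "x \<notin> {x + y |x y. x \<in> C \<and> y \<in> cball 0 d}"
    have "\<rho> y *\<^sub>R f (x + y) = 0" if "y \<in> B" for y
    proof -
      have "- y \<in> cball 0 d" using B_norm[OF that] by simp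
      then have "x + y \<notin> C" using x by (metis (mono_tags, lifting) add.right_inverse add.right_neutral add.assoc mem_Collect_eq)
      then show ?thesis using C(4) by simp
    qed
    then have "integral B (\<lambda>y. \<rho> y *\<^sub>R f (x + y)) = integral B (\<lambda>y. 0)"
      by (intro integral_cong)
    then show "\<eta> x = 0" by (simp add: \<eta>_def)
  qed
  moreover have "\<bar>\<eta> x - f x\<bar> \<le> e" for x
  proof -
    have "\<bar>f (x + y) - f x\<bar> \<le> e" if "y \<in> cbox (- \<delta> *\<^sub>R One) (\<delta> *\<^sub>R One)" for y
      using d0(2)[of y x] d(2) B_norm[of y] that by (simp add: B_def)
    then show ?thesis
    unfolding \<eta>_def real_scaleR_def B_def
      by (rule weighted_average_close[OF \<rho>c \<rho>(2) c_def[unfolded B_def] c cont])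
  qed
  moreover have "\<bar>frechet_derivative \<eta> (at x) v - f' x v\<bar> \<le> e" if v: "v \<in> Basis" for x v
  proof -
    have "\<bar>f' (x + y) v - f' x v\<bar> \<le> e" if "y \<in> cbox (- \<delta> *\<^sub>R One) (\<delta> *\<^sub>R One)" for y
      using dv(2)[of y v x] d(4)[OF v] B_norm[of y] that by (simp add: B_def)
    then show ?thesis
    unfolding frechet_derivative_at[OF der, symmetric] real_scaleR_def B_def
      by (rule weighted_average_close[OF \<rho>c \<rho>(2) c_def[unfolded B_def] c f'])
  qed
  ultimately show ?thesis by blast
qed

section \<open>Cofactors and the Piola identity\<close>

text \<open>The adjugate formula shows continuity in the entries wherever the determinant does not
  vanish, and it ties the inverse to \<open>cof\<close>, which enters the surface functional and
  Piola's identity.\<close>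

definition minv :: "real^3^3 \<Rightarrow> real^3^3" where
  "minv A = (1 / det A) *\<^sub>R transpose (cof A)"

lemma cof_components:
  "cof A $ 1 $ 1 = A$2$2 * A$3$3 - A$2$3 * A$3$2"
  "cof A $ 1 $ 2 = A$2$3 * A$3$1 - A$2$1 * A$3$3"
  "cof A $ 1 $ 3 = A$2$1 * A$3$2 - A$2$2 * A$3$1"
  "cof A $ 2 $ 1 = A$1$3 * A$3$2 - A$1$2 * A$3$3"
  "cof A $ 2 $ 2 = A$1$1 * A$3$3 - A$1$3 * A$3$1"
  "cof A $ 2 $ 3 = A$1$2 * A$3$1 - A$1$1 * A$3$2"
  "cof A $ 3 $ 1 = A$1$2 * A$2$3 - A$1$3 * A$2$2"
  "cof A $ 3 $ 2 = A$1$3 * A$2$1 - A$1$1 * A$2$3"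
  "cof A $ 3 $ 3 = A$1$1 * A$2$2 - A$1$2 * A$2$1"
  by (simp_all add: cof_def det_3)

lemma mult_transpose_cof: "A ** transpose (cof A) = mat (det A)"
  by (simp add: vec_eq_iff forall_3 matrix_matrix_mult_def transpose_def mat_def det_3
      sum_3 cof_components algebra_simps)

lemma transpose_cof_mult: "transpose (cof A) ** A = mat (det A)"
  by (simp add: vec_eq_iff forall_3 matrix_matrix_mult_def transpose_def mat_def det_3
      sum_3 cof_components algebra_simps)

lemma scaleR_matrix_mult: "(c *\<^sub>R A) ** B = c *\<^sub>R (A ** (B :: real^'n^'m))" "A ** (c *\<^sub>R B) = c *\<^sub>R (A ** (B :: real^'n^'m))"
  by (simp_all add: vec_eq_iff matrix_matrix_mult_def sum_distrib_left mult.assoc mult.left_commute)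

lemma scaleR_mat: "c *\<^sub>R mat d = (mat (c * d) :: real^'n^'n)"
  by (simp add: vec_eq_iff mat_def)

lemma minv_mult:
  assumes "det A \<noteq> 0"
  shows "minv A ** A = mat 1" "A ** minv A = mat 1"
  using assms by (simp_all add: minv_def scaleR_matrix_mult transpose_cof_mult mult_transpose_cof scaleR_mat)

lemma minv_unique:
  assumes "B ** A = mat 1"
  shows "minv A = B"
proof -
  have "det B * det A = 1" using assms det_mul[of B A] by simp
  then have "det A \<noteq> 0" by auto
  then have "B ** (A ** minv A) = B" by (simp add: minv_mult)
  then show ?thesis by (simp add: matrix_mul_assoc assms)
qed

lemma det_minv: "det A \<noteq> 0 \<Longrightarrow> det (minv A) = 1 / det A"
  using minv_mult(1)[of A] det_mul[of "minv A" A] by (simp add: field_simps)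

lemma bounded_bilinear_matrix_mult: "bounded_bilinear ((**) :: real^'n^'m \<Rightarrow> real^'p^'n \<Rightarrow> real^'p^'m)"
proof -
  have "bilinear ((**) :: real^'n^'m \<Rightarrow> real^'p^'n \<Rightarrow> real^'p^'m)"
    unfolding bilinear_def
    by (auto intro!: linearI simp: vec_eq_iff matrix_matrix_mult_def algebra_simps sum.distrib sum_distrib_left)
  then show ?thesis by (simp add: bilinear_conv_bounded_bilinear)
qed

lemma jacobian_component: "jacobian f (at x) $ i $ j = frechet_derivative f (at x) (axis j 1) $ i"
  by (simp add: jacobian_def matrix_def)

lemma jacobianI:
  fixes f :: "real^'n \<Rightarrow> real^'m"
  shows "(f has_derivative (\<lambda>h. A *v h)) (at x) \<Longrightarrow> jacobian f (at x) = A"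
proof -
  assume "(f has_derivative (\<lambda>h. A *v h)) (at x)"
  from frechet_derivative_at[OF this, symmetric] show ?thesis
    by (simp add: jacobian_def matrix_def vec_eq_iff matrix_vector_mult_def axis_def if_distrib cong: if_cong)
qed

lemma smooth_jacobian:
  fixes f :: "real^'n \<Rightarrow> real^'m"
  assumes "smooth_on UNIV f"
  shows "(f has_derivative (\<lambda>h. jacobian f (at x) *v h)) (at x)"
    and "smooth_on UNIV (\<lambda>x. jacobian f (at x) $ i $ j)"
proof -
  show "(f has_derivative (\<lambda>h. jacobian f (at x) *v h)) (at x)"
    using jacobian_works[of f "at x"] smooth_has_derivative[OF assms, of x] by (auto simp: differentiable_def)
  show "smooth_on UNIV (\<lambda>x. jacobian f (at x) $ i $ j)"
    unfolding jacobian_component by (rule smooth_bounded_linear[OF bounded_linear_vec_nth smooth_derivative[OF assms]])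
qed

lemma continuous_jacobian:
  fixes f :: "real^'n \<Rightarrow> real^'m"
  assumes "smooth_on UNIV f"
  shows "continuous_on UNIV (\<lambda>x. jacobian f (at x))"
proof -
  have "continuous_on UNIV (\<lambda>x. \<chi> i j. jacobian f (at x) $ i $ j)"
    by (intro continuous_on_vec_lambda smooth_continuous smooth_jacobian assms)
  then show ?thesis by simp
qed

lemma smooth_cof:
  assumes "\<And>i j. smooth_on UNIV (\<lambda>x. A x $ i $ j)"
  shows "smooth_on UNIV (\<lambda>x. cof (A x) $ i $ j)"
proof -
  have "\<forall>i j. smooth_on UNIV (\<lambda>x. cof (A x) $ i $ j)"
    unfolding forall_3 cof_components by (intro conjI smooth_diff smooth_mult assms)
  then show ?thesis by blast
qed

lemma partial_deriv_mult:
  assumes "smooth_on UNIV f" "smooth_on UNIV g"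
  shows "partial_deriv k (\<lambda>x. f x * g x) x = partial_deriv k f x * g x + f x * partial_deriv k g x"
proof -
  have "((\<lambda>x. f x * g x) has_derivative (\<lambda>h. f x * frechet_derivative g (at x) h + frechet_derivative f (at x) h * g x)) (at x)"
    by (intro has_derivative_mult smooth_has_derivative assms)
  from fun_cong[OF frechet_derivative_at[OF this], of "axis k 1"] show ?thesis by (simp add: partial_deriv_def)
qed

lemma partial_deriv_diff:
  assumes "smooth_on UNIV f" "smooth_on UNIV g"
  shows "partial_deriv k (\<lambda>x. f x - g x) x = partial_deriv k f x - partial_deriv k g x"
proof -
  have "((\<lambda>x. f x - g x) has_derivative (\<lambda>h. frechet_derivative f (at x) h - frechet_derivative g (at x) h)) (at x)"
    by (intro has_derivative_diff smooth_has_derivative assms)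
  from fun_cong[OF frechet_derivative_at[OF this], of "axis k 1"] show ?thesis by (simp add: partial_deriv_def)
qed

lemma smooth_partial_deriv: "smooth_on UNIV f \<Longrightarrow> smooth_on UNIV (partial_deriv k f)"
  unfolding partial_deriv_def[abs_def] by (rule smooth_derivative)

lemma partial_deriv_jacobian_symmetric:
  assumes "smooth_on UNIV \<psi>"
  shows "partial_deriv k (\<lambda>x. jacobian \<psi> (at x) $ i $ j) x = partial_deriv j (\<lambda>x. jacobian \<psi> (at x) $ i $ k) x"
proof -
  have comp: "partial_deriv b (\<lambda>x. jacobian \<psi> (at x) $ i $ a) x =
      frechet_derivative (\<lambda>x. frechet_derivative \<psi> (at x) (axis a 1)) (at x) (axis b 1) $ i" for a b
  proof -
    have "((\<lambda>x. frechet_derivative \<psi> (at x) (axis a 1) $ i) has_derivative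
        (\<lambda>h. frechet_derivative (\<lambda>x. frechet_derivative \<psi> (at x) (axis a 1)) (at x) h $ i)) (at x)"
      by (intro bounded_linear.has_derivative[OF bounded_linear_vec_nth] smooth_has_derivative smooth_derivative assms)
    from fun_cong[OF frechet_derivative_at[OF this], of "axis b 1"] show ?thesis
      by (simp add: partial_deriv_def jacobian_component)
  qed
  show ?thesis
    unfolding comp smooth_second_derivative_symmetric[OF assms, of "axis j 1"] ..
qed

text \<open>The cofactors are 2 x 2 minors of D\<psi>. In the divergence of a row, every product of
  a first and a second derivative occurs twice with opposite signs, by symmetry of second
  derivatives.\<close>

lemma piola_identity:
  assumes \<psi>: "smooth_on UNIV \<psi>"
  shows "(\<Sum>k\<in>UNIV. partial_deriv k (\<lambda>x. cof (jacobian \<psi> (at x)) $ j $ k) x) = 0"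
proof -
  note [simp] = partial_deriv_mult partial_deriv_diff smooth_mult smooth_diff smooth_jacobian(2)[OF \<psi>]
  note sym = partial_deriv_jacobian_symmetric[OF \<psi>]
  have "\<forall>j. (\<Sum>k\<in>UNIV. partial_deriv k (\<lambda>x. cof (jacobian \<psi> (at x)) $ j $ k) x) = 0"
    unfolding sum_3 forall_3 cof_components
    \<comment> \<open>For each pair of columns the symmetry is used in one direction only, so that
      the rewriting terminates.\<close>
    by (simp add: sym[of 2 _ 1] sym[of 3 _ 1] sym[of 3 _ 2] algebra_simps)
  then show ?thesis by blast
qed

lemma partial_deriv_compose:
  fixes \<phi> :: "real^3 \<Rightarrow> real"
  assumes "smooth_on UNIV \<phi>" "smooth_on UNIV \<psi>"
  shows "partial_deriv k (\<lambda>x. \<phi> (\<psi> x)) x = (\<Sum>l\<in>UNIV. partial_deriv l \<phi> (\<psi> x) * jacobian \<psi> (at x) $ l $ k)"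
proof -
  have "((\<lambda>x. \<phi> (\<psi> x)) has_derivative (\<lambda>h. frechet_derivative \<phi> (at (\<psi> x)) (frechet_derivative \<psi> (at x) h))) (at x)"
    using has_derivative_compose[OF smooth_has_derivative[OF assms(2)] smooth_has_derivative[OF assms(1)]] .
  from fun_cong[OF frechet_derivative_at[OF this], of "axis k 1"]
  have "partial_deriv k (\<lambda>x. \<phi> (\<psi> x)) x = frechet_derivative \<phi> (at (\<psi> x)) (frechet_derivative \<psi> (at x) (axis k 1))"
    by (simp add: partial_deriv_def)
  also have "frechet_derivative \<psi> (at x) (axis k 1) = (\<Sum>l\<in>UNIV. (jacobian \<psi> (at x) $ l $ k) *\<^sub>R axis l 1)"
    unfolding jacobian_component scalar_mult_eq_scaleR[symmetric] by (rule basis_expansion[symmetric])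
  also have "frechet_derivative \<phi> (at (\<psi> x)) \<dots> = (\<Sum>l\<in>UNIV. partial_deriv l \<phi> (\<psi> x) * jacobian \<psi> (at x) $ l $ k)"
    using has_derivative_linear[OF smooth_has_derivative[OF assms(1), of "\<psi> x"]]
    by (simp add: linear_sum linear_cmul partial_deriv_def mult.commute)
  finally show ?thesis .
qed

text \<open>By \<open>piola_identity\<close> only the derivative of \<phi>(\<psi>(x)) survives, and
  multiplying it by the cofactors leaves the determinant. A derivative of \<phi> at \<psi>(x) thus
  becomes a divergence in x, which the definition of the weak gradient can absorb.\<close>

lemma piola_transform:
  assumes \<phi>: "smooth_on UNIV \<phi>" and \<psi>: "smooth_on UNIV \<psi>"
  shows "(\<Sum>k\<in>UNIV. partial_deriv k (\<lambda>x. \<phi> (\<psi> x) * cof (jacobian \<psi> (at x)) $ j $ k) x) =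
    partial_deriv j \<phi> (\<psi> x) * det (jacobian \<psi> (at x))"
proof -
  let ?J = "jacobian \<psi> (at x)"
  have \<phi>\<psi>: "smooth_on UNIV (\<lambda>x. \<phi> (\<psi> x))" by (rule smooth_compose[OF \<phi> \<psi>])
  have "(\<Sum>k\<in>UNIV. partial_deriv k (\<lambda>x. \<phi> (\<psi> x) * cof (jacobian \<psi> (at x)) $ j $ k) x) =
     (\<Sum>k\<in>UNIV. partial_deriv k (\<lambda>x. \<phi> (\<psi> x)) x * cof ?J $ j $ k)
     + \<phi> (\<psi> x) * (\<Sum>k\<in>UNIV. partial_deriv k (\<lambda>x. cof (jacobian \<psi> (at x)) $ j $ k) x)"
    by (simp add: partial_deriv_mult[OF \<phi>\<psi> smooth_cof[OF smooth_jacobian(2)[OF \<psi>]]] sum.distrib sum_distrib_left)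
  also have "\<dots> = (\<Sum>k\<in>UNIV. \<Sum>l\<in>UNIV. partial_deriv l \<phi> (\<psi> x) * (?J $ l $ k * cof ?J $ j $ k))"
    unfolding piola_identity[OF \<psi>] partial_deriv_compose[OF \<phi> \<psi>] by (simp add: sum_distrib_right mult.assoc)
  also have "\<dots> = (\<Sum>l\<in>UNIV. partial_deriv l \<phi> (\<psi> x) * (?J ** transpose (cof ?J)) $ l $ j)"
    by (subst sum.swap) (simp add: matrix_matrix_mult_def transpose_def sum_distrib_left)
  also have "\<dots> = partial_deriv j \<phi> (\<psi> x) * det ?J"
    by (simp add: mult_transpose_cof mat_def if_distrib cong: if_cong)
  finally show ?thesis .
qed

section \<open>Almost everywhere equality and Lebesgue measurability\<close>

lemma complete_measure_lebesgue_on: "S \<in> sets lebesgue \<Longrightarrow> complete_measure (lebesgue_on S)"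
  by (rule complete_measure.intro)
    (metis (no_types, lifting) completion.complete null_sets_restrict_space sets_restrict_space_iff inf.orderE
      sets.Int_space_eq2 space_restrict_space null_setsD2 subset_trans null_sets_def completion.complete2 Int_absorb1 sets.sets_into_space)

text \<open>In a complete measure space a set that differs from a measurable one by a null set is
  measurable, so \<open>g\<close> inherits measurability. This allows gradients to be replaced by
  almost everywhere equal ones under integrals.\<close>

lemma measurable_cong_AE_lebesgue_on:
  assumes S: "S \<in> sets lebesgue" and f: "f \<in> measurable (lebesgue_on S) N" and eq: "AE x in lebesgue_on S. f x = g x"
    and g: "\<And>x. x \<in> S \<Longrightarrow> g x \<in> space N"
  shows "g \<in> measurable (lebesgue_on S) N"
proof (rule measurableI)
  interpret complete_measure "lebesgue_on S" by (rule complete_measure_lebesgue_on[OF S])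
  fix A assume A: "A \<in> sets N"
  show "g -` A \<inter> space (lebesgue_on S) \<in> sets (lebesgue_on S)"
    by (rule in_sets_AE[OF _ measurable_sets[OF f A]]) (use eq in \<open>auto elim!: eventually_mono\<close>)
qed (use g in auto)

lemma integral_cong_AE_lebesgue_on:
  fixes f g :: "'a::euclidean_space \<Rightarrow> 'b::{banach, second_countable_topology}"
  assumes S: "S \<in> sets lebesgue" and eq: "AE x in lebesgue_on S. f x = g x"
  shows "integrable (lebesgue_on S) f \<longleftrightarrow> integrable (lebesgue_on S) g"
    and "integral\<^sup>L (lebesgue_on S) f = integral\<^sup>L (lebesgue_on S) g"
proof -
  have eq': "AE x in lebesgue_on S. g x = f x" using eq by eventually_elim simp
  have meas: "f \<in> borel_measurable (lebesgue_on S) \<longleftrightarrow> g \<in> borel_measurable (lebesgue_on S)"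
    by (rule iffI; erule measurable_cong_AE_lebesgue_on[OF S], simp_all add: eq eq')
  show int: "integrable (lebesgue_on S) f \<longleftrightarrow> integrable (lebesgue_on S) g"
    by (metis meas integrable_cong_AE[OF _ _ eq] borel_measurable_integrable)
  show "integral\<^sup>L (lebesgue_on S) f = integral\<^sup>L (lebesgue_on S) g"
    using meas integral_cong_AE[OF _ _ eq] int not_integrable_integral_eq borel_measurable_integrable by metis
qed

lemma integrable_mult_bounded:
  fixes f :: "'a \<Rightarrow> 'b::{banach, second_countable_topology}"
  assumes f: "integrable M f" and g: "g \<in> borel_measurable M" and B: "\<And>x. x \<in> space M \<Longrightarrow> \<bar>g x\<bar> \<le> B"
  shows "integrable M (\<lambda>x. g x *\<^sub>R f x)"
proof (rule Bochner_Integration.integrable_bound[OF integrable_scaleR_right[OF f, of B]])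
  show "(\<lambda>x. g x *\<^sub>R f x) \<in> borel_measurable M"
    by (rule borel_measurable_scaleR[OF g borel_measurable_integrable[OF f]])
  show "AE x in M. norm (g x *\<^sub>R f x) \<le> norm (B *\<^sub>R f x)"
  proof (rule AE_I2)
    fix x assume "x \<in> space M"
    then have "\<bar>g x\<bar> \<le> \<bar>B\<bar>" using B[of x] by linarith
    then show "norm (g x *\<^sub>R f x) \<le> norm (B *\<^sub>R f x)" by (simp add: mult_right_mono)
  qed
qed

section \<open>Approximation and change of variables\<close>

lemma integrable_continuous_compact_support:
  fixes f :: "'a::euclidean_space \<Rightarrow> 'b::euclidean_space"
  assumes "continuous_on UNIV f" "compact C" "\<And>x. x \<notin> C \<Longrightarrow> f x = 0" "S \<in> sets lebesgue"
  shows "integrable (lebesgue_on S) f"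
proof -
  obtain R where R: "C \<subseteq> cbox (- R *\<^sub>R One) (R *\<^sub>R One)"
    using compact_subset_symmetric_cbox assms(2) by blast
  have "f absolutely_integrable_on cbox (- R *\<^sub>R One) (R *\<^sub>R One)"
    by (intro absolutely_integrable_continuous continuous_on_subset[OF assms(1)]) auto
  then have "integrable lebesgue (\<lambda>x. indicator (cbox (- R *\<^sub>R One) (R *\<^sub>R One)) x *\<^sub>R f x)"
    by (simp add: set_integrable_def)
  moreover have "indicator (cbox (- R *\<^sub>R One) (R *\<^sub>R One)) x *\<^sub>R f x = f x" for x
    using R assms(3)[of x] by (auto simp: indicator_def)
  ultimately have "integrable lebesgue f" by simp
  then show ?thesis
    using assms(4) integrable_mult_indicator[of S lebesgue f] by (simp add: integrable_lebesgue_on_iff)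
qed

lemma measurable_continuous_lebesgue_on:
  "continuous_on UNIV f \<Longrightarrow> S \<in> sets lebesgue \<Longrightarrow> f \<in> borel_measurable (lebesgue_on S)"
  using continuous_imp_measurable_on_sets_lebesgue continuous_on_subset by blast

lemma bounded_continuous_compact_support:
  fixes f :: "'a::topological_space \<Rightarrow> 'b::real_normed_vector"
  assumes "continuous_on UNIV f" "compact C" "\<And>x. x \<notin> C \<Longrightarrow> f x = 0"
  obtains B where "B > 0" "\<And>x. norm (f x) \<le> B"
proof -
  have "bounded (f ` C)"
    using assms by (intro compact_imp_bounded compact_continuous_image) (auto intro: continuous_on_subset)
  then obtain B where B: "B > 0" "\<forall>x\<in>C. norm (f x) \<le> B" by (auto simp: bounded_pos)
  have "norm (f x) \<le> B" for x using B assms(3)[of x] by (cases "x \<in> C") auto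
  then show ?thesis using that B(1) by blast
qed

lemma locally_integrable_if_integrable:
  assumes "integrable (lebesgue_on \<Omega>) f" "open \<Omega>"
  shows "locally_integrable \<Omega> f"
  unfolding locally_integrable_def
proof (intro allI impI)
  fix K :: "(real^3) set" assume K: "compact K \<and> K \<subseteq> \<Omega>"
  have \<Omega>: "\<Omega> \<in> sets lebesgue" using assms(2) by (simp add: borel_open)
  have Ks: "K \<in> sets lebesgue" using K by (simp add: compact_imp_closed borel_closed)
  have "integrable lebesgue (\<lambda>x. indicator \<Omega> x *\<^sub>R f x)"
    using assms(1) by (simp only: integrable_lebesgue_on_iff[OF \<Omega>])
  from integrable_mult_indicator[OF Ks this]
  have "integrable lebesgue (\<lambda>x. indicator K x *\<^sub>R (indicator \<Omega> x *\<^sub>R f x))" .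
  moreover have "indicator K x *\<^sub>R (indicator \<Omega> x *\<^sub>R f x) = indicator K x *\<^sub>R f x" for x
    using K by (auto simp: indicator_def)
  ultimately show "integrable (lebesgue_on K) f"
    by (simp only: integrable_lebesgue_on_iff[OF Ks])
qed

text \<open>An open set is a countable union of closed boxes, and local integrability gives
  measurability on each of them.\<close>

lemma locally_integrable_measurable:
  assumes "locally_integrable \<Omega> f" "open \<Omega>"
  shows "f \<in> borel_measurable (lebesgue_on \<Omega>)"
proof -
  obtain D where D: "countable D" "D \<subseteq> Pow \<Omega>" "\<And>X. X \<in> D \<Longrightarrow> \<exists>a b. X = cbox a b" "\<Union>D = \<Omega>"
    by (rule open_countable_Union_open_cbox[OF assms(2)]) blast
  have D': "X \<in> sets lebesgue" "compact X" "X \<subseteq> \<Omega>" if "X \<in> D" for X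
    using D(3)[OF that] D(2) that by auto
  show ?thesis
  proof (rule measurable_piecewise_restrict[OF D(1)])
    show "X \<inter> space (lebesgue_on \<Omega>) \<in> sets (lebesgue_on \<Omega>)" if "X \<in> D" for X
      using D'[OF that] by (simp add: sets_restrict_space_iff Int_absorb2 assms(2) borel_open)
    show "f \<in> borel_measurable (restrict_space (lebesgue_on \<Omega>) X)" if "X \<in> D" for X
    proof -
      have "restrict_space (lebesgue_on \<Omega>) X = lebesgue_on X"
        using D'[OF that] by (subst restrict_restrict_space) (auto simp: assms(2) borel_open Int_absorb1)
      moreover have "integrable (lebesgue_on X) f"
        using assms(1) D'[OF that] by (auto simp: locally_integrable_def)
      ultimately show ?thesis by (simp add: borel_measurable_integrable)
    qed
  qed (use D(4) in auto)
qed

text \<open>On a bounded domain constants are integrable, and |f| \<le> 1 + |f|^2.\<close>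

lemma integrable_if_square_integrable:
  fixes f :: "real^3 \<Rightarrow> 'b::euclidean_space"
  assumes "f \<in> borel_measurable (lebesgue_on \<Omega>)" "integrable (lebesgue_on \<Omega>) (\<lambda>x. (norm (f x))\<^sup>2)"
    and "open \<Omega>" "bounded \<Omega>"
  shows "integrable (lebesgue_on \<Omega>) f"
proof -
  have "finite_measure (lebesgue_on \<Omega>)"
    using assms(3,4) by (intro finite_measure_lebesgue_on lmeasurable_open)
  then have c: "integrable (lebesgue_on \<Omega>) (\<lambda>x. 1 + (norm (f x))\<^sup>2)"
    using assms(2) by (intro Bochner_Integration.integrable_add finite_measure.integrable_const)
  show ?thesis
  proof (rule Bochner_Integration.integrable_bound[OF c assms(1)])
    have "norm (f x) \<le> 1 + (norm (f x))\<^sup>2" for x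
      using sum_squares_ge_zero[of "norm (f x) - 1" 0] zero_le_power2[of "norm (f x)"]
      by (auto simp: power2_eq_square algebra_simps) (smt (verit) norm_ge_zero mult_nonneg_nonneg)
    then show "AE x in lebesgue_on \<Omega>. norm (f x) \<le> norm (1 + (norm (f x))\<^sup>2)"
      by (auto intro!: AE_I2 order_trans[OF _ abs_ge_self])
  qed
qed

lemma matrix_zero_if_mult_zero: "(\<lambda>h. A *v h) = (\<lambda>h. 0) \<Longrightarrow> A = (0 :: real^'n^'m)"
  by (metis matrix_eq matrix_vector_mult_0)

lemma jacobian_zero_outside_support:
  fixes f :: "real^'n \<Rightarrow> real^'m"
  assumes "smooth_on UNIV f" "compact C" "\<And>x. x \<notin> C \<Longrightarrow> f x = 0" "x \<notin> C"
  shows "jacobian f (at x) = 0"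
  using derivative_zero_outside_support[OF smooth_jacobian(1)[OF assms(1)] compact_imp_closed[OF assms(2)] assms(3,4)]
  by (rule matrix_zero_if_mult_zero)

lemma partial_deriv_zero_outside_support:
  assumes "smooth_on UNIV f" "compact C" "\<And>x. x \<notin> C \<Longrightarrow> f x = 0" "x \<notin> C"
  shows "partial_deriv k f x = 0"
  using derivative_zero_outside_support[OF smooth_has_derivative[OF assms(1)] compact_imp_closed[OF assms(2)] assms(3,4)]
  by (simp add: partial_deriv_def)

lemma integrable_mult_compact_support:
  fixes f h :: "'a::euclidean_space \<Rightarrow> real"
  assumes f: "integrable (lebesgue_on S) f" and S: "S \<in> sets lebesgue"
    and h: "continuous_on UNIV h" "compact C" "\<And>x. x \<notin> C \<Longrightarrow> h x = 0"
  shows "integrable (lebesgue_on S) (\<lambda>x. f x * h x)"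
proof -
  obtain B where B: "\<And>x. norm (h x) \<le> B"
    using bounded_continuous_compact_support[OF h] by metis
  have "integrable (lebesgue_on S) (\<lambda>x. h x *\<^sub>R f x)"
    by (rule integrable_mult_bounded[OF f measurable_continuous_lebesgue_on[OF h(1) S]]) (use B in auto)
  then show ?thesis by (simp add: mult.commute)
qed

lemmas integrable_component = integrable_bounded_linear[OF bounded_linear_vec_nth]
lemmas integrable_entry = integrable_component[OF integrable_component]

lemma norm_vec3_le:
  fixes v :: "'v::real_normed_vector^3"
  assumes "\<And>i. norm (v $ i) \<le> b"
  shows "norm v \<le> 3 * b"
proof -
  have "norm v \<le> (\<Sum>i\<in>UNIV. norm (v $ i))"
    unfolding norm_vec_def by (rule L2_set_le_sum) simp
  also have "\<dots> \<le> (\<Sum>i\<in>(UNIV::3 set). b)" by (intro sum_mono assms)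
  finally show ?thesis by simp
qed

lemma continuous_on_matrix_vector_mult:
  fixes A :: "'a::topological_space \<Rightarrow> real^'n^'m"
  shows "continuous_on S A \<Longrightarrow> continuous_on S (\<lambda>x. A x *v v)"
  unfolding matrix_vector_mult_def
  by (intro continuous_on_vec_lambda continuous_on_sum continuous_on_mult continuous_on_component continuous_on_const)

text \<open>Componentwise mollification. It turns compactly supported C^1 maps into test functions,
  as is needed for test functions composed with the inverse of a diffeomorphism.\<close>

lemma C1_approximation:
  fixes f :: "real^3 \<Rightarrow> real^3"
  assumes f: "\<And>x. (f has_derivative (\<lambda>h. A x *v h)) (at x)" and A: "continuous_on UNIV A"
    and C: "compact C" "C \<subseteq> S" "open S" "\<And>x. x \<notin> C \<Longrightarrow> f x = 0" and e: "e > 0"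
  obtains k where "k \<in> test_functions S" "\<And>x. norm (k x - f x) \<le> e" "\<And>x. norm (jacobian k (at x) - A x) \<le> e"
proof -
  \<comment> \<open>The bound \<open>norm_vec3_le\<close> costs a factor 3 for each index, hence e /
    9 for the entries of the Jacobian.\<close>
  have "\<exists>k\<in>test_functions S. \<forall>x. \<bar>k x - f x $ i\<bar> \<le> e / 9 \<and>
      (\<forall>v\<in>Basis. \<bar>frechet_derivative k (at x) v - (A x *v v) $ i\<bar> \<le> e / 9)" for i
  proof (rule mollification[OF _ _ C(1,2,3)])
    show "((\<lambda>x. f x $ i) has_derivative (\<lambda>v. (A x *v v) $ i)) (at x)" for x
      by (rule bounded_linear.has_derivative[OF bounded_linear_vec_nth f])
    show "continuous_on UNIV (\<lambda>x. (A x *v v) $ i)" for v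
      by (intro continuous_on_component continuous_on_matrix_vector_mult A)
  qed (use C e in auto)
  then obtain k where k: "\<And>i. k i \<in> test_functions S" "\<And>i x. \<bar>k i x - f x $ i\<bar> \<le> e / 9"
    "\<And>i x v. v \<in> Basis \<Longrightarrow> \<bar>frechet_derivative (k i) (at x) v - (A x *v v) $ i\<bar> \<le> e / 9"
    by metis
  have sk: "smooth_on UNIV (k i)" for i using k(1)[of i] by (auto simp: test_functions_def)
  define K where "K = (\<lambda>x. \<chi> i. k i x)"
  have sK: "smooth_on UNIV K" unfolding K_def by (rule smooth_vec_lambda[OF sk])
  have jac: "jacobian K (at x) $ i $ j = frechet_derivative (k i) (at x) (axis j 1)" for x i j
  proof -
    have "((\<lambda>x. K x $ i) has_derivative (\<lambda>h. frechet_derivative K (at x) h $ i)) (at x)"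
      by (rule bounded_linear.has_derivative[OF bounded_linear_vec_nth smooth_has_derivative[OF sK]])
    then have "(k i has_derivative (\<lambda>h. frechet_derivative K (at x) h $ i)) (at x)"
      by (simp add: K_def)
    from fun_cong[OF frechet_derivative_at[OF this], of "axis j 1"] show ?thesis
      by (simp add: jacobian_component)
  qed
  show ?thesis
  proof (rule that)
    define Q where "Q = (\<Union>i. closure {x. k i x \<noteq> 0})"
    have "compact Q" unfolding Q_def using k(1) by (intro compact_UN) (auto simp: test_functions_def)
    moreover have "Q \<subseteq> S" unfolding Q_def using k(1) by (auto simp: test_functions_def)
    moreover have "K x = 0" if "x \<notin> Q" for x
      using that closure_subset[of "{x. k _ x \<noteq> 0}"] by (auto simp: K_def Q_def vec_eq_iff)
    ultimately show "K \<in> test_functions S" by (intro test_functionsI[OF sK])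
    show "norm (K x - f x) \<le> e" for x
      using norm_vec3_le[of "K x - f x" "e / 9"] k(2)[of _ x] e by (simp add: K_def)
    have "norm (jacobian K (at x) - A x) \<le> 3 * (3 * (e / 9))" for x
    proof (intro norm_vec3_le)
      fix i j
      have "(A x *v axis j 1) $ i = A x $ i $ j"
        by (simp add: matrix_vector_mult_def axis_def if_distrib cong: if_cong)
      then show "norm ((jacobian K (at x) - A x) $ i $ j) \<le> e / 9"
        using k(3)[of "axis j 1" i x] by (auto simp: jac Basis_vec_def)
    qed
    then show "norm (jacobian K (at x) - A x) \<le> e" for x by simp
  qed
qed

text \<open>Integration by parts: the product \<open>f x $ i * \<phi> x\<close> has compact support,
  so its j-th derivative integrates to 0.\<close>

lemma C1_has_weak_gradient:
  fixes f :: "real^3 \<Rightarrow> real^3"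
  assumes f: "\<And>x. (f has_derivative (\<lambda>h. A x *v h)) (at x)" and A: "continuous_on UNIV A"
    and C: "compact C" "\<And>x. x \<notin> C \<Longrightarrow> f x = 0" and \<Omega>: "open \<Omega>"
  shows "has_weak_gradient \<Omega> f A"
proof -
  have \<Omega>s: "\<Omega> \<in> sets lebesgue" using \<Omega> by (simp add: borel_open)
  have cont: "continuous_on UNIV f"
    using f by (intro continuous_at_imp_continuous_on) (auto intro: has_derivative_continuous)
  have A0: "A x = 0" if "x \<notin> C" for x
    using derivative_zero_outside_support[OF f compact_imp_closed[OF C(1)] C(2) that] by (rule matrix_zero_if_mult_zero)
  have "locally_integrable \<Omega> f" "locally_integrable \<Omega> A"
    by (auto intro!: locally_integrable_if_integrable integrable_continuous_compact_support[OF cont C]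
        integrable_continuous_compact_support[OF A C(1) A0] \<Omega>s \<Omega>)
  moreover have "(LINT x|lebesgue_on \<Omega>. f x $ i * partial_deriv j \<phi> x) = - (LINT x|lebesgue_on \<Omega>. A x $ i $ j * \<phi> x)"
    if \<phi>: "\<phi> \<in> test_functions \<Omega>" for \<phi> i j
  proof -
    obtain Q where Q: "smooth_on UNIV \<phi>" "compact Q" "Q \<subseteq> \<Omega>" "\<And>x. x \<notin> Q \<Longrightarrow> \<phi> x = 0"
      using test_functionsE[OF \<phi>] by metis
    have p0: "partial_deriv j \<phi> x = 0" if "x \<notin> Q" for x
      by (rule partial_deriv_zero_outside_support[OF Q(1,2,4) that])
    note c = smooth_continuous[OF Q(1)] smooth_continuous[OF smooth_partial_deriv[OF Q(1), of j]]
    have cA: "continuous_on UNIV (\<lambda>x. (A x *v v) $ i)" for v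
      by (intro continuous_on_component continuous_on_matrix_vector_mult A)
    have Aj: "(A x *v axis j 1) $ i = A x $ i $ j" for x
      by (simp add: matrix_vector_mult_def axis_def if_distrib cong: if_cong)
    have int: "integrable (lebesgue_on \<Omega>) (\<lambda>x. f x $ i * partial_deriv j \<phi> x)"
      "integrable (lebesgue_on \<Omega>) (\<lambda>x. A x $ i $ j * \<phi> x)"
      using cA[of "axis j 1"] unfolding Aj
      by (auto intro!: integrable_continuous_compact_support[OF _ Q(2)] continuous_on_mult c continuous_on_component cont \<Omega>s simp: p0 Q(4))
    have "(LINT x|lebesgue. f x $ i * frechet_derivative \<phi> (at x) (axis j 1) + (A x *v axis j 1) $ i * \<phi> x) = 0"
    proof (rule integral_derivative_compact_support[OF _ _ Q(2), of "\<lambda>x. f x $ i * \<phi> x"])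
      show "((\<lambda>x. f x $ i * \<phi> x) has_derivative (\<lambda>h. f x $ i * frechet_derivative \<phi> (at x) h + (A x *v h) $ i * \<phi> x)) (at x)" for x
        by (intro has_derivative_mult smooth_has_derivative Q(1) bounded_linear.has_derivative[OF bounded_linear_vec_nth f])
      show "continuous_on UNIV (\<lambda>x. f x $ i * frechet_derivative \<phi> (at x) v + (A x *v v) $ i * \<phi> x)" for v
        by (intro continuous_on_add continuous_on_mult c cA continuous_on_component cont smooth_continuous[OF smooth_derivative[OF Q(1)]])
    qed (use Q(4) in auto)
    moreover have "f x $ i * frechet_derivative \<phi> (at x) (axis j 1) + (A x *v axis j 1) $ i * \<phi> x =
      indicator \<Omega> x *\<^sub>R (f x $ i * partial_deriv j \<phi> x + A x $ i $ j * \<phi> x)" for x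
    proof (cases "x \<in> \<Omega>")
      case False
      then have "x \<notin> Q" using Q(3) by blast
      with Q(4)[of x] p0[of x] show ?thesis by (simp add: partial_deriv_def)
    qed (simp add: Aj partial_deriv_def)
    ultimately have "(LINT x|lebesgue_on \<Omega>. f x $ i * partial_deriv j \<phi> x + A x $ i $ j * \<phi> x) = 0"
      by (simp only: integral_lebesgue_on_eq[OF \<Omega>s])
    then show ?thesis using int by simp
  qed
  ultimately show ?thesis by (auto simp: has_weak_gradient_def)
qed

text \<open>The classical theorem speaks of \<open>real^n\<close>-valued absolutely integrable
  functions and the gauge integral. A real function is read as \<open>real^1\<close>-valued, and the
  result is carried back to Bochner integrals, both of which are 0 when integrability fails.\<close>

lemma change_of_variables_lebesgue_on:
  fixes f :: "real^3 \<Rightarrow> real"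
  assumes S: "S \<in> sets lebesgue" "g ` S \<in> sets lebesgue" and inj: "inj_on g S"
    and g: "\<And>x. x \<in> S \<Longrightarrow> (g has_derivative (\<lambda>h. G x *v h)) (at x within S)"
  shows "integrable (lebesgue_on (g ` S)) f \<longleftrightarrow> integrable (lebesgue_on S) (\<lambda>x. \<bar>det (G x)\<bar> * f (g x))"
    and "(LINT x|lebesgue_on (g ` S). f x) = (LINT x|lebesgue_on S. \<bar>det (G x)\<bar> * f (g x))"
proof -
  define F :: "real^3 \<Rightarrow> real^1" where "F = (\<lambda>x. \<chi> i. f x)"
  have comp: "(\<lambda>x. (\<chi> i. h x) :: real^1) absolutely_integrable_on T \<longleftrightarrow> h absolutely_integrable_on T" for h :: "real^3 \<Rightarrow> real" and T
    by (subst absolutely_integrable_componentwise_iff) (auto simp: Basis_vec_def inner_axis)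
  have iff: "h absolutely_integrable_on T \<longleftrightarrow> integrable (lebesgue_on T) h" if "T \<in> sets lebesgue" for h :: "real^3 \<Rightarrow> real" and T
    by (simp add: set_integrable_def integrable_lebesgue_on_iff[OF that])
  have int_eq: "integral T (\<lambda>x. (\<chi> i. h x) :: real^1) = (\<chi> i. integral T h)" if "h integrable_on T" for h :: "real^3 \<Rightarrow> real" and T
  proof -
    have "(h has_integral integral T h) T" using that by (rule integrable_integral)
    then have "((\<lambda>x. (\<chi> i. h x) :: real^1) has_integral (\<chi> i. integral T h)) T"
      by (subst has_integral_componentwise_iff) (auto simp: Basis_vec_def inner_axis)
    then show ?thesis by (rule integral_unique)
  qed
  have scale: "\<bar>d\<bar> *\<^sub>R (\<chi> i. y) = ((\<chi> i. \<bar>d\<bar> * y) :: real^1)" for d y :: real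
    by (simp add: vec_eq_iff)
  note cov = has_absolute_integral_change_of_variables[OF S(1) g inj, of F]
  have cov': "((\<lambda>x. \<bar>det (G x)\<bar> * f (g x)) absolutely_integrable_on S \<and>
      integral S (\<lambda>x. (\<chi> i. \<bar>det (G x)\<bar> * f (g x)) :: real^1) = b) \<longleftrightarrow> (f absolutely_integrable_on g ` S \<and> integral (g ` S) (\<lambda>x. (\<chi> i. f x) :: real^1) = b)" for b
    using cov[of b] unfolding F_def by (simp add: scale comp)
  show i: "integrable (lebesgue_on (g ` S)) f \<longleftrightarrow> integrable (lebesgue_on S) (\<lambda>x. \<bar>det (G x)\<bar> * f (g x))"
    unfolding iff[OF S(1), symmetric] iff[OF S(2), symmetric] using cov' by blast
  show "(LINT x|lebesgue_on (g ` S). f x) = (LINT x|lebesgue_on S. \<bar>det (G x)\<bar> * f (g x))"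
  proof (cases "integrable (lebesgue_on (g ` S)) f")
    case True
    then have a: "f absolutely_integrable_on g ` S" "(\<lambda>x. \<bar>det (G x)\<bar> * f (g x)) absolutely_integrable_on S"
      using i by (simp_all add: iff S)
    have "(\<chi> i. integral S (\<lambda>x. \<bar>det (G x)\<bar> * f (g x))) = ((\<chi> i. integral (g ` S) f) :: real^1)"
      using cov'[of "integral (g ` S) (\<lambda>x. (\<chi> i. f x))"] a
      by (simp add: int_eq set_lebesgue_integral_eq_integral(1))
    then have "integral S (\<lambda>x. \<bar>det (G x)\<bar> * f (g x)) = integral (g ` S) f"
      by (simp add: vec_eq_iff)
    then show ?thesis
      using True i by (simp add: lebesgue_integral_eq_integral S)
  next
    case False
    then show ?thesis using i by (simp add: not_integrable_integral_eq)
  qed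
qed

section \<open>Transport of Sobolev maps by diffeomorphisms\<close>

lemma smooth_det:
  fixes A :: "'a::real_normed_vector \<Rightarrow> real^3^3"
  assumes "\<And>i j. smooth_on UNIV (\<lambda>x. A x $ i $ j)"
  shows "smooth_on UNIV (\<lambda>x. det (A x))"
  unfolding det_3 by (intro smooth_diff smooth_add smooth_mult assms)

lemma W12D:
  assumes "u \<in> W12 \<Omega>" "open \<Omega>" "bounded \<Omega>"
  shows "u \<in> borel_measurable (lebesgue_on \<Omega>)" "integrable (lebesgue_on \<Omega>) (\<lambda>x. (norm (u x))\<^sup>2)"
    "integrable (lebesgue_on \<Omega>) u" "has_weak_gradient \<Omega> u (weak_gradient \<Omega> u)"
    "weak_gradient \<Omega> u \<in> borel_measurable (lebesgue_on \<Omega>)"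
    "integrable (lebesgue_on \<Omega>) (\<lambda>x. (norm (weak_gradient \<Omega> u x))\<^sup>2)"
    "integrable (lebesgue_on \<Omega>) (weak_gradient \<Omega> u)"
proof -
  show u: "u \<in> borel_measurable (lebesgue_on \<Omega>)" "integrable (lebesgue_on \<Omega>) (\<lambda>x. (norm (u x))\<^sup>2)"
    "integrable (lebesgue_on \<Omega>) (\<lambda>x. (norm (weak_gradient \<Omega> u x))\<^sup>2)"
    using assms(1) by (auto simp: W12_def)
  show D: "has_weak_gradient \<Omega> u (weak_gradient \<Omega> u)"
    using assms(1) someI_ex[of "has_weak_gradient \<Omega> u"] by (simp add: weak_gradient_def W12_def)
  then show m: "weak_gradient \<Omega> u \<in> borel_measurable (lebesgue_on \<Omega>)"
    using locally_integrable_measurable assms(2) by (auto simp: has_weak_gradient_def)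
  show "integrable (lebesgue_on \<Omega>) u" "integrable (lebesgue_on \<Omega>) (weak_gradient \<Omega> u)"
    using integrable_if_square_integrable u m assms by blast+
qed

lemma W12I:
  assumes "u \<in> borel_measurable (lebesgue_on \<Omega>)" "integrable (lebesgue_on \<Omega>) (\<lambda>x. (norm (u x))\<^sup>2)"
    and D: "has_weak_gradient \<Omega> u D" "integrable (lebesgue_on \<Omega>) (\<lambda>x. (norm (D x))\<^sup>2)" and \<Omega>: "open \<Omega>"
  shows "u \<in> W12 \<Omega>" "AE x in lebesgue_on \<Omega>. weak_gradient \<Omega> u x = D x"
proof -
  have "has_weak_gradient \<Omega> u (weak_gradient \<Omega> u)"
    using someI[of "has_weak_gradient \<Omega> u", OF D(1)] by (simp add: weak_gradient_def)
  then show eq: "AE x in lebesgue_on \<Omega>. weak_gradient \<Omega> u x = D x"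
    using has_weak_gradient_unique[OF \<Omega> _ D(1)] by blast
  have "integrable (lebesgue_on \<Omega>) (\<lambda>x. (norm (weak_gradient \<Omega> u x))\<^sup>2)"
    using D(2) by (subst integral_cong_AE_lebesgue_on(1)[of \<Omega> _ "\<lambda>x. (norm (D x))\<^sup>2"])
      (use eq \<Omega> in \<open>auto simp: borel_open elim!: eventually_mono\<close>)
  then show "u \<in> W12 \<Omega>" using assms by (auto simp: W12_def)
qed

text \<open>If P(g x) fails, then x = f (g x) lies in the image under f of the exceptional set of P,
  and differentiable images of null sets are null. Hence differentiability is asked of the map f
  that undoes g.\<close>

lemma AE_lebesgue_on_preimage:
  fixes f g :: "'a::euclidean_space \<Rightarrow> 'a"
  assumes S: "S \<in> sets lebesgue" and P: "AE x in lebesgue_on S. P x"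
    and f: "f differentiable_on UNIV" and g: "\<And>x. x \<in> S \<Longrightarrow> g x \<in> S" "\<And>x. x \<in> S \<Longrightarrow> f (g x) = x"
  shows "AE x in lebesgue_on S. P (g x)"
proof -
  obtain N where N: "negligible N" "{x. \<not> (x \<in> S \<longrightarrow> P x)} \<subseteq> N"
    using P unfolding AE_lebesgue_on_iff[OF S] eventually_ae_filter_negligible by blast
  have "negligible (f ` N)"
    by (rule negligible_differentiable_image_negligible[OF _ N(1)])
      (auto intro: differentiable_on_subset[OF f])
  moreover have "{x. \<not> (x \<in> S \<longrightarrow> P (g x))} \<subseteq> f ` N"
  proof
    fix x assume "x \<in> {x. \<not> (x \<in> S \<longrightarrow> P (g x))}"
    then have x: "x \<in> S" "\<not> P (g x)" by auto
    then have "g x \<in> N" using N(2) g(1) by blast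
    then show "x \<in> f ` N" using g(2)[OF x(1)] by (metis imageI)
  qed
  ultimately show ?thesis
    unfolding AE_lebesgue_on_iff[OF S] eventually_ae_filter_negligible by blast
qed

text \<open>\<open>\<sigma>\<close> is the orientation; it is \<open>-1\<close> for the reflection.\<close>

locale smooth_diffeo =
  fixes \<Omega> :: "(real^3) set" and \<psi> \<eta> :: "real^3 \<Rightarrow> real^3" and \<sigma> C :: real
  assumes open_dom: "open \<Omega>" and bounded_dom: "bounded \<Omega>"
    and smooth: "smooth_on UNIV \<psi>"
    and left_inverse [simp]: "\<And>x. \<eta> (\<psi> x) = x" and right_inverse [simp]: "\<And>x. \<psi> (\<eta> x) = x"
    and image: "\<psi> ` \<Omega> = \<Omega>"
    and cont_inverse: "continuous_on UNIV \<eta>"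
    and det_nonzero: "\<And>x. det (jacobian \<psi> (at x)) \<noteq> 0"
    and sign: "\<And>x. \<sigma> * det (jacobian \<psi> (at x)) = \<bar>det (jacobian \<psi> (at x))\<bar>"
    and bounds: "\<And>x. \<bar>det (jacobian \<psi> (at x))\<bar> \<le> C" "\<And>x. norm (minv (jacobian \<psi> (at x))) \<le> C"
begin

abbreviation J :: "real^3 \<Rightarrow> real^3^3" where "J x \<equiv> jacobian \<psi> (at x)"

lemma dom_sets: "\<Omega> \<in> sets lebesgue"
  using open_dom by (simp add: borel_open)

lemma C_nonneg: "C \<ge> 0"
  using bounds(2)[of 0] norm_ge_zero order_trans by blast

lemma \<psi>_mem: "x \<in> \<Omega> \<Longrightarrow> \<psi> x \<in> \<Omega>"
  using image by blast

lemma \<eta>_mem: "x \<in> \<Omega> \<Longrightarrow> \<eta> x \<in> \<Omega>"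
  using image by (metis imageE left_inverse)

text \<open>Continuity of \<open>\<eta>\<close> and invertibility of D\<psi> give the derivative.
  Only first order regularity of the inverse is derived, so composing with \<open>\<eta>\<close>
  yields C^1 maps, which are mollified where test functions are required.\<close>

lemma inverse_has_derivative: "(\<eta> has_derivative (\<lambda>h. minv (J (\<eta> x)) *v h)) (at x)"
proof (rule has_derivative_inverse_basic[where T = UNIV])
  show "(\<psi> has_derivative (\<lambda>h. J (\<eta> x) *v h)) (at (\<eta> x))"
    by (rule smooth_jacobian(1)[OF smooth])
  show "(\<lambda>h. minv (J (\<eta> x)) *v h) \<circ> (\<lambda>h. J (\<eta> x) *v h) = id"
    by (simp add: fun_eq_iff matrix_vector_mul_assoc minv_mult[OF det_nonzero])
  show "continuous (at x) \<eta>"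
    using cont_inverse by (simp add: continuous_on_eq_continuous_at)
qed (auto simp: matrix_vector_mul_bounded_linear)

lemma differentiable: "\<psi> differentiable_on UNIV" "\<eta> differentiable_on UNIV"
  using smooth_has_derivative[OF smooth] inverse_has_derivative
  by (auto simp: differentiable_on_def differentiable_def)

lemma smooth_det_J: "smooth_on UNIV (\<lambda>x. det (J x))"
  by (intro smooth_det smooth_jacobian smooth)

lemma continuous_minv_J: "continuous_on UNIV (\<lambda>x. minv (J x))"
proof -
  have "continuous_on UNIV (\<lambda>x. \<chi> i j. (1 / det (J x)) * cof (J x) $ j $ i)"
    by (intro continuous_on_vec_lambda continuous_on_mult continuous_on_divide continuous_on_const
        smooth_continuous smooth_cof smooth_jacobian smooth smooth_det_J) (simp add: det_nonzero)
  then show ?thesis by (simp add: minv_def transpose_def scaleR_vec_def)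
qed

lemma AE_\<eta>: "AE x in lebesgue_on \<Omega>. P x \<Longrightarrow> AE x in lebesgue_on \<Omega>. P (\<eta> x)"
  by (rule AE_lebesgue_on_preimage[OF dom_sets _ differentiable(1)]) (auto simp: \<eta>_mem)

lemma cov:
  fixes f :: "real^3 \<Rightarrow> real"
  shows "integrable (lebesgue_on \<Omega>) f \<longleftrightarrow> integrable (lebesgue_on \<Omega>) (\<lambda>x. \<bar>det (J x)\<bar> * f (\<psi> x))"
    and "(LINT x|lebesgue_on \<Omega>. f x) = (LINT x|lebesgue_on \<Omega>. \<bar>det (J x)\<bar> * f (\<psi> x))"
proof -
  have "inj_on \<psi> \<Omega>" by (metis inj_onI left_inverse)
  note c = change_of_variables_lebesgue_on[of \<Omega> \<psi> J, unfolded image, OF dom_sets dom_sets this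
      has_derivative_at_withinI[OF smooth_jacobian(1)[OF smooth]]]
  show "integrable (lebesgue_on \<Omega>) f \<longleftrightarrow> integrable (lebesgue_on \<Omega>) (\<lambda>x. \<bar>det (J x)\<bar> * f (\<psi> x))"
    and "(LINT x|lebesgue_on \<Omega>. f x) = (LINT x|lebesgue_on \<Omega>. \<bar>det (J x)\<bar> * f (\<psi> x))"
    by (rule c)+
qed

text \<open>A preimage under \<open>\<eta>\<close> is an image under \<open>\<psi>\<close>, and
  differentiable maps send Lebesgue sets to Lebesgue sets; continuity of \<open>\<eta>\<close> alone
  would handle Borel sets only.\<close>

lemma measurable_\<eta>:
  assumes f: "f \<in> measurable (lebesgue_on \<Omega>) N"
  shows "(\<lambda>x. f (\<eta> x)) \<in> measurable (lebesgue_on \<Omega>) N"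
proof (rule measurableI)
  fix x assume "x \<in> space (lebesgue_on \<Omega>)"
  then show "f (\<eta> x) \<in> space N" using measurable_space[OF f] \<eta>_mem by simp
next
  fix A assume A: "A \<in> sets N"
  have sub: "B \<in> sets (lebesgue_on \<Omega>) \<longleftrightarrow> B \<subseteq> \<Omega> \<and> B \<in> sets lebesgue" for B
    using dom_sets by (subst sets_restrict_space_iff) auto
  have "f -` A \<inter> \<Omega> \<in> sets lebesgue" using measurable_sets[OF f A] sub by auto
  then have "\<psi> ` (f -` A \<inter> \<Omega>) \<in> sets lebesgue"
    by (rule differentiable_image_in_sets_lebesgue) (auto intro: differentiable_on_subset[OF differentiable(1)])
  moreover have "\<psi> ` (f -` A \<inter> \<Omega>) = (\<lambda>x. f (\<eta> x)) -` A \<inter> \<Omega>"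
  proof (intro set_eqI iffI)
    fix x assume "x \<in> (\<lambda>x. f (\<eta> x)) -` A \<inter> \<Omega>"
    then have "\<eta> x \<in> f -` A \<inter> \<Omega>" using \<eta>_mem by auto
    then show "x \<in> \<psi> ` (f -` A \<inter> \<Omega>)" using image_eqI[of x \<psi> "\<eta> x"] by simp
  qed (auto simp: \<psi>_mem)
  ultimately show "(\<lambda>x. f (\<eta> x)) -` A \<inter> space (lebesgue_on \<Omega>) \<in> sets (lebesgue_on \<Omega>)"
    using sub by simp
qed

lemma measurable_det_J: "(\<lambda>x. \<bar>det (J x)\<bar>) \<in> borel_measurable (lebesgue_on \<Omega>)"
  by (intro measurable_continuous_lebesgue_on continuous_on_rabs smooth_continuous smooth_det_J dom_sets)

lemma integrable_\<eta>:
  fixes f :: "real^3 \<Rightarrow> 'b::euclidean_space"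
  assumes f: "integrable (lebesgue_on \<Omega>) f"
  shows "integrable (lebesgue_on \<Omega>) (\<lambda>x. f (\<eta> x))"
proof -
  have "integrable (lebesgue_on \<Omega>) (\<lambda>x. \<bar>det (J x)\<bar> *\<^sub>R norm (f x))"
    using bounds(1) by (intro integrable_mult_bounded[OF integrable_norm[OF f] measurable_det_J, of C]) simp
  then have "integrable (lebesgue_on \<Omega>) (\<lambda>x. norm (f (\<eta> x)))"
    using cov(1)[of "\<lambda>x. norm (f (\<eta> x))"] by simp
  then show ?thesis
    by (rule integrable_norm_cancel) (rule measurable_\<eta>[OF borel_measurable_integrable[OF f]])
qed

lemma integral_\<eta>_le:
  fixes f :: "real^3 \<Rightarrow> real"
  assumes f: "integrable (lebesgue_on \<Omega>) f" "\<And>x. f x \<ge> 0"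
  shows "(LINT x|lebesgue_on \<Omega>. f (\<eta> x)) \<le> C * (LINT x|lebesgue_on \<Omega>. f x)"
proof -
  have "(LINT x|lebesgue_on \<Omega>. f (\<eta> x)) = (LINT x|lebesgue_on \<Omega>. \<bar>det (J x)\<bar> * f x)"
    using cov(2)[of "\<lambda>x. f (\<eta> x)"] by simp
  also have "\<dots> \<le> (LINT x|lebesgue_on \<Omega>. C * f x)"
  proof (rule integral_mono)
    show "integrable (lebesgue_on \<Omega>) (\<lambda>x. \<bar>det (J x)\<bar> * f x)"
      using bounds(1) integrable_mult_bounded[OF f(1) measurable_det_J, of C] by simp
  qed (use f bounds(1) in \<open>auto intro: mult_right_mono\<close>)
  finally show ?thesis by simp
qed

text \<open>The chain rule for u(\<eta>(x)) with \<open>D\<close> in the place of Du: the derivative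
  of \<eta> at x is the inverse of D\<psi> at \<eta>(x).\<close>

definition push_gradient :: "(real^3 \<Rightarrow> real^3^3) \<Rightarrow> real^3 \<Rightarrow> real^3^3" where
  "push_gradient D x = D (\<eta> x) ** minv (J (\<eta> x))"

lemma measurable_push_gradient:
  assumes "D \<in> borel_measurable (lebesgue_on \<Omega>)"
  shows "push_gradient D \<in> borel_measurable (lebesgue_on \<Omega>)"
proof -
  have "(\<lambda>x. D x ** minv (J x)) \<in> borel_measurable (lebesgue_on \<Omega>)"
    by (rule borel_measurable_continuous_Pair[OF assms measurable_continuous_lebesgue_on[OF continuous_minv_J dom_sets]])
      (intro bounded_bilinear.continuous_on[OF bounded_bilinear_matrix_mult] continuous_on_fst continuous_on_snd continuous_on_id)
  from measurable_\<eta>[OF this] show ?thesis by (simp add: push_gradient_def[abs_def])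
qed

lemma push_gradient_bound:
  obtains K where "K > 0" "\<And>D x. norm (push_gradient D x) \<le> K * norm (D (\<eta> x))"
proof -
  obtain K where K: "K > 0" "\<And>(A :: real^3^3) (B :: real^3^3). norm (A ** B) \<le> norm A * norm B * K"
    using bounded_bilinear.pos_bounded[OF bounded_bilinear_matrix_mult] by blast
  \<comment> \<open>The constant C is only known to be nonnegative; C + 1 keeps the bound
    positive.\<close>
  have "norm (push_gradient D x) \<le> K * (C + 1) * norm (D (\<eta> x))" for D x
  proof -
    have "norm (push_gradient D x) \<le> norm (D (\<eta> x)) * norm (minv (J (\<eta> x))) * K"
      unfolding push_gradient_def by (rule K(2))
    also have "\<dots> \<le> norm (D (\<eta> x)) * (C + 1) * K"
      using bounds(2)[of "\<eta> x"] K(1) by (intro mult_right_mono mult_left_mono) auto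
    finally show ?thesis by (simp add: algebra_simps)
  qed
  then show ?thesis using that[of "K * (C + 1)"] K(1) C_nonneg by (simp add: add_nonneg_pos)
qed

lemma push_gradient_square_integrable:
  assumes m: "D \<in> borel_measurable (lebesgue_on \<Omega>)" and i: "integrable (lebesgue_on \<Omega>) (\<lambda>x. (norm (D x))\<^sup>2)"
  shows "integrable (lebesgue_on \<Omega>) (\<lambda>x. (norm (push_gradient D x))\<^sup>2)"
proof -
  obtain K where K: "K > 0" "\<And>D x. norm (push_gradient D x) \<le> K * norm (D (\<eta> x))"
    using push_gradient_bound by blast
  show ?thesis
  proof (rule Bochner_Integration.integrable_bound[OF integrable_mult_right[OF integrable_\<eta>[OF i], of "K\<^sup>2"]])
    show "(\<lambda>x. (norm (push_gradient D x))\<^sup>2) \<in> borel_measurable (lebesgue_on \<Omega>)"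
      using measurable_push_gradient[OF m] by measurable
    have "(norm (push_gradient D x))\<^sup>2 \<le> K\<^sup>2 * (norm (D (\<eta> x)))\<^sup>2" for x
      using power_mono[OF K(2)[of D x], of 2] by (simp add: power_mult_distrib)
    then show "AE x in lebesgue_on \<Omega>. norm ((norm (push_gradient D x))\<^sup>2) \<le> norm (K\<^sup>2 * (norm (D (\<eta> x)))\<^sup>2)"
      by simp
  qed
qed

text \<open>After the change of variables, \<open>piola_transform\<close> rewrites the derivative of
  \<phi> at \<psi>(x) times det D\<psi> as the divergence of the field \<open>\<Phi>\<close>, whose
  components are test functions, so the weak gradient of u applies. The sign \<open>\<sigma>\<close>
  mediates between |det D\<psi>| and the determinant in Piola's identity.\<close>

lemma has_weak_gradient_push:
  assumes wg: "has_weak_gradient \<Omega> u D"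
    and u: "integrable (lebesgue_on \<Omega>) u" and D: "integrable (lebesgue_on \<Omega>) D"
  shows "has_weak_gradient \<Omega> (\<lambda>x. u (\<eta> x)) (push_gradient D)"
proof -
  obtain K where K: "K > 0" "\<And>D x. norm (push_gradient D x) \<le> K * norm (D (\<eta> x))"
    using push_gradient_bound by blast
  have "integrable (lebesgue_on \<Omega>) (push_gradient D)"
  proof (rule Bochner_Integration.integrable_bound[OF integrable_scaleR_right[OF integrable_\<eta>[OF D], of K]])
    show "push_gradient D \<in> borel_measurable (lebesgue_on \<Omega>)"
      using measurable_push_gradient[OF borel_measurable_integrable[OF D]] .
  qed (use K in auto)
  then have loc: "locally_integrable \<Omega> (\<lambda>x. u (\<eta> x))" "locally_integrable \<Omega> (push_gradient D)"
    using integrable_\<eta>[OF u] by (auto intro: locally_integrable_if_integrable open_dom)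
  have "(LINT x|lebesgue_on \<Omega>. u (\<eta> x) $ i * partial_deriv j \<phi> x) = - (LINT x|lebesgue_on \<Omega>. push_gradient D x $ i $ j * \<phi> x)"
    if \<phi>: "\<phi> \<in> test_functions \<Omega>" for \<phi> i j
  proof -
    obtain Q where Q: "smooth_on UNIV \<phi>" "compact Q" "Q \<subseteq> \<Omega>" "\<And>x. x \<notin> Q \<Longrightarrow> \<phi> x = 0"
      using test_functionsE[OF \<phi>] by metis
    define \<Phi> where "\<Phi> = (\<lambda>k x. \<phi> (\<psi> x) * cof (J x) $ j $ k)"
    have s\<Phi>: "smooth_on UNIV (\<Phi> k)" for k
      unfolding \<Phi>_def by (intro smooth_mult smooth_compose[OF Q(1)] smooth smooth_cof smooth_jacobian)
    have cQ: "compact (\<eta> ` Q)"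
      by (intro compact_continuous_image continuous_on_subset[OF cont_inverse] Q) auto
    have \<Phi>0: "\<Phi> k x = 0" if "x \<notin> \<eta> ` Q" for k x
    proof -
      have "\<psi> x \<notin> Q" using that by (metis imageI left_inverse)
      then show ?thesis using Q(4) by (simp add: \<Phi>_def)
    qed
    have p\<Phi>0: "partial_deriv k (\<Phi> k) x = 0" if "x \<notin> \<eta> ` Q" for k x
      by (rule partial_deriv_zero_outside_support[OF s\<Phi> cQ \<Phi>0 that])
    have \<Phi>: "\<Phi> k \<in> test_functions \<Omega>" for k
      by (rule test_functionsI[OF s\<Phi> cQ]) (use \<eta>_mem Q(3) \<Phi>0 in auto)
    have int: "integrable (lebesgue_on \<Omega>) (\<lambda>x. u x $ i * partial_deriv k (\<Phi> k) x)" for k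
      by (intro integrable_mult_compact_support[OF integrable_component[OF u] dom_sets _ cQ] p\<Phi>0
          smooth_continuous smooth_partial_deriv s\<Phi>)
    have intD: "integrable (lebesgue_on \<Omega>) (\<lambda>x. D x $ i $ k * \<Phi> k x)" for k
      by (intro integrable_mult_compact_support[OF integrable_entry[OF D] dom_sets _ cQ] \<Phi>0 smooth_continuous s\<Phi>)
    have "(LINT x|lebesgue_on \<Omega>. u (\<eta> x) $ i * partial_deriv j \<phi> x) =
        (LINT x|lebesgue_on \<Omega>. \<bar>det (J x)\<bar> * (u x $ i * partial_deriv j \<phi> (\<psi> x)))"
      by (subst cov(2)) simp
    also have "\<dots> = (LINT x|lebesgue_on \<Omega>. (\<Sum>k\<in>UNIV. \<sigma> * (u x $ i * partial_deriv k (\<Phi> k) x)))"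
      unfolding sum_distrib_left[symmetric] \<Phi>_def piola_transform[OF Q(1) smooth] sign[symmetric]
      by (simp add: algebra_simps)
    also have "\<dots> = (\<Sum>k\<in>UNIV. \<sigma> * (LINT x|lebesgue_on \<Omega>. u x $ i * partial_deriv k (\<Phi> k) x))"
      by (subst Bochner_Integration.integral_sum)
        (auto intro!: integrable_mult_right int simp del: integrable_mult_right_iff)
    also have "\<dots> = (\<Sum>k\<in>UNIV. \<sigma> * - (LINT x|lebesgue_on \<Omega>. D x $ i $ k * \<Phi> k x))"
      using wg \<Phi> by (simp add: has_weak_gradient_def)
    also have "\<dots> = - (LINT x|lebesgue_on \<Omega>. (\<Sum>k\<in>UNIV. \<sigma> * (D x $ i $ k * \<Phi> k x)))"
      by (subst Bochner_Integration.integral_sum)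
        (auto intro!: integrable_mult_right intD simp: sum_negf simp del: integrable_mult_right_iff)
    also have "(LINT x|lebesgue_on \<Omega>. (\<Sum>k\<in>UNIV. \<sigma> * (D x $ i $ k * \<Phi> k x))) =
        (LINT x|lebesgue_on \<Omega>. \<bar>det (J x)\<bar> * (push_gradient D (\<psi> x) $ i $ j * \<phi> (\<psi> x)))"
    proof (rule Bochner_Integration.integral_cong[OF refl])
      fix x
      \<comment> \<open>The determinant times \<open>minv\<close> is the transposed cofactor matrix,
        so the cofactors left by \<open>\<Phi>\<close> assemble to the pushed gradient.\<close>
      have "\<bar>det (J x)\<bar> * (push_gradient D (\<psi> x) $ i $ j) = \<sigma> * (\<Sum>k\<in>UNIV. D x $ i $ k * cof (J x) $ j $ k)"
        using det_nonzero[of x] sign[of x, symmetric]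
        by (simp add: push_gradient_def matrix_matrix_mult_def minv_def transpose_def sum_divide_distrib[symmetric] del: sign)
      then have "\<bar>det (J x)\<bar> * (push_gradient D (\<psi> x) $ i $ j * \<phi> (\<psi> x)) = \<sigma> * (\<Sum>k\<in>UNIV. D x $ i $ k * cof (J x) $ j $ k) * \<phi> (\<psi> x)"
        by (simp only: mult.assoc[symmetric])
      then show "(\<Sum>k\<in>UNIV. \<sigma> * (D x $ i $ k * \<Phi> k x)) = \<bar>det (J x)\<bar> * (push_gradient D (\<psi> x) $ i $ j * \<phi> (\<psi> x))"
        by (simp add: \<Phi>_def sum_distrib_left sum_distrib_right algebra_simps)
    qed
    also have "\<dots> = (LINT x|lebesgue_on \<Omega>. push_gradient D x $ i $ j * \<phi> x)"
      by (rule cov(2)[symmetric])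
    finally show ?thesis .
  qed
  then show ?thesis using loc by (simp add: has_weak_gradient_def)
qed

lemma W12_push:
  assumes u: "u \<in> W12 \<Omega>"
  shows "(\<lambda>x. u (\<eta> x)) \<in> W12 \<Omega>"
    and "AE x in lebesgue_on \<Omega>. weak_gradient \<Omega> (\<lambda>x. u (\<eta> x)) x = push_gradient (weak_gradient \<Omega> u) x"
proof -
  note d = W12D[OF u open_dom bounded_dom]
  note * = W12I[OF measurable_\<eta>[OF d(1)] integrable_\<eta>[OF d(2)] has_weak_gradient_push[OF d(4,3,7)]
      push_gradient_square_integrable[OF d(5,6)] open_dom]
  show "(\<lambda>x. u (\<eta> x)) \<in> W12 \<Omega>"
    and "AE x in lebesgue_on \<Omega>. weak_gradient \<Omega> (\<lambda>x. u (\<eta> x)) x = push_gradient (weak_gradient \<Omega> u) x"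
    by (rule *)+
qed

text \<open>With J = D\<psi> and A = Du, the transposed cofactor matrix of A J^-1 times det J is J
  times the transposed cofactor matrix of A. Cyclicity of the trace moves J behind the x-derivative
  of f, where it completes the chain rule for f(\<psi>(x), y). Preservation of orientation lets det
  J replace |det J|.\<close>

lemma surface_functional_push:
  assumes u: "u \<in> W12 \<Omega>" and det: "AE x in lebesgue_on \<Omega>. det (weak_gradient \<Omega> u x) > 0"
    and f: "smooth_on UNIV f" and \<sigma>: "\<sigma> = 1"
  shows "surface_functional \<Omega> (\<lambda>x. u (\<eta> x)) f = surface_functional \<Omega> u (\<lambda>p. f (\<psi> (fst p), snd p))"
proof -
  let ?D = "weak_gradient \<Omega> u"
  let ?g = "\<lambda>E x. trace (transpose (cof E) ** jacobian (\<lambda>x'. f (x', u (\<eta> x))) (at x)) +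
        det E * trace (jacobian (\<lambda>y. f (x, y)) (at (u (\<eta> x))))"
  have "surface_functional \<Omega> (\<lambda>x. u (\<eta> x)) f = (LINT x|lebesgue_on \<Omega>. ?g (push_gradient ?D x) x)"
    unfolding surface_functional_def
    by (rule integral_cong_AE_lebesgue_on(2)[OF dom_sets]) (use W12_push(2)[OF u] in eventually_elim, simp)
  also have "\<dots> = (LINT x|lebesgue_on \<Omega>. \<bar>det (J x)\<bar> * ?g (push_gradient ?D (\<psi> x)) (\<psi> x))"
    by (rule cov(2))
  also have "\<dots> = surface_functional \<Omega> u (\<lambda>p. f (\<psi> (fst p), snd p))"
    unfolding surface_functional_def
  proof (rule integral_cong_AE_lebesgue_on(2)[OF dom_sets], use det in eventually_elim)
    case (elim x)
    let ?A = "?D x" and ?B = "?D x ** minv (J x)" and ?G = "jacobian (\<lambda>x'. f (x', u x)) (at (\<psi> x))"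
    have dJ: "\<bar>det (J x)\<bar> = det (J x)" using sign[of x] \<sigma> by simp
    have dB: "det ?B * det (J x) = det ?A"
      using det_nonzero[of x] by (simp add: det_mul det_minv)
    then have dB0: "det ?B \<noteq> 0" using elim by auto
    \<comment> \<open>Positivity of det Du makes both matrices invertible, so the cofactor identity
      reduces to one between inverses.\<close>
    have "minv ?B = J x ** minv ?A"
    proof (rule minv_unique)
      have "J x ** minv ?A ** ?B = J x ** (minv ?A ** ?A) ** minv (J x)" by (simp add: matrix_mul_assoc)
      then show "J x ** minv ?A ** ?B = mat 1" using elim det_nonzero[of x] by (simp add: minv_mult)
    qed
    moreover have cof_minv: "transpose (cof M) = det M *\<^sub>R minv M" if "det M \<noteq> 0" for M :: "real^3^3"
      using that by (simp add: minv_def)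
    ultimately have "det (J x) *\<^sub>R transpose (cof ?B) = (det ?B * det (J x)) *\<^sub>R (J x ** minv ?A)"
      using dB0 by simp
    also have "\<dots> = J x ** transpose (cof ?A)"
      using cof_minv[of ?A] elim by (simp only: dB) (simp add: scaleR_matrix_mult)
    finally have c: "det (J x) *\<^sub>R transpose (cof ?B) = J x ** transpose (cof ?A)" .
    have tr_scale: "c * trace M = trace (c *\<^sub>R M)" for c and M :: "real^3^3"
      by (simp add: trace_def sum_distrib_left)
    have "det (J x) * trace (transpose (cof ?B) ** ?G) = trace (J x ** (transpose (cof ?A) ** ?G))"
      unfolding tr_scale scaleR_matrix_mult(1)[symmetric] c by (simp add: matrix_mul_assoc)
    also have "\<dots> = trace (transpose (cof ?A) ** (?G ** J x))"
      by (subst trace_mul_sym) (simp add: matrix_mul_assoc)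
    also have "?G ** J x = jacobian (\<lambda>x'. f (\<psi> x', u x)) (at x)"
    proof -
      have s: "smooth_on UNIV (\<lambda>x'. f (x', u x))"
      proof -
        have "smooth_on UNIV (\<lambda>x'. (x', 0) + (0, u x) :: (real^3) \<times> (real^3))"
          by (intro smooth_add smooth_const smooth_linear bounded_linear_Pair bounded_linear_ident bounded_linear_zero)
        then show ?thesis using smooth_compose[OF f] by simp
      qed
      from has_derivative_compose[OF smooth_jacobian(1)[OF smooth] smooth_jacobian(1)[OF s]]
      have "((\<lambda>x'. f (\<psi> x', u x)) has_derivative (\<lambda>h. ?G *v (J x *v h))) (at x)" .
      then show ?thesis by (simp add: matrix_vector_mul_assoc jacobianI)
    qed
    finally show ?case
      using dJ dB by (simp add: push_gradient_def distrib_left mult.assoc[symmetric] mult.commute)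
  qed
  finally show ?thesis .
qed

text \<open>Precomposing the first argument with \<psi> maps competitors for the supremum to
  competitors, so the supremum stays at most 0; the zero field gives the other inequality.\<close>

lemma surface_energy_push:
  assumes u: "u \<in> W12 \<Omega>" and det: "AE x in lebesgue_on \<Omega>. det (weak_gradient \<Omega> u x) > 0"
    and \<sigma>: "\<sigma> = 1" and E: "surface_energy \<Omega> u = 0"
  shows "surface_energy \<Omega> (\<lambda>x. u (\<eta> x)) = 0"
proof (rule antisym)
  show "surface_energy \<Omega> (\<lambda>x. u (\<eta> x)) \<le> 0"
    unfolding surface_energy_def
  proof (rule SUP_least)
    fix f :: "(real^3) \<times> (real^3) \<Rightarrow> real^3" assume "f \<in> {f \<in> test_functions (\<Omega> \<times> UNIV). \<forall>p. norm (f p) \<le> 1}"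
    then have f: "f \<in> test_functions (\<Omega> \<times> UNIV)" "\<And>p. norm (f p) \<le> 1" by auto
    let ?f = "\<lambda>p. f (\<psi> (fst p), snd p)"
    obtain Q where Q: "smooth_on UNIV f" "compact Q" "Q \<subseteq> \<Omega> \<times> UNIV" "\<And>x. x \<notin> Q \<Longrightarrow> f x = 0"
      using test_functionsE[OF f(1)] by metis
    have "?f \<in> test_functions (\<Omega> \<times> UNIV)"
    proof (rule test_functionsI)
      have "smooth_on UNIV (\<lambda>p. (\<psi> (fst p), 0) + (0, snd p) :: (real^3) \<times> (real^3))"
        by (intro smooth_add smooth_linear bounded_linear_Pair bounded_linear_zero bounded_linear_snd
            smooth_bounded_linear[of "\<lambda>x. (x, 0)"] bounded_linear_ident smooth_compose[OF smooth] bounded_linear_fst)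
      then show "smooth_on UNIV ?f" using smooth_compose[OF Q(1)] by simp
      show "compact ((\<lambda>p. (\<eta> (fst p), snd p)) ` Q)"
        by (intro compact_continuous_image continuous_intros continuous_on_compose2[OF cont_inverse] Q) auto
      show "(\<lambda>p. (\<eta> (fst p), snd p)) ` Q \<subseteq> \<Omega> \<times> UNIV" using Q(3) \<eta>_mem by auto
      fix p assume "p \<notin> (\<lambda>p. (\<eta> (fst p), snd p)) ` Q"
      then have "(\<psi> (fst p), snd p) \<notin> Q" by (force simp: image_iff)
      then show "?f p = 0" by (rule Q(4))
    qed
    then have "ereal (surface_functional \<Omega> u ?f) \<le> surface_energy \<Omega> u"
      unfolding surface_energy_def using f(2) by (intro SUP_upper) auto
    then show "ereal (surface_functional \<Omega> (\<lambda>x. u (\<eta> x)) f) \<le> 0"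
      using surface_functional_push[OF u det Q(1) \<sigma>] E by simp
  qed
  have "(\<lambda>p. 0) \<in> (test_functions (\<Omega> \<times> UNIV) :: ((real^3) \<times> (real^3) \<Rightarrow> real^3) set)"
    by (rule test_functionsI[of _ "{}"]) (auto simp: smooth_const)
  then have "ereal (surface_functional \<Omega> (\<lambda>x. u (\<eta> x)) (\<lambda>p. 0)) \<le> surface_energy \<Omega> (\<lambda>x. u (\<eta> x))"
    unfolding surface_energy_def by (intro SUP_upper) auto
  moreover have "jacobian (\<lambda>x. 0 :: real^3) (at x) = 0" for x :: "real^3"
    by (rule jacobianI) simp
  then have "surface_functional \<Omega> (\<lambda>x. u (\<eta> x)) (\<lambda>p. 0) = 0"
    by (simp add: surface_functional_def trace_def)
  ultimately show "0 \<le> surface_energy \<Omega> (\<lambda>x. u (\<eta> x))"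
    by (simp add: zero_ereal_def)
qed

end

section \<open>Boundary values\<close>

lemma norm_add_square_le: "(norm (a + b))\<^sup>2 \<le> 2 * (norm a)\<^sup>2 + 2 * (norm (b :: 'a::real_normed_vector))\<^sup>2"
proof -
  have "(norm (a + b))\<^sup>2 \<le> (norm a + norm b)\<^sup>2"
    by (intro power_mono norm_triangle_ineq) simp
  also have "\<dots> \<le> 2 * (norm a)\<^sup>2 + 2 * (norm b)\<^sup>2"
    using zero_le_power2[of "norm a - norm b"] by (simp add: power2_eq_square algebra_simps)
  finally show ?thesis .
qed

lemma square_integrable_add:
  fixes f g :: "'a \<Rightarrow> 'b::euclidean_space"
  assumes "f \<in> borel_measurable M" "integrable M (\<lambda>x. (norm (f x))\<^sup>2)"
    and "g \<in> borel_measurable M" "integrable M (\<lambda>x. (norm (g x))\<^sup>2)"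
  shows "integrable M (\<lambda>x. (norm (f x + g x))\<^sup>2)"
proof (rule Bochner_Integration.integrable_bound)
  show "integrable M (\<lambda>x. 2 * (norm (f x))\<^sup>2 + 2 * (norm (g x))\<^sup>2)"
    using assms by simp
  show "(\<lambda>x. (norm (f x + g x))\<^sup>2) \<in> borel_measurable M"
    using assms by measurable
  show "AE x in M. norm ((norm (f x + g x))\<^sup>2) \<le> norm (2 * (norm (f x))\<^sup>2 + 2 * (norm (g x))\<^sup>2)"
    by (intro AE_I2) (simp add: norm_add_square_le)
qed

lemma square_integrable_diff:
  fixes f g :: "'a \<Rightarrow> 'b::euclidean_space"
  assumes "f \<in> borel_measurable M" "integrable M (\<lambda>x. (norm (f x))\<^sup>2)"
    and "g \<in> borel_measurable M" "integrable M (\<lambda>x. (norm (g x))\<^sup>2)"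
  shows "integrable M (\<lambda>x. (norm (f x - g x))\<^sup>2)"
  using square_integrable_add[of f M "\<lambda>x. - g x"] assms by simp

lemma square_integrable_compact_support:
  fixes f :: "'a::euclidean_space \<Rightarrow> 'b::euclidean_space"
  assumes "continuous_on UNIV f" "compact C" "\<And>x. x \<notin> C \<Longrightarrow> f x = 0" "S \<in> sets lebesgue"
  shows "integrable (lebesgue_on S) (\<lambda>x. (norm (f x))\<^sup>2)"
  using assms by (intro integrable_continuous_compact_support[of _ C] continuous_intros) auto

lemma has_weak_gradient_add:
  assumes "has_weak_gradient \<Omega> u D" "has_weak_gradient \<Omega> v E" and \<Omega>: "open \<Omega>"
    and u: "integrable (lebesgue_on \<Omega>) u" and D: "integrable (lebesgue_on \<Omega>) D"
    and v: "integrable (lebesgue_on \<Omega>) v" and E: "integrable (lebesgue_on \<Omega>) E"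
  shows "has_weak_gradient \<Omega> (\<lambda>x. u x + v x) (\<lambda>x. D x + E x)"
proof -
  have \<Omega>s: "\<Omega> \<in> sets lebesgue" using \<Omega> by (simp add: borel_open)
  have "(LINT x|lebesgue_on \<Omega>. (u x + v x) $ i * partial_deriv j \<phi> x) = - (LINT x|lebesgue_on \<Omega>. (D x + E x) $ i $ j * \<phi> x)"
    if \<phi>: "\<phi> \<in> test_functions \<Omega>" for \<phi> i j
  proof -
    obtain Q where Q: "smooth_on UNIV \<phi>" "compact Q" "Q \<subseteq> \<Omega>" "\<And>x. x \<notin> Q \<Longrightarrow> \<phi> x = 0"
      using test_functionsE[OF \<phi>] by metis
    note p = integrable_mult_compact_support[OF integrable_component \<Omega>s smooth_continuous[OF smooth_partial_deriv[OF Q(1)]] Q(2)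
        partial_deriv_zero_outside_support[OF Q(1,2,4)]]
    note q = integrable_mult_compact_support[OF integrable_entry \<Omega>s smooth_continuous[OF Q(1)] Q(2,4)]
    note i1 = p[OF u] p[OF v] and i2 = q[OF D] q[OF E]
    show ?thesis
      using assms(1,2) \<phi> i1 i2 by (simp add: has_weak_gradient_def distrib_right)
  qed
  then show ?thesis
    using u v D E \<Omega> by (auto simp: has_weak_gradient_def intro!: locally_integrable_if_integrable)
qed

context smooth_diffeo
begin

text \<open>The n-th approximation has two errors: a uniform mollification error 1 / (n + 1), and
  the error of the original approximation carried along \<eta>, whose integral grows by the factor C
  at most.\<close>

lemma integral_square_tendsto_zero:
  fixes b h :: "nat \<Rightarrow> real^3 \<Rightarrow> real"
  assumes h: "\<And>n. integrable (lebesgue_on \<Omega>) (h n)" "\<And>n x. h n x \<ge> 0" "(\<lambda>n. LINT x|lebesgue_on \<Omega>. h n x) \<longlonglongrightarrow> 0"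
    and b: "\<And>n. AE x in lebesgue_on \<Omega>. b n x \<le> 2 * (1 / Suc n)\<^sup>2 + K * h n (\<eta> x)" "\<And>n x. b n x \<ge> 0" and K: "K \<ge> 0"
  shows "(\<lambda>n. LINT x|lebesgue_on \<Omega>. b n x) \<longlonglongrightarrow> 0"
proof (rule tendsto_sandwich[OF _ _ tendsto_const])
  have fin: "finite_measure (lebesgue_on \<Omega>)"
    by (intro finite_measure_lebesgue_on lmeasurable_open open_dom bounded_dom)
  let ?V = "measure (lebesgue_on \<Omega>) \<Omega>"
  show "\<forall>\<^sub>F n in sequentially. (LINT x|lebesgue_on \<Omega>. b n x) \<le> ?V * (2 * (1 / Suc n)\<^sup>2) + K * (C * (LINT x|lebesgue_on \<Omega>. h n x))"
  proof (rule always_eventually, rule allI)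
    fix n
    have c: "integrable (lebesgue_on \<Omega>) (\<lambda>x. 2 * (1 / Suc n)\<^sup>2)"
      using fin by (rule finite_measure.integrable_const)
    have hi: "integrable (lebesgue_on \<Omega>) (\<lambda>x. K * h n (\<eta> x))"
      using integrable_\<eta>[OF h(1)] by simp
    have "(LINT x|lebesgue_on \<Omega>. b n x) \<le> (LINT x|lebesgue_on \<Omega>. 2 * (1 / Suc n)\<^sup>2 + K * h n (\<eta> x))"
      using b K h(2) c hi by (intro integral_mono_AE') auto
    also have "\<dots> = (LINT x|lebesgue_on \<Omega>. 2 * (1 / Suc n)\<^sup>2) + (LINT x|lebesgue_on \<Omega>. K * h n (\<eta> x))"
      by (rule Bochner_Integration.integral_add[OF c hi])
    also have "\<dots> \<le> ?V * (2 * (1 / Suc n)\<^sup>2) + K * (C * (LINT x|lebesgue_on \<Omega>. h n x))"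
      using integral_\<eta>_le[OF h(1) h(2)] K by (simp add: mult_left_mono)
    finally show "(LINT x|lebesgue_on \<Omega>. b n x) \<le> ?V * (2 * (1 / Suc n)\<^sup>2) + K * (C * (LINT x|lebesgue_on \<Omega>. h n x))" .
  qed
  have "(\<lambda>n. 1 / real (Suc n)) \<longlonglongrightarrow> 0"
    using LIMSEQ_inverse_real_of_nat by (simp add: inverse_eq_divide)
  then have "(\<lambda>n. ?V * (2 * (1 / real (Suc n))\<^sup>2) + K * (C * (LINT x|lebesgue_on \<Omega>. h n x))) \<longlonglongrightarrow> ?V * (2 * 0\<^sup>2) + K * (C * 0)"
    by (intro tendsto_intros h(3))
  then show "(\<lambda>n. ?V * (2 * (1 / real (Suc n))\<^sup>2) + K * (C * (LINT x|lebesgue_on \<Omega>. h n x))) \<longlonglongrightarrow> 0" by simp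
  show "\<forall>\<^sub>F n in sequentially. 0 \<le> (LINT x|lebesgue_on \<Omega>. b n x)"
    using b(2) by (intro always_eventually allI integral_nonneg_AE) auto
qed

lemma push_has_derivative:
  assumes "(f has_derivative (\<lambda>h. A (\<eta> x) *v h)) (at (\<eta> x))"
  shows "((\<lambda>x. f (\<eta> x)) has_derivative (\<lambda>h. push_gradient A x *v h)) (at x)"
  using has_derivative_compose[OF inverse_has_derivative assms]
  by (simp add: push_gradient_def matrix_vector_mul_assoc)

lemma continuous_push_gradient:
  assumes "continuous_on S A" "\<And>x. x \<in> T \<Longrightarrow> \<eta> x \<in> S"
  shows "continuous_on T (push_gradient A)"
  unfolding push_gradient_def[abs_def]
  by (intro bounded_bilinear.continuous_on[OF bounded_bilinear_matrix_mult] continuous_on_compose2[OF assms(1)]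
      continuous_on_compose2[OF continuous_minv_J] continuous_on_subset[OF cont_inverse]) (use assms in auto)

text \<open>With w = u - g, the new difference is w(\<eta>(x)) + (g(\<eta>(x)) - g(x)). The bracket
  is C^1 with compact support, since \<eta> is the identity off K. If the test functions \<phi>_n
  approximate w, then \<phi>_n(\<eta>(x)) approximates the first term; the C^1 sum of both is then
  mollified.\<close>

lemma same_trace_push:
  assumes tr: "same_trace \<Omega> u g" and g: "C1_on_closed (closure \<Omega>) g"
    and K: "compact K" "K \<subseteq> \<Omega>" "\<And>x. x \<notin> K \<Longrightarrow> \<eta> x = x"
  shows "same_trace \<Omega> (\<lambda>x. u (\<eta> x)) g"
proof -
  define w where "w = (\<lambda>x. u x - g x)"
  obtain G where G: "continuous_on (closure \<Omega>) G"
    "\<And>x. x \<in> closure \<Omega> \<Longrightarrow> (g has_derivative (\<lambda>h. G x *v h)) (at x within closure \<Omega>)"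
    using g by (auto simp: C1_on_closed_def)
  have G': "(g has_derivative (\<lambda>h. G x *v h)) (at x)" if "x \<in> \<Omega>" for x
  proof -
    have "x \<in> closure \<Omega>" using that closure_subset by blast
    have "at x within \<Omega> = at x" by (rule at_within_open[OF that open_dom])
    with has_derivative_subset[OF G(2)[OF \<open>x \<in> closure \<Omega>\<close>] closure_subset] show ?thesis
      by metis
  qed
  \<comment> \<open>Differentiability of g is given on the closure of \<Omega> only, so the
    difference is extended by 0; it already vanishes off K.\<close>
  define f where "f = (\<lambda>x. if x \<in> \<Omega> then g (\<eta> x) - g x else 0)"
  define A where "A = (\<lambda>x. if x \<in> \<Omega> then push_gradient G x - G x else 0)"
  have f0: "f x = 0" if "x \<notin> K" for x using K(3)[OF that] by (simp add: f_def)
  have f: "(f has_derivative (\<lambda>h. A x *v h)) (at x)" for x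
  proof (cases "x \<in> \<Omega>")
    case True
    have "((\<lambda>x. g (\<eta> x) - g x) has_derivative (\<lambda>h. push_gradient G x *v h - G x *v h)) (at x)"
      by (intro has_derivative_diff push_has_derivative G' \<eta>_mem True)
    then have "((\<lambda>x. g (\<eta> x) - g x) has_derivative (\<lambda>h. A x *v h)) (at x)"
      using True by (simp add: A_def matrix_vector_mult_diff_rdistrib)
    then show ?thesis
      by (rule has_derivative_transform_within_open[OF _ open_dom True]) (simp add: f_def)
  next
    case False
    then have "x \<notin> K" using K(2) by blast
    then have "(f has_derivative (\<lambda>h. 0)) (at x)"
      by (intro has_derivative_transform_within_open[OF has_derivative_const, where s = "- K"])
        (use f0 K in \<open>auto simp: compact_imp_closed\<close>)
    then show ?thesis using False by (simp add: A_def)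
  qed
  have A0: "A x = 0" if "x \<notin> K" for x
    using derivative_zero_outside_support[OF f compact_imp_closed[OF K(1)] f0 that] by (rule matrix_zero_if_mult_zero)
  have A: "continuous_on UNIV A"
  proof -
    have "continuous_on \<Omega> (\<lambda>x. push_gradient G x - G x)"
      using closure_subset[of \<Omega>] \<eta>_mem
      by (intro continuous_on_diff continuous_push_gradient[OF G(1)] continuous_on_subset[OF G(1)]) auto
    then have "continuous_on \<Omega> A" by (rule continuous_on_eq) (simp add: A_def)
    moreover have "continuous_on (- K) A"
      by (rule continuous_on_eq[OF continuous_on_const, of _ 0]) (simp add: A0)
    ultimately have "continuous_on (\<Omega> \<union> - K) A"
      using open_dom K(1) by (intro continuous_on_open_Un) (auto simp: compact_imp_closed)
    moreover have "\<Omega> \<union> - K = UNIV" using K(2) by blast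
    ultimately show ?thesis by simp
  qed
  have cf: "continuous_on UNIV f"
    using f by (intro continuous_at_imp_continuous_on) (auto intro: has_derivative_continuous)
  have w: "w \<in> W12 \<Omega>" using tr by (simp add: same_trace_def W12_zero_def w_def)
  let ?D = "weak_gradient \<Omega> w"
  obtain \<phi> where \<phi>: "\<And>n. \<phi> n \<in> test_functions \<Omega>"
    "(\<lambda>n. LINT x|lebesgue_on \<Omega>. (norm (\<phi> n x - w x))\<^sup>2) \<longlonglongrightarrow> 0"
    "(\<lambda>n. LINT x|lebesgue_on \<Omega>. (norm (jacobian (\<phi> n) (at x) - ?D x))\<^sup>2) \<longlonglongrightarrow> 0"
    using tr by (auto simp: same_trace_def W12_zero_def w_def)
  have "\<forall>n. \<exists>Q. smooth_on UNIV (\<phi> n) \<and> compact Q \<and> Q \<subseteq> \<Omega> \<and> (\<forall>x. x \<notin> Q \<longrightarrow> \<phi> n x = 0)"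
    using test_functionsE[OF \<phi>(1)] by metis
  then obtain Q where Q: "\<And>n. smooth_on UNIV (\<phi> n)" "\<And>n. compact (Q n)" "\<And>n. Q n \<subseteq> \<Omega>"
    "\<And>n x. x \<notin> Q n \<Longrightarrow> \<phi> n x = 0" by metis
  note d = W12D[OF w open_dom bounded_dom]
  note d' = W12D[OF W12_push(1)[OF w] open_dom bounded_dom]
  have v_eq: "(\<lambda>x. u (\<eta> x) - g x) = (\<lambda>x. w (\<eta> x) + f x)"
    using K(2,3) by (fastforce simp: w_def f_def)
  have fi: "integrable (lebesgue_on \<Omega>) f" "integrable (lebesgue_on \<Omega>) A"
    "integrable (lebesgue_on \<Omega>) (\<lambda>x. (norm (f x))\<^sup>2)" "integrable (lebesgue_on \<Omega>) (\<lambda>x. (norm (A x))\<^sup>2)"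
    using integrable_continuous_compact_support[OF cf K(1) _ dom_sets] integrable_continuous_compact_support[OF A K(1) _ dom_sets]
      square_integrable_compact_support[OF cf K(1) _ dom_sets] square_integrable_compact_support[OF A K(1) _ dom_sets] f0 A0
    by blast+
  have wf: "has_weak_gradient \<Omega> f A"
    using C1_has_weak_gradient[OF f A K(1) _ open_dom] f0 by blast
  note pg = measurable_push_gradient[OF d(5)] push_gradient_square_integrable[OF d(5,6)]
  note v = W12I[OF borel_measurable_add[OF d'(1) borel_measurable_integrable[OF fi(1)]]
      square_integrable_add[OF d'(1,2) borel_measurable_integrable[OF fi(1)] fi(3)]
      has_weak_gradient_add[OF has_weak_gradient_push[OF d(4,3,7)] wf
        open_dom integrable_\<eta>[OF d(3)] integrable_if_square_integrable[OF pg open_dom bounded_dom] fi(1,2)]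
      square_integrable_add[OF pg borel_measurable_integrable[OF fi(2)] fi(4)] open_dom]
  have "\<exists>k. k \<in> test_functions \<Omega> \<and> (\<forall>x. norm (k x - (\<phi> n (\<eta> x) + f x)) \<le> 1 / Suc n) \<and>
      (\<forall>x. norm (jacobian k (at x) - (push_gradient (\<lambda>x. jacobian (\<phi> n) (at x)) x + A x)) \<le> 1 / Suc n)" for n
  proof -
    have 1: "((\<lambda>x. \<phi> n (\<eta> x) + f x) has_derivative
       (\<lambda>h. (push_gradient (\<lambda>x. jacobian (\<phi> n) (at x)) x + A x) *v h)) (at x)" for x
      unfolding matrix_vector_mult_add_rdistrib
      by (intro has_derivative_add push_has_derivative smooth_jacobian(1) Q(1) f)
    have 2: "continuous_on UNIV (\<lambda>x. push_gradient (\<lambda>x. jacobian (\<phi> n) (at x)) x + A x)"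
      by (intro continuous_on_add continuous_push_gradient[OF continuous_jacobian[OF Q(1)]] A) auto
    have 3: "compact (\<psi> ` Q n \<union> K)"
      by (intro compact_Un compact_continuous_image continuous_on_subset[OF smooth_continuous[OF smooth]] Q K) auto
    have 4: "\<psi> ` Q n \<union> K \<subseteq> \<Omega>" using Q(3) K(2) \<psi>_mem by blast
    have 5: "\<phi> n (\<eta> x) + f x = 0" if "x \<notin> \<psi> ` Q n \<union> K" for x
    proof -
      have "\<eta> x \<notin> Q n" using that image_eqI[of x \<psi> "\<eta> x"] by auto
      then show ?thesis using Q(4) f0 that by simp
    qed
    have 6: "0 < 1 / real (Suc n)" by simp
    show ?thesis
      using C1_approximation[OF 1 2 3 4 open_dom 5 6] by metis
  qed
  then obtain k where k: "\<And>n. k n \<in> test_functions \<Omega>" "\<And>n x. norm (k n x - (\<phi> n (\<eta> x) + f x)) \<le> 1 / Suc n"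
    "\<And>n x. norm (jacobian (k n) (at x) - (push_gradient (\<lambda>x. jacobian (\<phi> n) (at x)) x + A x)) \<le> 1 / Suc n"
    by metis
  have "(\<lambda>n. LINT x|lebesgue_on \<Omega>. (norm (k n x - (w (\<eta> x) + f x)))\<^sup>2) \<longlonglongrightarrow> 0"
  proof (rule integral_square_tendsto_zero[where K = 2, OF _ _ \<phi>(2)])
    show "integrable (lebesgue_on \<Omega>) (\<lambda>x. (norm (\<phi> n x - w x))\<^sup>2)" for n
      by (intro square_integrable_diff d(1,2) square_integrable_compact_support[OF smooth_continuous[OF Q(1)] Q(2,4) dom_sets]
          measurable_continuous_lebesgue_on[OF smooth_continuous[OF Q(1)] dom_sets])
    show "AE x in lebesgue_on \<Omega>. (norm (k n x - (w (\<eta> x) + f x)))\<^sup>2 \<le> 2 * (1 / Suc n)\<^sup>2 + 2 * (norm (\<phi> n (\<eta> x) - w (\<eta> x)))\<^sup>2" for n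
    proof (rule AE_I2)
      fix x
      have "(norm (k n x - (w (\<eta> x) + f x)))\<^sup>2 = (norm ((k n x - (\<phi> n (\<eta> x) + f x)) + (\<phi> n (\<eta> x) - w (\<eta> x))))\<^sup>2"
        by (simp add: algebra_simps)
      also have "\<dots> \<le> 2 * (norm (k n x - (\<phi> n (\<eta> x) + f x)))\<^sup>2 + 2 * (norm (\<phi> n (\<eta> x) - w (\<eta> x)))\<^sup>2"
        by (rule norm_add_square_le)
      also have "\<dots> \<le> 2 * (1 / Suc n)\<^sup>2 + 2 * (norm (\<phi> n (\<eta> x) - w (\<eta> x)))\<^sup>2"
        using power_mono[OF k(2) norm_ge_zero, of n x 2] by simp
      finally show "(norm (k n x - (w (\<eta> x) + f x)))\<^sup>2 \<le> 2 * (1 / Suc n)\<^sup>2 + 2 * (norm (\<phi> n (\<eta> x) - w (\<eta> x)))\<^sup>2" .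
    qed
  qed auto
  moreover
  obtain K' where K': "K' > 0" "\<And>D x. norm (push_gradient D x) \<le> K' * norm (D (\<eta> x))"
    using push_gradient_bound by blast
  have "(\<lambda>n. LINT x|lebesgue_on \<Omega>. (norm (jacobian (k n) (at x) - weak_gradient \<Omega> (\<lambda>x. w (\<eta> x) + f x) x))\<^sup>2) \<longlonglongrightarrow> 0"
  proof (rule integral_square_tendsto_zero[where K = "2 * K'\<^sup>2", OF _ _ \<phi>(3)])
    have j: "jacobian (\<phi> n) (at x) = 0" if "x \<notin> Q n" for n x
      by (rule jacobian_zero_outside_support[OF Q(1,2,4) that])
    show "integrable (lebesgue_on \<Omega>) (\<lambda>x. (norm (jacobian (\<phi> n) (at x) - ?D x))\<^sup>2)" for n
      by (intro square_integrable_diff d(5,6) square_integrable_compact_support[OF continuous_jacobian[OF Q(1)] Q(2) j dom_sets]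
          measurable_continuous_lebesgue_on[OF continuous_jacobian[OF Q(1)] dom_sets])
    show "AE x in lebesgue_on \<Omega>. (norm (jacobian (k n) (at x) - weak_gradient \<Omega> (\<lambda>x. w (\<eta> x) + f x) x))\<^sup>2
        \<le> 2 * (1 / Suc n)\<^sup>2 + 2 * K'\<^sup>2 * (norm (jacobian (\<phi> n) (at (\<eta> x)) - ?D (\<eta> x)))\<^sup>2" for n
      using v(2)
    proof eventually_elim
      case (elim x)
      let ?P = "push_gradient (\<lambda>x. jacobian (\<phi> n) (at x)) x"
      have pd: "?P - push_gradient ?D x = push_gradient (\<lambda>x. jacobian (\<phi> n) (at x) - ?D x) x"
        by (simp add: push_gradient_def bounded_bilinear.diff_left[OF bounded_bilinear_matrix_mult])
      have "(norm (jacobian (k n) (at x) - weak_gradient \<Omega> (\<lambda>x. w (\<eta> x) + f x) x))\<^sup>2 =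
          (norm ((jacobian (k n) (at x) - (?P + A x)) + (?P - push_gradient ?D x)))\<^sup>2"
        unfolding elim by (simp add: algebra_simps)
      also have "\<dots> \<le> 2 * (norm (jacobian (k n) (at x) - (?P + A x)))\<^sup>2 + 2 * (norm (?P - push_gradient ?D x))\<^sup>2"
        by (rule norm_add_square_le)
      also have "\<dots> \<le> 2 * (1 / Suc n)\<^sup>2 + 2 * (K' * norm (jacobian (\<phi> n) (at (\<eta> x)) - ?D (\<eta> x)))\<^sup>2"
        unfolding pd
        by (intro add_mono mult_left_mono power_mono k(3) K'(2)) auto
      finally show ?case by (simp add: power_mult_distrib mult.assoc)
    qed
  qed auto
  ultimately show ?thesis
    using v(1) k(1) unfolding same_trace_def W12_zero_def v_eq by blast
qed

end

section \<open>Growth of the stored energy\<close>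

text \<open>Near 0 the power laws for H and H' are compared directly. Near infinity only H' is
  controlled, so H is bounded below by the mean value theorem on [t/2, t], whence the threshold 2
  d1. In between, continuity on a compact interval suffices.\<close>

lemma logarithmic_derivative_bound:
  fixes H H' :: "real \<Rightarrow> real"
  assumes nonneg: "\<And>t. t > 0 \<Longrightarrow> H t \<ge> 0"
    and der: "\<And>t. t > 0 \<Longrightarrow> (H has_real_derivative H' t) (at t)" and cont: "continuous_on {0<..} H'"
    and near0: "\<And>t. 0 < t \<Longrightarrow> t < d0 \<Longrightarrow> c1 * t powr (- s) \<le> H t"
      "\<And>t. 0 < t \<Longrightarrow> t < d0 \<Longrightarrow> \<bar>H' t\<bar> \<le> c2 * t powr (- s - 1)"
    and c: "c1 > 0" "c2 > 0" "d0 > 0" "c3 > 0" "c4 > 0" "d1 > 0" "\<tau> > 0"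
    and near_top: "\<And>t. t \<ge> d1 \<Longrightarrow> c3 * t powr (\<tau> + 1) \<le> H' t" "\<And>t. t \<ge> d1 \<Longrightarrow> H' t \<le> c4 * t powr (\<tau> + 1)"
  obtains C where "C > 0" "\<And>t. t > 0 \<Longrightarrow> \<bar>t * H' t\<bar> \<le> C * (1 + H t)"
proof -
  \<comment> \<open>The quotient of the upper bound t c4 t^(\<tau>+1) for t H'(t) by the lower bound
    (t/2) c3 (t/2)^(\<tau>+1) for H(t).\<close>
  define K where "K = 2 * c4 * 2 powr (\<tau> + 1) / c3"
  have "compact ((\<lambda>t. t * H' t) ` {d0..2 * d1})"
    using c by (intro compact_continuous_image continuous_on_mult continuous_on_id continuous_on_subset[OF cont]) auto
  then have "bounded ((\<lambda>t. t * H' t) ` {d0..2 * d1})" by (rule compact_imp_bounded)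
  then obtain B where B: "B > 0" "\<And>t. t \<in> {d0..2 * d1} \<Longrightarrow> \<bar>t * H' t\<bar> \<le> B"
    by (auto simp: bounded_pos)
  define C where "C = c2 / c1 + K + B"
  have K: "K > 0" using c by (simp add: K_def)
  have C: "C > 0" "c2 / c1 \<le> C" "K \<le> C" "B \<le> C"
    using divide_pos_pos[OF c(2,1)] K B(1) by (auto simp: C_def)
  have scale: "x * H t \<le> C * (1 + H t)" if "t > 0" "x \<le> C" for x t
    using mult_right_mono[OF that(2) nonneg[OF that(1)]] C(1) by (simp add: algebra_simps)
  show ?thesis
  proof (rule that[OF C(1)])
    fix t :: real assume t: "t > 0"
    consider "t < d0" | "t \<ge> 2 * d1" | "t \<in> {d0..2 * d1}" by fastforce
    then show "\<bar>t * H' t\<bar> \<le> C * (1 + H t)"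
    proof cases
      case 1
      have "\<bar>t * H' t\<bar> \<le> t * (c2 * t powr (- s - 1))"
        using near0(2)[OF t 1] t by (simp add: abs_mult)
      also have "\<dots> = c2 / c1 * (c1 * t powr (- s))"
        using t c by (simp add: powr_diff)
      also have "\<dots> \<le> c2 / c1 * H t"
        using near0(1)[OF t 1] c by (intro mult_left_mono) auto
      also have "\<dots> \<le> C * (1 + H t)" by (rule scale[OF t C(2)])
      finally show ?thesis .
    next
      case 2
      have t2: "t / 2 \<ge> d1" "t \<ge> d1" using 2 c by auto
      have "\<exists>\<xi>. t / 2 < \<xi> \<and> \<xi> < t \<and> H t - H (t / 2) = (t - t / 2) * H' \<xi>"
        using t by (intro MVT2 der) auto
      then obtain \<xi> where \<xi>: "t / 2 < \<xi>" "\<xi> < t" "H t - H (t / 2) = (t - t / 2) * H' \<xi>" by blast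
      have "c3 * (t / 2) powr (\<tau> + 1) \<le> c3 * \<xi> powr (\<tau> + 1)"
        using c \<xi> t by (intro mult_left_mono powr_mono2) auto
      also have "\<dots> \<le> H' \<xi>" using near_top(1)[of \<xi>] \<xi> t2 by simp
      finally have "t / 2 * (c3 * (t / 2) powr (\<tau> + 1)) \<le> t / 2 * H' \<xi>"
        using t by (intro mult_left_mono) auto
      also have "\<dots> \<le> H t" using \<xi>(3) nonneg[of "t / 2"] t by simp
      finally have Ht: "t / 2 * (c3 * (t / 2) powr (\<tau> + 1)) \<le> H t" .
      have "0 \<le> c3 * t powr (\<tau> + 1)" using c by simp
      then have "\<bar>t * H' t\<bar> \<le> t * (c4 * t powr (\<tau> + 1))"
        using near_top[OF t2(2)] t by (simp add: abs_mult)
      also have "\<dots> = K * (t / 2 * (c3 * (t / 2) powr (\<tau> + 1)))"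
        using t c by (simp add: K_def powr_divide)
      also have "\<dots> \<le> K * H t" using Ht K by (intro mult_left_mono) auto
      also have "\<dots> \<le> C * (1 + H t)" by (rule scale[OF t C(3)])
      finally show ?thesis .
    next
      case 3
      then have "\<bar>t * H' t\<bar> \<le> B" by (rule B(2))
      also have "\<dots> \<le> C * (1 + H t)"
        using C(1,4) nonneg[OF t] by (simp add: distrib_left add_increasing2)
      finally show ?thesis .
    qed
  qed
qed

text \<open>\<open>x \<mapsto> ln (1 + H (exp x))\<close> is Lipschitz by the bound on \<open>t * H' t\<close>.\<close>

lemma scaling_bound:
  fixes H H' :: "real \<Rightarrow> real"
  assumes nonneg: "\<And>t. t > 0 \<Longrightarrow> H t \<ge> 0"
    and der: "\<And>t. t > 0 \<Longrightarrow> (H has_real_derivative H' t) (at t)"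
    and C: "C > 0" "\<And>t. t > 0 \<Longrightarrow> \<bar>t * H' t\<bar> \<le> C * (1 + H t)"
    and t: "t > 0" "\<delta> \<in> {1/2..2}"
  shows "1 + H (t / \<delta>) \<le> 2 powr C * (1 + H t)"
proof -
  define L where "L = (\<lambda>x. ln (1 + H (exp x)))"
  have L: "(L has_real_derivative (H' (exp x) * exp x) / (1 + H (exp x))) (at x)" for x
    unfolding L_def using nonneg[of "exp x"]
    by (auto intro!: derivative_eq_intros DERIV_chain2[OF der] add_pos_nonneg)
  have Lb: "\<bar>(H' (exp x) * exp x) / (1 + H (exp x))\<bar> \<le> C" for x
    using C(2)[of "exp x"] nonneg[of "exp x"] by (simp add: abs_mult pos_divide_le_eq mult.commute)
  have "norm (L (ln (t / \<delta>)) - L (ln t)) \<le> C * norm (ln (t / \<delta>) - ln t)"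
    by (rule field_differentiable_bound[of UNIV, OF _ has_field_derivative_at_within[OF L]]) (use Lb in auto)
  also have "norm (ln (t / \<delta>) - ln t) \<le> ln 2"
  proof -
    have "ln \<delta> \<le> ln 2" using t(2) by (intro ln_mono) auto
    moreover have "ln (1 / 2) \<le> ln \<delta>" using t(2) by (intro ln_mono) auto
    moreover have "ln (1 / 2 :: real) = - ln 2" by (simp add: ln_div)
    moreover have "ln (t / \<delta>) - ln t = - ln \<delta>" using t by (simp add: ln_div)
    ultimately show ?thesis unfolding real_norm_def by linarith
  qed
  finally have "L (ln (t / \<delta>)) - L (ln t) \<le> C * ln 2"
    using C(1) by auto
  then have "exp (L (ln (t / \<delta>))) \<le> exp (C * ln 2 + L (ln t))" by simp
  moreover have "exp (L (ln x)) = 1 + H x" if "x > 0" for x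
    using that nonneg[OF that] by (simp add: L_def add_pos_nonneg)
  ultimately show ?thesis using t by (simp add: exp_add powr_def)
qed

text \<open>The perspective \<open>\<delta> * H (t / \<delta>)\<close> is the bulk density after a
  change of variables with Jacobian \<delta>. Its derivative in \<delta> is H(t/\<delta>) -
  (t/\<delta>) H'(t/\<delta>), which the bound on t H'(t) and \<open>scaling_bound\<close> control
  by 1 + H(t).\<close>

lemma perspective_lipschitz:
  fixes H H' :: "real \<Rightarrow> real"
  assumes nonneg: "\<And>t. t > 0 \<Longrightarrow> H t \<ge> 0"
    and der: "\<And>t. t > 0 \<Longrightarrow> (H has_real_derivative H' t) (at t)"
    and C: "C > 0" "\<And>t. t > 0 \<Longrightarrow> \<bar>t * H' t\<bar> \<le> C * (1 + H t)"
    and t: "t > 0" "\<delta> \<in> {1/2..2}"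
  shows "\<bar>\<delta> * H (t / \<delta>) - H t\<bar> \<le> (1 + C) * 2 powr C * (1 + H t) * \<bar>\<delta> - 1\<bar>"
proof -
  have d: "((\<lambda>\<delta>. \<delta> * H (t / \<delta>)) has_real_derivative H (t / x) - t / x * H' (t / x)) (at x)" if "x > 0" for x
  proof -
    have "((\<lambda>\<delta>. H (t / \<delta>)) has_real_derivative H' (t / x) * (- t / x\<^sup>2)) (at x)"
      by (rule DERIV_chain2[OF der]) (use that t in \<open>auto intro!: derivative_eq_intros simp: power2_eq_square\<close>)
    from DERIV_mult'[OF DERIV_ident this]
    have "((\<lambda>\<delta>. \<delta> * H (t / \<delta>)) has_real_derivative x * (H' (t / x) * (- t / x\<^sup>2)) + 1 * H (t / x)) (at x)" .
    moreover have "x * (H' (t / x) * (- t / x\<^sup>2)) + 1 * H (t / x) = H (t / x) - t / x * H' (t / x)"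
      using that by (simp add: power2_eq_square)
    ultimately show ?thesis by (simp only:)
  qed
  have "norm (\<delta> * H (t / \<delta>) - 1 * H (t / 1)) \<le> (1 + C) * 2 powr C * (1 + H t) * norm (\<delta> - 1)"
  proof (rule field_differentiable_bound[where S = "{1/2..2}" and f = "\<lambda>\<delta>. \<delta> * H (t / \<delta>)"
        and f' = "\<lambda>x. H (t / x) - t / x * H' (t / x)"])
    fix x :: real assume x: "x \<in> {1/2..2}"
    then show "((\<lambda>\<delta>. \<delta> * H (t / \<delta>)) has_real_derivative H (t / x) - t / x * H' (t / x)) (at x within {1/2..2})"
      by (intro has_field_derivative_at_within[OF d]) auto
    have "t / x > 0" using x t by auto
    then have "norm (H (t / x) - t / x * H' (t / x)) \<le> H (t / x) + C * (1 + H (t / x))"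
      using C(2)[of "t / x"] nonneg[of "t / x"] unfolding real_norm_def by linarith
    also have "\<dots> \<le> (1 + C) * (1 + H (t / x))" by (simp add: algebra_simps)
    also have "\<dots> \<le> (1 + C) * (2 powr C * (1 + H t))"
      using C(1) by (intro mult_left_mono scaling_bound[OF nonneg der C t(1) x]) auto
    finally show "norm (H (t / x) - t / x * H' (t / x)) \<le> (1 + C) * 2 powr C * (1 + H t)" by simp
  qed (use t in auto)
  then show ?thesis by simp
qed

section \<open>First order expansion of the pulled-back energy density\<close>

lemma det_add_scaled: "det (mat 1 + t *\<^sub>R G) =
   1 + t * trace G + t\<^sup>2 * (cof G $ 1 $ 1 + cof G $ 2 $ 2 + cof G $ 3 $ 3) + t ^ 3 * det (G :: real^3^3)"
  by (simp add: det_3 mat_def trace_def sum_3 cof_components power2_eq_square power3_eq_cube algebra_simps)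

lemma norm_matrix_vector_mult: "norm (A *v v) \<le> norm A * norm (v :: real^'n)"
proof -
  have "norm (A *v v) \<le> L2_set (\<lambda>i. norm (A $ i) * norm v) UNIV"
    unfolding norm_vec_def[of "A *v v"]
    by (intro L2_set_mono) (auto simp: matrix_vector_mul_component Cauchy_Schwarz_ineq2)
  also have "\<dots> = norm A * norm v"
    by (simp add: norm_vec_def[of A] L2_set_left_distrib)
  finally show ?thesis .
qed

text \<open>The inverse has operator norm at most 2, so each of its nine entries is at most 2; this
  is the origin of the constant 18.\<close>

lemma norm_minv_le:
  assumes det: "det A \<noteq> 0" and A: "\<And>v. norm v \<le> 2 * norm (A *v v)"
  shows "norm (minv A) \<le> 18"
proof -
  have "norm (minv A) \<le> 3 * (3 * 2)"
  proof (intro norm_vec3_le)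
    fix i j
    have "minv A $ i $ j = (minv A *v axis j 1) $ i"
      by (simp add: matrix_vector_mult_def axis_def if_distrib cong: if_cong)
    also have "norm \<dots> \<le> norm (minv A *v axis j 1)" by (simp add: component_le_norm_cart)
    also have "\<dots> \<le> 2 * norm (A *v (minv A *v axis j 1))" by (rule A)
    also have "\<dots> = 2" using minv_mult(2)[OF det] by (simp add: matrix_vector_mul_assoc)
    finally show "norm (minv A $ i $ j) \<le> 2" .
  qed
  then show ?thesis by simp
qed

text \<open>The integrand of the energy of \<open>u \<circ> \<psi>\<^sup>-\<^sup>1\<close>, pulled back by \<open>\<psi>\<close>:
  here \<open>A = Du\<close> and \<open>P = D\<psi>\<close>.\<close>

definition pulled_density :: "(real \<Rightarrow> real) \<Rightarrow> real^3^3 \<Rightarrow> real^3^3 \<Rightarrow> real" where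
  "pulled_density H A P = det P * ((norm (A ** minv P))\<^sup>2 + H (det A / det P))"

text \<open>The Eshelby tensor of the density |A|^2 + H(det A), with the sign for which it is minus
  the derivative of \<open>pulled_density\<close> in P at the identity.\<close>

definition energy_momentum :: "(real \<Rightarrow> real) \<Rightarrow> real^3^3 \<Rightarrow> real^3^3" where
  "energy_momentum H A =
     2 *\<^sub>R (transpose A ** A) + mat (deriv H (det A) * det A - (norm A)\<^sup>2 - H (det A))"

lemma inner_matrix_mult: "(A ** G) \<bullet> A = (transpose A ** (A :: real^3^3)) \<bullet> (G :: real^3^3)"
  by (simp add: inner_vec_def matrix_matrix_mult_def transpose_def sum_3 algebra_simps)

lemma inner_mat: "mat c \<bullet> G = c * trace (G :: real^3^3)"
  by (simp add: inner_vec_def mat_def trace_def sum_3 algebra_simps)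

text \<open>An exact resolvent identity, obtained by multiplying out. Its explicit factor t serves
  both the difference quotient and the uniform bound.\<close>

lemma minv_perturbation:
  assumes "det (mat 1 + t *\<^sub>R G) \<noteq> 0"
  shows "minv (mat 1 + t *\<^sub>R G) - mat 1 = - t *\<^sub>R (G ** minv (mat 1 + t *\<^sub>R G))"
proof -
  have "(mat 1 + t *\<^sub>R G) ** minv (mat 1 + t *\<^sub>R G) = mat 1" using assms by (rule minv_mult)
  then have "minv (mat 1 + t *\<^sub>R G) + t *\<^sub>R (G ** minv (mat 1 + t *\<^sub>R G)) = mat 1"
    by (simp add: bounded_bilinear.add_left[OF bounded_bilinear_matrix_mult] scaleR_matrix_mult)
  then show ?thesis by (simp add: algebra_simps)
qed

text \<open>Write |x|^2 - |y|^2 = (x - y) . (x + y) and insert the resolvent identity in the first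
  factor.\<close>

lemma square_norm_mult_minv:
  fixes A G :: "real^3^3"
  assumes "det (mat 1 + t *\<^sub>R G) \<noteq> 0"
  shows "(norm (A ** minv (mat 1 + t *\<^sub>R G)))\<^sup>2 - (norm A)\<^sup>2 =
    - t * ((A ** (G ** minv (mat 1 + t *\<^sub>R G))) \<bullet> (A ** minv (mat 1 + t *\<^sub>R G) + A))"
proof -
  let ?B = "minv (mat 1 + t *\<^sub>R G)"
  have "A ** ?B - A = A ** (?B - mat 1)"
    by (simp add: bounded_bilinear.diff_right[OF bounded_bilinear_matrix_mult])
  also have "\<dots> = - t *\<^sub>R (A ** (G ** ?B))"
    unfolding minv_perturbation[OF assms]
    by (simp add: scaleR_matrix_mult bounded_bilinear.minus_right[OF bounded_bilinear_matrix_mult])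
  finally have 1: "A ** ?B - A = - t *\<^sub>R (A ** (G ** ?B))" .
  have 2: "(norm x)\<^sup>2 - (norm y)\<^sup>2 = (x - y) \<bullet> (x + y)" for x y :: "real^3^3"
    by (simp add: power2_norm_eq_inner inner_diff_left inner_add_right inner_commute[of y x])
  show ?thesis unfolding 2 1 inner_scaleR_left by (rule refl)
qed

lemma minv_one: "minv (mat 1) = mat 1"
  by (rule minv_unique) simp

lemma pulled_density_one: "pulled_density H A (mat 1) = (norm A)\<^sup>2 + H (det A)"
  by (simp add: pulled_density_def minv_one)

text \<open>Product rule at t = 0: the determinant contributes trace G, the gradient term -2 (A G) .
  A, and the bulk term -H'(det A) det A trace G. Continuity of the inverse at t = 0 comes from the
  resolvent identity and the uniform bound on the inverse.\<close>

lemma pulled_density_derivative: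
  assumes der: "(H has_real_derivative deriv H (det A)) (at (det A))"
    and B: "t0 > 0" "\<And>t. \<bar>t\<bar> \<le> t0 \<Longrightarrow> det (mat 1 + t *\<^sub>R G) \<noteq> 0 \<and> norm (minv (mat 1 + t *\<^sub>R G)) \<le> C"
  shows "((\<lambda>t. pulled_density H A (mat 1 + t *\<^sub>R G)) has_real_derivative - (energy_momentum H A \<bullet> G)) (at 0)"
proof -
  let ?P = "\<lambda>t. mat 1 + t *\<^sub>R G"
  have \<delta>: "((\<lambda>t. det (?P t)) has_real_derivative trace G) (at 0)"
    unfolding det_add_scaled by (auto intro!: derivative_eq_intros)
  obtain K where K: "K > 0" "\<And>(A :: real^3^3) (B :: real^3^3). norm (A ** B) \<le> norm A * norm B * K"
    using bounded_bilinear.pos_bounded[OF bounded_bilinear_matrix_mult] by blast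
  have ev: "\<forall>\<^sub>F t in at 0. \<bar>t\<bar> \<le> t0"
    unfolding eventually_at using B(1) by (intro exI[of _ t0]) (auto simp: dist_real_def)
  have lim: "((\<lambda>t. minv (?P t)) \<longlongrightarrow> mat 1) (at 0)"
  proof (rule LIM_zero_cancel, rule Lim_null_comparison)
    show "\<forall>\<^sub>F t in at 0. norm (minv (?P t) - mat 1) \<le> \<bar>t\<bar> * (norm G * C * K)"
      using ev
    proof eventually_elim
      case (elim t)
      have "norm (G ** minv (?P t)) \<le> norm G * norm (minv (?P t)) * K" by (rule K(2))
      also have "\<dots> \<le> norm G * C * K"
        using B(2)[OF elim] K(1) by (intro mult_right_mono mult_left_mono) auto
      finally have "norm (G ** minv (?P t)) \<le> norm G * C * K" .
      moreover have "minv (?P t) - mat 1 = - t *\<^sub>R (G ** minv (?P t))"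
        using B(2)[OF elim] by (intro minv_perturbation) auto
      ultimately show ?case by (simp add: mult_left_mono)
    qed
    show "((\<lambda>t. \<bar>t\<bar> * (norm G * C * K)) \<longlongrightarrow> 0) (at 0)"
      by (auto intro!: tendsto_eq_intros)
  qed
  have N: "((\<lambda>t. (norm (A ** minv (?P t)))\<^sup>2) has_real_derivative - 2 * ((A ** G) \<bullet> A)) (at 0)"
    unfolding DERIV_def
  proof (rule Lim_transform_eventually)
    have "((\<lambda>t. - ((A ** (G ** minv (?P t))) \<bullet> (A ** minv (?P t) + A))) \<longlongrightarrow> - ((A ** (G ** mat 1)) \<bullet> (A ** mat 1 + A))) (at 0)"
      by (intro tendsto_intros bounded_bilinear.tendsto[OF bounded_bilinear_matrix_mult] lim)
    moreover have "- ((A ** (G ** mat 1)) \<bullet> (A ** mat 1 + A)) = - 2 * ((A ** G) \<bullet> A)"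
      unfolding matrix_mul_rid inner_add_right by linarith
    ultimately show "((\<lambda>t. - ((A ** (G ** minv (?P t))) \<bullet> (A ** minv (?P t) + A))) \<longlongrightarrow> - 2 * ((A ** G) \<bullet> A)) (at 0)"
      by (simp only:)
    show "\<forall>\<^sub>F t in at 0. - ((A ** (G ** minv (?P t))) \<bullet> (A ** minv (?P t) + A)) =
        ((norm (A ** minv (?P (0 + t))))\<^sup>2 - (norm (A ** minv (?P 0)))\<^sup>2) / t"
      using ev eventually_neq_at_within[of 0 0 UNIV]
    proof eventually_elim
      case (elim t)
      then show ?case
        using square_norm_mult_minv[of t G A] B(2)[OF elim(1)] by (simp add: minv_one)
    qed
  qed
  have Hd: "((\<lambda>t. H (det A / det (?P t))) has_real_derivative deriv H (det A) * (- det A * trace G)) (at 0)"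
    by (rule DERIV_chain2[of H]) (use der in \<open>auto intro!: derivative_eq_intros \<delta>\<close>)
  have "((\<lambda>t. pulled_density H A (?P t)) has_real_derivative
     det (?P 0) * (- 2 * ((A ** G) \<bullet> A) + deriv H (det A) * (- det A * trace G))
     + trace G * ((norm (A ** minv (?P 0)))\<^sup>2 + H (det A / det (?P 0)))) (at 0)"
    unfolding pulled_density_def by (intro DERIV_mult' DERIV_add N Hd \<delta>)
  then show ?thesis
    by (simp add: minv_one energy_momentum_def inner_add_left inner_mat inner_matrix_mult algebra_simps)
qed

text \<open>With P = 1 + t G, the increment splits into (det P - 1) |A P^-1|^2, the change of the
  gradient term, and the change of the perspective of H; each is at most a multiple of |t| (1 +
  |A|^2 + H(det A)). The constant depends on G only through \<beta> and \<gamma>, and not on A or t,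
  so it provides a dominating function.\<close>

lemma pulled_density_bound:
  assumes nonneg: "\<And>t. t > 0 \<Longrightarrow> H t \<ge> 0"
    and der: "\<And>t. t > 0 \<Longrightarrow> (H has_real_derivative H' t) (at t)"
    and C: "C > 0" "\<And>t. t > 0 \<Longrightarrow> \<bar>t * H' t\<bar> \<le> C * (1 + H t)"
  obtains L where "L \<ge> 0" "\<And>A G t. det A > 0 \<Longrightarrow> norm G \<le> \<beta> \<Longrightarrow> det (mat 1 + t *\<^sub>R G) \<in> {1/2..2} \<Longrightarrow>
    \<bar>det (mat 1 + t *\<^sub>R G) - 1\<bar> \<le> \<gamma> * \<bar>t\<bar> \<Longrightarrow> norm (minv (mat 1 + t *\<^sub>R G)) \<le> 18 \<Longrightarrow>
    \<bar>pulled_density H A (mat 1 + t *\<^sub>R G) - ((norm A)\<^sup>2 + H (det A))\<bar> \<le> L * (1 + (norm A)\<^sup>2 + H (det A)) * \<bar>t\<bar>"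
proof -
  obtain K where K: "K > 0" "\<And>(A :: real^3^3) (B :: real^3^3). norm (A ** B) \<le> norm A * norm B * K"
    using bounded_bilinear.pos_bounded[OF bounded_bilinear_matrix_mult] by blast
  define Q where "Q = (1 + C) * 2 powr C"
  have Q: "Q \<ge> 0" using C(1) by (simp add: Q_def)
  define L where "L = \<bar>\<gamma>\<bar> * (18 * K)\<^sup>2 + \<bar>\<beta>\<bar> * 18 * K\<^sup>2 * (18 * K + 1) + Q * \<bar>\<gamma>\<bar>"
  have L: "L \<ge> 0" using K(1) Q by (simp add: L_def)
  show ?thesis
  proof (rule that[OF L])
    fix A G :: "real^3^3" and t
    let ?P = "mat 1 + t *\<^sub>R G"
    assume A: "det A > 0" and G: "norm G \<le> \<beta>" and \<delta>: "det ?P \<in> {1/2..2}" "\<bar>det ?P - 1\<bar> \<le> \<gamma> * \<bar>t\<bar>"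
      and B: "norm (minv ?P) \<le> 18"
    have \<gamma>: "\<bar>det ?P - 1\<bar> \<le> \<bar>\<gamma>\<bar> * \<bar>t\<bar>"
      using \<delta>(2) mult_right_mono[OF abs_ge_self[of \<gamma>], of "\<bar>t\<bar>"] by simp
    let ?N = "(norm (A ** minv ?P))\<^sup>2"
    have AB: "norm (A ** minv ?P) \<le> 18 * K * norm A"
    proof -
      have "norm (A ** minv ?P) \<le> norm A * norm (minv ?P) * K" by (rule K(2))
      also have "\<dots> \<le> norm A * 18 * K" using B K(1) by (intro mult_right_mono mult_left_mono) auto
      finally show ?thesis by (simp add: algebra_simps)
    qed
    have GB: "norm (G ** minv ?P) \<le> \<bar>\<beta>\<bar> * 18 * K"
    proof -
      have "norm (G ** minv ?P) \<le> norm G * norm (minv ?P) * K" by (rule K(2))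
      also have "\<dots> \<le> \<bar>\<beta>\<bar> * 18 * K" using B G K(1) by (intro mult_right_mono mult_mono) auto
      finally show ?thesis .
    qed
    have 1: "\<bar>(det ?P - 1) * ?N\<bar> \<le> \<bar>\<gamma>\<bar> * (18 * K)\<^sup>2 * (norm A)\<^sup>2 * \<bar>t\<bar>"
    proof -
      have "\<bar>(det ?P - 1) * ?N\<bar> \<le> (\<bar>\<gamma>\<bar> * \<bar>t\<bar>) * (18 * K * norm A)\<^sup>2"
        unfolding abs_mult by (intro mult_mono \<gamma>) (use power_mono[OF AB, of 2] in auto)
      then show ?thesis by (simp add: power_mult_distrib algebra_simps)
    qed
    have 2: "\<bar>?N - (norm A)\<^sup>2\<bar> \<le> \<bar>\<beta>\<bar> * 18 * K\<^sup>2 * (18 * K + 1) * (norm A)\<^sup>2 * \<bar>t\<bar>"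
    proof -
      have "norm (A ** (G ** minv ?P)) \<le> norm A * norm (G ** minv ?P) * K" by (rule K(2))
      also have "\<dots> \<le> norm A * (\<bar>\<beta>\<bar> * 18 * K) * K"
        using GB K(1) by (intro mult_right_mono mult_left_mono) auto
      finally have a: "norm (A ** (G ** minv ?P)) \<le> \<bar>\<beta>\<bar> * 18 * K\<^sup>2 * norm A"
        by (simp add: power2_eq_square algebra_simps)
      have b: "norm (A ** minv ?P + A) \<le> (18 * K + 1) * norm A"
        using norm_triangle_ineq[of "A ** minv ?P" A] AB by (simp add: algebra_simps)
      have "\<bar>?N - (norm A)\<^sup>2\<bar> = \<bar>t\<bar> * \<bar>(A ** (G ** minv ?P)) \<bullet> (A ** minv ?P + A)\<bar>"
        using square_norm_mult_minv[of t G A] \<delta>(1) by (simp add: abs_mult)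
      also have "\<dots> \<le> \<bar>t\<bar> * (norm (A ** (G ** minv ?P)) * norm (A ** minv ?P + A))"
        by (intro mult_left_mono Cauchy_Schwarz_ineq2) auto
      also have "\<dots> \<le> \<bar>t\<bar> * ((\<bar>\<beta>\<bar> * 18 * K\<^sup>2 * norm A) * ((18 * K + 1) * norm A))"
        using K(1) by (intro mult_left_mono mult_mono a b) auto
      finally show ?thesis by (simp add: power2_eq_square algebra_simps)
    qed
    have 3: "\<bar>det ?P * H (det A / det ?P) - H (det A)\<bar> \<le> Q * \<bar>\<gamma>\<bar> * (1 + H (det A)) * \<bar>t\<bar>"
    proof -
      have "\<bar>det ?P * H (det A / det ?P) - H (det A)\<bar> \<le> Q * (1 + H (det A)) * \<bar>det ?P - 1\<bar>"
        unfolding Q_def by (rule perspective_lipschitz[OF nonneg der C A \<delta>(1)])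
      also have "\<dots> \<le> Q * (1 + H (det A)) * (\<bar>\<gamma>\<bar> * \<bar>t\<bar>)"
        using Q nonneg[OF A] by (intro mult_left_mono \<gamma>) auto
      finally show ?thesis by (simp add: algebra_simps)
    qed
    let ?e = "1 + (norm A)\<^sup>2 + H (det A)"
    have e: "(norm A)\<^sup>2 \<le> ?e" "1 + H (det A) \<le> ?e" using nonneg[OF A] by auto
    have "pulled_density H A ?P - ((norm A)\<^sup>2 + H (det A)) =
       (det ?P - 1) * ?N + (?N - (norm A)\<^sup>2) + (det ?P * H (det A / det ?P) - H (det A))"
      by (simp add: pulled_density_def algebra_simps)
    then have "\<bar>pulled_density H A ?P - ((norm A)\<^sup>2 + H (det A))\<bar> \<le>
      \<bar>\<gamma>\<bar> * (18 * K)\<^sup>2 * (norm A)\<^sup>2 * \<bar>t\<bar> + \<bar>\<beta>\<bar> * 18 * K\<^sup>2 * (18 * K + 1) * (norm A)\<^sup>2 * \<bar>t\<bar> + Q * \<bar>\<gamma>\<bar> * (1 + H (det A)) * \<bar>t\<bar>"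
      using 1 2 3 by linarith
    also have "\<dots> \<le> \<bar>\<gamma>\<bar> * (18 * K)\<^sup>2 * ?e * \<bar>t\<bar> + \<bar>\<beta>\<bar> * 18 * K\<^sup>2 * (18 * K + 1) * ?e * \<bar>t\<bar> + Q * \<bar>\<gamma>\<bar> * ?e * \<bar>t\<bar>"
      using Q K(1) by (intro add_mono mult_right_mono mult_left_mono e) auto
    also have "\<dots> = L * ?e * \<bar>t\<bar>" by (simp add: L_def distrib_right)
    finally show "\<bar>pulled_density H A ?P - ((norm A)\<^sup>2 + H (det A))\<bar> \<le> L * ?e * \<bar>t\<bar>" .
  qed
qed

section \<open>Inner variations\<close>

lemma test_function_bounded:
  fixes f :: "'a::real_normed_vector \<Rightarrow> 'b::real_normed_vector"
  assumes f: "continuous_on UNIV f" and C: "compact C" "\<And>x. x \<notin> C \<Longrightarrow> f x = 0"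
  shows "\<exists>B>0. \<forall>x. norm (f x) \<le> B"
  using bounded_continuous_compact_support[OF f C] by metis

lemma jacobian_id_add:
  fixes X :: "real^3 \<Rightarrow> real^3"
  assumes "smooth_on UNIV X"
  shows "jacobian (\<lambda>x. x + t *\<^sub>R X x) (at y) = mat 1 + t *\<^sub>R jacobian X (at y)"
proof (rule jacobianI)
  show "((\<lambda>x. x + t *\<^sub>R X x) has_derivative (\<lambda>h. (mat 1 + t *\<^sub>R jacobian X (at y)) *v h)) (at y)"
    unfolding matrix_vector_mult_add_rdistrib matrix_vector_mul_lid scaleR_matrix_vector_assoc[symmetric]
    by (intro has_derivative_add has_derivative_ident has_derivative_scaleR_right smooth_jacobian(1) assms)
qed

lemma lipschitz_jacobian_bound:
  fixes X :: "real^3 \<Rightarrow> real^3"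
  assumes "smooth_on UNIV X" "\<And>y. norm (jacobian X (at y)) \<le> \<beta>"
  shows "norm (X x - X y) \<le> \<beta> * norm (x - y)"
proof (rule differentiable_bound[of UNIV X "\<lambda>x h. jacobian X (at x) *v h"])
  show "onorm (\<lambda>h. jacobian X (at x) *v h) \<le> \<beta>" for x
  proof (rule onorm_bound)
    show "0 \<le> \<beta>" using assms(2)[of 0] norm_ge_zero order_trans by blast
    show "norm (jacobian X (at x) *v v) \<le> \<beta> * norm v" for v
      using norm_matrix_vector_mult[of "jacobian X (at x)" v] mult_right_mono[OF assms(2)[of x], of "norm v"] by simp
  qed
qed (use smooth_jacobian(1)[OF assms(1)] in auto)

text \<open>For |t| \<le> t0 the field t X has Lipschitz constant 1/2, so Banach's fixed point
  theorem inverts id + t X. The constant 18 passed to \<open>smooth_diffeo\<close> bounds the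
  inverse matrix, by \<open>norm_minv_le\<close>, and also the determinant, which is at most
  2.\<close>

lemma inner_variation_diffeo:
  fixes X :: "real^3 \<Rightarrow> real^3"
  assumes X: "X \<in> test_functions \<Omega>" and \<Omega>: "open \<Omega>" "bounded \<Omega>"
  obtains t0 \<beta> \<gamma> K where "t0 > 0" "\<And>y. norm (jacobian X (at y)) \<le> \<beta>" "t0 * \<beta> \<le> 1 / 2"
    "\<And>t. \<bar>t\<bar> \<le> t0 \<Longrightarrow> smooth_diffeo \<Omega> (\<lambda>x. x + t *\<^sub>R X x) (inv (\<lambda>x. x + t *\<^sub>R X x)) 1 18"
    "\<And>t y. \<bar>t\<bar> \<le> t0 \<Longrightarrow> det (mat 1 + t *\<^sub>R jacobian X (at y)) \<in> {1/2..2}"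
    "\<And>t y. \<bar>t\<bar> \<le> t0 \<Longrightarrow> \<bar>det (mat 1 + t *\<^sub>R jacobian X (at y)) - 1\<bar> \<le> \<gamma> * \<bar>t\<bar>"
    "\<And>t y. \<bar>t\<bar> \<le> t0 \<Longrightarrow> norm (minv (mat 1 + t *\<^sub>R jacobian X (at y))) \<le> 18"
    "compact K" "K \<subseteq> \<Omega>" "\<And>t x. \<bar>t\<bar> \<le> t0 \<Longrightarrow> x \<notin> K \<Longrightarrow> inv (\<lambda>x. x + t *\<^sub>R X x) x = x"
proof -
  obtain K where K: "smooth_on UNIV X" "compact K" "K \<subseteq> \<Omega>" "\<And>x. x \<notin> K \<Longrightarrow> X x = 0"
    using test_functionsE[OF X] by metis
  let ?G = "\<lambda>y. jacobian X (at y)"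
  have G0: "?G y = 0" if "y \<notin> K" for y
    by (rule jacobian_zero_outside_support[OF K(1,2,4) that])
  obtain \<beta> where \<beta>: "\<beta> > 0" "\<And>y. norm (?G y) \<le> \<beta>"
    using test_function_bounded[OF continuous_jacobian[OF K(1)] K(2)] G0 by blast
  \<comment> \<open>The sum of the principal 2 x 2 minors, which is the coefficient of
    \<open>t\<^sup>2\<close> in det (1 + t G).\<close>
  let ?e2 = "\<lambda>G :: real^3^3. cof G $ 1 $ 1 + cof G $ 2 $ 2 + cof G $ 3 $ 3"
  have c: "continuous_on UNIV (\<lambda>y. trace (?G y))" "continuous_on UNIV (\<lambda>y. ?e2 (?G y))" "continuous_on UNIV (\<lambda>y. det (?G y))"
    unfolding trace_def
    by (intro continuous_on_sum continuous_on_add smooth_continuous smooth_cof smooth_det smooth_jacobian(2) K(1))+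
  have z: "trace (?G y) = 0" "?e2 (?G y) = 0" "det (?G y) = 0" if "y \<notin> K" for y
    unfolding G0[OF that] by (simp_all add: trace_def cof_components det_3)
  obtain b1 b2 b3 where b: "b1 > 0" "\<And>y. norm (trace (?G y)) \<le> b1" "b2 > 0" "\<And>y. norm (?e2 (?G y)) \<le> b2"
      "b3 > 0" "\<And>y. norm (det (?G y)) \<le> b3"
    using test_function_bounded[OF c(1) K(2) z(1)] test_function_bounded[OF c(2) K(2) z(2)]
      test_function_bounded[OF c(3) K(2) z(3)] by blast
  define \<gamma> where "\<gamma> = b1 + b2 + b3"
  have \<gamma>: "\<gamma> > 0" using b by (simp add: \<gamma>_def)
  \<comment> \<open>The three bounds make the powers of t at most |t|, the Lipschitz constant of t X
    at most 1/2, and the deviation of the determinant from 1 at most 1/2.\<close>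
  define t0 where "t0 = min 1 (min (1 / (2 * \<beta>)) (1 / (2 * \<gamma>)))"
  have t0: "t0 > 0" "t0 \<le> 1" "t0 * \<beta> \<le> 1 / 2" "t0 * \<gamma> \<le> 1 / 2"
  proof -
    show "t0 > 0" "t0 \<le> 1" using \<beta>(1) \<gamma> by (auto simp: t0_def)
    have "t0 \<le> 1 / (2 * \<beta>)" "t0 \<le> 1 / (2 * \<gamma>)" by (auto simp: t0_def)
    then show "t0 * \<beta> \<le> 1 / 2" "t0 * \<gamma> \<le> 1 / 2"
      using \<beta>(1) \<gamma> by (auto simp: field_simps)
  qed
  have det1: "\<bar>det (mat 1 + t *\<^sub>R ?G y) - 1\<bar> \<le> \<gamma> * \<bar>t\<bar>" if t: "\<bar>t\<bar> \<le> t0" for t y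
  proof -
    have t1: "\<bar>t\<bar> \<le> 1" using t t0(2) by simp
    have p: "\<bar>t\<^sup>2\<bar> \<le> \<bar>t\<bar>" "\<bar>t ^ 3\<bar> \<le> \<bar>t\<bar>"
      using power_decreasing[of 1 2 "\<bar>t\<bar>"] power_decreasing[of 1 3 "\<bar>t\<bar>"] t1 by (simp_all add: power_abs)
    have "det (mat 1 + t *\<^sub>R ?G y) - 1 = t * trace (?G y) + t\<^sup>2 * ?e2 (?G y) + t ^ 3 * det (?G y)"
      by (simp add: det_add_scaled)
    also have "\<bar>\<dots>\<bar> \<le> \<bar>t * trace (?G y)\<bar> + \<bar>t\<^sup>2 * ?e2 (?G y)\<bar> + \<bar>t ^ 3 * det (?G y)\<bar>" by linarith
    also have "\<dots> \<le> \<bar>t\<bar> * b1 + \<bar>t\<bar> * b2 + \<bar>t\<bar> * b3"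
      unfolding abs_mult using b p by (intro add_mono mult_mono) auto
    finally show ?thesis by (simp add: \<gamma>_def algebra_simps)
  qed
  have det2: "det (mat 1 + t *\<^sub>R ?G y) \<in> {1/2..2}" if t: "\<bar>t\<bar> \<le> t0" for t y
  proof -
    have "\<bar>t\<bar> * \<gamma> \<le> t0 * \<gamma>" using t \<gamma> by (intro mult_right_mono) auto
    then have "\<gamma> * \<bar>t\<bar> \<le> 1 / 2" unfolding mult.commute[of \<gamma>] using t0(4) by linarith
    then show ?thesis using det1[OF t, of y] by (simp add: abs_le_iff)
  qed
  have half: "\<bar>t\<bar> * \<beta> \<le> 1 / 2" if "\<bar>t\<bar> \<le> t0" for t
  proof -
    have "\<bar>t\<bar> * \<beta> \<le> t0 * \<beta>" using that \<beta>(1) by (intro mult_right_mono) auto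
    then show ?thesis using t0(3) by linarith
  qed
  have minv: "norm (minv (mat 1 + t *\<^sub>R ?G y)) \<le> 18" if t: "\<bar>t\<bar> \<le> t0" for t y
  proof (rule norm_minv_le)
    show "det (mat 1 + t *\<^sub>R ?G y) \<noteq> 0" using det2[OF t, of y] by auto
    fix v :: "real^3"
    have "norm (t *\<^sub>R (?G y *v v)) \<le> \<bar>t\<bar> * (\<beta> * norm v)"
      using norm_matrix_vector_mult[of "?G y" v] mult_right_mono[OF \<beta>(2)[of y], of "norm v"]
      by (simp add: mult_left_mono)
    also have "\<dots> \<le> 1 / 2 * norm v"
      using mult_right_mono[OF half[OF t], of "norm v"] by (simp add: mult.assoc)
    finally have "norm (t *\<^sub>R (?G y *v v)) \<le> 1 / 2 * norm v" .
    moreover have "(mat 1 + t *\<^sub>R ?G y) *v v = v + t *\<^sub>R (?G y *v v)"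
      by (simp add: matrix_vector_mult_add_rdistrib scaleR_matrix_vector_assoc)
    moreover have "norm v \<le> norm (v + t *\<^sub>R (?G y *v v)) + norm (t *\<^sub>R (?G y *v v))"
      by (metis add_diff_cancel_right' norm_triangle_ineq4)
    ultimately show "norm v \<le> 2 * norm ((mat 1 + t *\<^sub>R ?G y) *v v)" by simp
  qed
  have lip: "norm (t *\<^sub>R X x - t *\<^sub>R X y) \<le> 1 / 2 * norm (x - y)" if t: "\<bar>t\<bar> \<le> t0" for t x y
  proof -
    have "norm (t *\<^sub>R X x - t *\<^sub>R X y) = \<bar>t\<bar> * norm (X x - X y)"
      by (simp flip: scaleR_diff_right)
    also have "\<dots> \<le> \<bar>t\<bar> * (\<beta> * norm (x - y))"
      by (intro mult_left_mono lipschitz_jacobian_bound[OF K(1) \<beta>(2)]) auto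
    also have "\<dots> \<le> 1 / 2 * norm (x - y)"
      using mult_right_mono[OF half[OF t], of "norm (x - y)"] by (simp add: mult.assoc)
    finally show ?thesis .
  qed
  \<comment> \<open>The factor 2 is 1 / (1 - 1/2). The estimate gives injectivity, and later the
    Lipschitz continuity of the inverse.\<close>
  have expand: "norm (x - y) \<le> 2 * norm ((x + t *\<^sub>R X x) - (y + t *\<^sub>R X y))" if t: "\<bar>t\<bar> \<le> t0" for t x y
  proof -
    have "x - y = ((x + t *\<^sub>R X x) - (y + t *\<^sub>R X y)) - (t *\<^sub>R X x - t *\<^sub>R X y)" by simp
    then have "norm (x - y) \<le> norm ((x + t *\<^sub>R X x) - (y + t *\<^sub>R X y)) + norm (t *\<^sub>R X x - t *\<^sub>R X y)"
      by (metis norm_triangle_ineq4)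
    then show ?thesis using lip[OF t, of x y] by simp
  qed
  have bij: "bij (\<lambda>x. x + t *\<^sub>R X x)" if t: "\<bar>t\<bar> \<le> t0" for t
    unfolding bij_def
  proof
    show "inj (\<lambda>x. x + t *\<^sub>R X x)"
    proof (rule injI)
      fix x y assume "x + t *\<^sub>R X x = y + t *\<^sub>R X y"
      then show "x = y" using expand[OF t, of x y] by simp
    qed
    have "\<exists>x. x + t *\<^sub>R X x = y" for y
    proof -
      have "\<exists>!x. y - t *\<^sub>R X x = x"
        by (rule banach_fix_type[of "1/2"]) (use lip[OF t] in \<open>auto simp: dist_norm norm_minus_commute\<close>)
      then obtain x where "y - t *\<^sub>R X x = x" by blast
      then have "x + t *\<^sub>R X x = y" by (metis diff_add_cancel)
      then show ?thesis by blast
    qed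
    then show "surj (\<lambda>x. x + t *\<^sub>R X x)" unfolding surj_def by metis
  qed
  have fixed: "inv (\<lambda>x. x + t *\<^sub>R X x) x = x" if t: "\<bar>t\<bar> \<le> t0" and x: "x \<notin> K" for t x
    using inv_f_f[OF bij_is_inj[OF bij[OF t]], of x] K(4)[OF x] by simp
  have "smooth_diffeo \<Omega> (\<lambda>x. x + t *\<^sub>R X x) (inv (\<lambda>x. x + t *\<^sub>R X x)) 1 18" if t: "\<bar>t\<bar> \<le> t0" for t
  proof
    let ?\<psi> = "\<lambda>x. x + t *\<^sub>R X x"
    show "smooth_on UNIV ?\<psi>"
      by (intro smooth_add smooth_scaleR smooth_const smooth_linear bounded_linear_ident K(1))
    show l: "inv ?\<psi> (x + t *\<^sub>R X x) = x" for x
      using inv_f_f[OF bij_is_inj[OF bij[OF t]], of x] .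
    show r: "inv ?\<psi> x + t *\<^sub>R X (inv ?\<psi> x) = x" for x
      using surj_f_inv_f[OF bij_is_surj[OF bij[OF t]], of x] .
    \<comment> \<open>A point of K cannot come from outside \<Omega>, because X vanishes there and
      the map is the identity.\<close>
    have mem: "inv ?\<psi> x \<in> \<Omega> \<longleftrightarrow> x \<in> \<Omega>" for x
    proof (cases "x \<in> K \<or> inv ?\<psi> x \<in> K")
      case False
      then show ?thesis using fixed[OF t, of x] by simp
    next
      case True
      have "inv ?\<psi> x \<in> \<Omega>" if "x \<in> K"
      proof (rule ccontr)
        assume n: "inv ?\<psi> x \<notin> \<Omega>"
        then have "inv ?\<psi> x \<notin> K" using K(3) by blast
        then have "inv ?\<psi> x = x" using r[of x] K(4) by simp
        then show False using n that K(3) by auto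
      qed
      moreover have "x \<in> \<Omega>" if "inv ?\<psi> x \<in> K"
        using fixed[OF t, of x] K(3) that by (cases "x \<in> K") auto
      ultimately show ?thesis using True K(3) by blast
    qed
    show "?\<psi> ` \<Omega> = \<Omega>"
    proof (intro set_eqI iffI)
      fix x assume "x \<in> ?\<psi> ` \<Omega>"
      then show "x \<in> \<Omega>" using mem l by fastforce
    next
      fix x assume "x \<in> \<Omega>"
      then have "?\<psi> (inv ?\<psi> x) \<in> ?\<psi> ` \<Omega>" using mem[of x] by (intro imageI) simp
      then show "x \<in> ?\<psi> ` \<Omega>" by (simp only: r)
    qed
    have "norm (inv ?\<psi> x - inv ?\<psi> y) \<le> 2 * norm (x - y)" for x y
      using expand[OF t, of "inv ?\<psi> x" "inv ?\<psi> y"] unfolding r .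
    then have "2-lipschitz_on UNIV (inv ?\<psi>)"
      by (intro lipschitz_onI) (auto simp: dist_norm)
    then show "continuous_on UNIV (inv ?\<psi>)" by (rule lipschitz_on_continuous_on)
    note j = jacobian_id_add[OF K(1), of t]
    show "det (jacobian ?\<psi> (at x)) \<noteq> 0" "1 * det (jacobian ?\<psi> (at x)) = \<bar>det (jacobian ?\<psi> (at x))\<bar>"
      "\<bar>det (jacobian ?\<psi> (at x))\<bar> \<le> 18" for x
      using det2[OF t, of x] unfolding j by auto
    show "norm (minv (jacobian ?\<psi> (at x))) \<le> 18" for x
      unfolding j by (rule minv[OF t])
  qed (use \<Omega> in auto)
  then show ?thesis
    using that[OF t0(1) \<beta>(2) t0(3) _ det2 det1 minv K(2,3) fixed] by blast
qed

section \<open>Measurability of the densities and derivative of the energy at t = 0\<close>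

lemma continuous_on_det: "continuous_on UNIV (det :: real^3^3 \<Rightarrow> real)"
  unfolding det_3[abs_def] by (intro continuous_intros)

text \<open>As h is continuous on (0, \<infinity>) only, it is cut off there by an indicator; since
  d > 0 almost everywhere, this changes the composite on a null set only.\<close>

lemma measurable_compose_positive:
  fixes h :: "real \<Rightarrow> real" and d :: "real^3 \<Rightarrow> real"
  assumes S: "S \<in> sets lebesgue" and h: "continuous_on {0<..} h"
    and d: "d \<in> borel_measurable (lebesgue_on S)" "AE x in lebesgue_on S. d x > 0"
  shows "(\<lambda>x. h (d x)) \<in> borel_measurable (lebesgue_on S)"
proof (rule measurable_cong_AE_lebesgue_on[OF S])
  have "(\<lambda>t. indicator {0<..} t *\<^sub>R h t) \<in> borel_measurable borel"
    by (rule borel_measurable_continuous_on_indicator[OF _ h]) simp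
  from measurable_compose[OF d(1) this]
  show "(\<lambda>x. indicator {0<..} (d x) *\<^sub>R h (d x)) \<in> borel_measurable (lebesgue_on S)" .
  show "AE x in lebesgue_on S. indicator {0<..} (d x) *\<^sub>R h (d x) = h (d x)"
    using d(2) by eventually_elim simp
qed simp

lemma measurable_det:
  assumes "D \<in> borel_measurable M"
  shows "(\<lambda>x. det (D x :: real^3^3)) \<in> borel_measurable M"
  using measurable_compose[OF assms borel_measurable_continuous_onI[OF continuous_on_det]] .

lemma measurable_pulled_density:
  fixes D P :: "real^3 \<Rightarrow> real^3^3"
  assumes S: "S \<in> sets lebesgue" and H: "continuous_on {0<..} H"
    and D: "D \<in> borel_measurable (lebesgue_on S)" "AE x in lebesgue_on S. det (D x) > 0"
    and P: "P \<in> borel_measurable (lebesgue_on S)" "(\<lambda>x. minv (P x)) \<in> borel_measurable (lebesgue_on S)" "\<And>x. det (P x) > 0"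
  shows "(\<lambda>x. pulled_density H (D x) (P x)) \<in> borel_measurable (lebesgue_on S)"
proof -
  have "(\<lambda>x. det (D x) / det (P x)) \<in> borel_measurable (lebesgue_on S)"
    by (intro borel_measurable_divide measurable_det D P)
  then have "(\<lambda>x. H (det (D x) / det (P x))) \<in> borel_measurable (lebesgue_on S)"
    by (rule measurable_compose_positive[OF S H]) (use D(2) P(3) in \<open>auto elim!: eventually_mono\<close>)
  moreover have "(\<lambda>x. (norm (D x ** minv (P x)))\<^sup>2) \<in> borel_measurable (lebesgue_on S)"
    by (rule borel_measurable_continuous_Pair[OF D(1) P(2)])
      (intro bounded_bilinear.continuous_on[OF bounded_bilinear_matrix_mult] continuous_on_power continuous_on_norm
        continuous_on_fst continuous_on_snd continuous_on_id)
  ultimately show ?thesis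
    unfolding pulled_density_def by (intro borel_measurable_times borel_measurable_add measurable_det P(1))
qed

text \<open>The energy takes values in \<open>ennreal\<close>, while the first variation is computed
  with Bochner integrals; integrability and nonnegativity of the pulled-back density link the
  two.\<close>

lemma (in smooth_diffeo) energy_push:
  assumes u: "u \<in> W12 \<Omega>" and \<sigma>: "\<sigma> = 1"
    and int: "integrable (lebesgue_on \<Omega>) (\<lambda>x. pulled_density H (weak_gradient \<Omega> u x) (J x))"
    and nonneg: "AE x in lebesgue_on \<Omega>. 0 \<le> pulled_density H (weak_gradient \<Omega> u x) (J x)"
  shows "energy \<Omega> H (\<lambda>x. u (\<eta> x)) = ennreal (LINT x|lebesgue_on \<Omega>. pulled_density H (weak_gradient \<Omega> u x) (J x))"
proof -
  let ?D = "weak_gradient \<Omega> u"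
  let ?g = "\<lambda>x. (norm (push_gradient ?D x))\<^sup>2 + H (det (push_gradient ?D x))"
  have dJ: "\<bar>det (J x)\<bar> = det (J x)" for x using sign[of x] \<sigma> by simp
  have pd: "\<bar>det (J x)\<bar> * ?g (\<psi> x) = pulled_density H (?D x) (J x)" for x
    using det_nonzero[of x] by (simp add: pulled_density_def push_gradient_def det_mul det_minv dJ)
  have gi: "integrable (lebesgue_on \<Omega>) ?g" and ge: "(LINT x|lebesgue_on \<Omega>. ?g x) = (LINT x|lebesgue_on \<Omega>. pulled_density H (?D x) (J x))"
    using cov[of ?g] int unfolding pd by blast+
  have "AE x in lebesgue_on \<Omega>. 0 \<le> ?g (\<psi> x)"
    using nonneg
  proof eventually_elim
    case (elim x)
    then show ?case unfolding pd[symmetric] using det_nonzero[of x] by (simp add: zero_le_mult_iff)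
  qed
  from AE_\<eta>[OF this] have "AE x in lebesgue_on \<Omega>. 0 \<le> ?g x" by simp
  then have "(\<integral>\<^sup>+x. ennreal (?g x) \<partial>lebesgue_on \<Omega>) = ennreal (LINT x|lebesgue_on \<Omega>. ?g x)"
    by (rule nn_integral_eq_integral[OF gi])
  moreover have "energy \<Omega> H (\<lambda>x. u (\<eta> x)) = (\<integral>\<^sup>+x. ennreal (?g x) \<partial>lebesgue_on \<Omega>)"
    unfolding energy_def by (rule nn_integral_cong_AE) (use W12_push(2)[OF u] in eventually_elim, simp)
  ultimately show ?thesis by (simp add: ge)
qed

text \<open>Dominated convergence: the majorant L (1 + energy density) comes from
  \<open>pulled_density_bound\<close>, the pointwise limit from
  \<open>pulled_density_derivative\<close>. The sequence \<open>s\<close> is left free so that t can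
  approach 0 from either side.\<close>

lemma inner_variation_tendsto:
  fixes X :: "real^3 \<Rightarrow> real^3"
  assumes \<Omega>: "open \<Omega>" "bounded \<Omega>"
    and D: "D \<in> borel_measurable (lebesgue_on \<Omega>)" "AE x in lebesgue_on \<Omega>. det (D x) > 0"
    and e: "integrable (lebesgue_on \<Omega>) (\<lambda>x. (norm (D x))\<^sup>2 + H (det (D x)))"
    and nonneg: "\<And>t. t > 0 \<Longrightarrow> H t \<ge> 0"
    and der: "\<And>t. t > 0 \<Longrightarrow> (H has_real_derivative deriv H t) (at t)"
    and C: "C > 0" "\<And>t. t > 0 \<Longrightarrow> \<bar>t * deriv H t\<bar> \<le> C * (1 + H t)"
    and X: "smooth_on UNIV X"
    and t0: "t0 > 0" "\<And>y. norm (jacobian X (at y)) \<le> \<beta>"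
      "\<And>t y. \<bar>t\<bar> \<le> t0 \<Longrightarrow> det (mat 1 + t *\<^sub>R jacobian X (at y)) \<in> {1/2..2}"
      "\<And>t y. \<bar>t\<bar> \<le> t0 \<Longrightarrow> \<bar>det (mat 1 + t *\<^sub>R jacobian X (at y)) - 1\<bar> \<le> \<gamma> * \<bar>t\<bar>"
      "\<And>t y. \<bar>t\<bar> \<le> t0 \<Longrightarrow> norm (minv (mat 1 + t *\<^sub>R jacobian X (at y))) \<le> 18"
      "\<And>t. \<bar>t\<bar> \<le> t0 \<Longrightarrow> (\<lambda>y. minv (mat 1 + t *\<^sub>R jacobian X (at y))) \<in> borel_measurable (lebesgue_on \<Omega>)"
    and s: "s \<longlonglongrightarrow> 0" "\<And>n. s n \<noteq> 0" "\<And>n. \<bar>s n\<bar> \<le> t0"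
  defines "F \<equiv> \<lambda>t y. pulled_density H (D y) (mat 1 + t *\<^sub>R jacobian X (at y))"
  shows "\<And>n. integrable (lebesgue_on \<Omega>) (F (s n))"
    and "(\<lambda>n. ((LINT y|lebesgue_on \<Omega>. F (s n) y) - (LINT x|lebesgue_on \<Omega>. (norm (D x))\<^sup>2 + H (det (D x)))) / s n)
      \<longlonglongrightarrow> - (LINT y|lebesgue_on \<Omega>. energy_momentum H (D y) \<bullet> jacobian X (at y))"
proof -
  let ?e = "\<lambda>x. (norm (D x))\<^sup>2 + H (det (D x))"
  have \<Omega>s: "\<Omega> \<in> sets lebesgue" using \<Omega> by (simp add: borel_open)
  have Hc: "continuous_on {0<..} H"
    using der by (intro continuous_at_imp_continuous_on) (auto intro: DERIV_isCont)
  obtain L where L: "L \<ge> 0" "\<And>A G t. det A > 0 \<Longrightarrow> norm G \<le> \<beta> \<Longrightarrow> det (mat 1 + t *\<^sub>R G) \<in> {1/2..2} \<Longrightarrow>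
    \<bar>det (mat 1 + t *\<^sub>R G) - 1\<bar> \<le> \<gamma> * \<bar>t\<bar> \<Longrightarrow> norm (minv (mat 1 + t *\<^sub>R G)) \<le> 18 \<Longrightarrow>
    \<bar>pulled_density H A (mat 1 + t *\<^sub>R G) - ((norm A)\<^sup>2 + H (det A))\<bar> \<le> L * (1 + (norm A)\<^sup>2 + H (det A)) * \<bar>t\<bar>"
    using pulled_density_bound[OF nonneg der C, of \<beta> \<gamma>] by blast
  have fin: "finite_measure (lebesgue_on \<Omega>)"
    by (intro finite_measure_lebesgue_on lmeasurable_open \<Omega>)
  have dom: "integrable (lebesgue_on \<Omega>) (\<lambda>x. L * (1 + ?e x))"
    by (intro integrable_mult_right Bochner_Integration.integrable_add[OF finite_measure.integrable_const[OF fin] e])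
  have Fm: "F t \<in> borel_measurable (lebesgue_on \<Omega>)" if t: "\<bar>t\<bar> \<le> t0" for t
    unfolding F_def
  proof (rule measurable_pulled_density[OF \<Omega>s Hc D])
    show "(\<lambda>y. mat 1 + t *\<^sub>R jacobian X (at y)) \<in> borel_measurable (lebesgue_on \<Omega>)"
      by (intro measurable_continuous_lebesgue_on continuous_on_add continuous_on_scaleR continuous_on_const
          continuous_jacobian X \<Omega>s)
    show "det (mat 1 + t *\<^sub>R jacobian X (at y)) > 0" for y
      using t0(3)[OF t, of y] by auto
  qed (rule t0(6)[OF t])
  have bound: "AE y in lebesgue_on \<Omega>. \<bar>F t y - ?e y\<bar> \<le> L * (1 + ?e y) * \<bar>t\<bar>" if t: "\<bar>t\<bar> \<le> t0" for t
    using D(2)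
  proof eventually_elim
    case (elim y)
    show ?case
      using L(2)[OF elim t0(2) t0(3)[OF t] t0(4)[OF t] t0(5)[OF t]] unfolding F_def by (simp add: add.assoc)
  qed
  have diff_int: "integrable (lebesgue_on \<Omega>) (\<lambda>y. F t y - ?e y)" if t: "\<bar>t\<bar> \<le> t0" for t
  proof (rule Bochner_Integration.integrable_bound[OF integrable_mult_left[OF dom, of "\<bar>t\<bar>"]])
    show "(\<lambda>y. F t y - ?e y) \<in> borel_measurable (lebesgue_on \<Omega>)"
      by (intro borel_measurable_diff Fm t borel_measurable_integrable[OF e])
    show "AE y in lebesgue_on \<Omega>. norm (F t y - ?e y) \<le> norm (L * (1 + ?e y) * \<bar>t\<bar>)"
      using bound[OF t] by eventually_elim (auto intro: order_trans[OF _ abs_ge_self])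
  qed
  have F_int: "integrable (lebesgue_on \<Omega>) (F t)" if t: "\<bar>t\<bar> \<le> t0" for t
    using Bochner_Integration.integrable_add[OF diff_int[OF t] e] by simp
  then show "integrable (lebesgue_on \<Omega>) (F (s n))" for n using s(3) by blast
  have "(\<lambda>n. LINT y|lebesgue_on \<Omega>. (F (s n) y - ?e y) / s n) \<longlonglongrightarrow>
      (LINT y|lebesgue_on \<Omega>. - (energy_momentum H (D y) \<bullet> jacobian X (at y)))"
  proof (rule integral_dominated_convergence[OF _ _ dom])
    show "(\<lambda>y. (F (s n) y - ?e y) / s n) \<in> borel_measurable (lebesgue_on \<Omega>)" for n
      by (intro borel_measurable_divide borel_measurable_integrable[OF diff_int] s borel_measurable_const)
    show "AE y in lebesgue_on \<Omega>. norm ((F (s n) y - ?e y) / s n) \<le> L * (1 + ?e y)" for n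
      using bound[OF s(3)[of n]] by eventually_elim (use s(2)[of n] in \<open>simp add: pos_divide_le_eq\<close>)
    show lim: "AE y in lebesgue_on \<Omega>. (\<lambda>n. (F (s n) y - ?e y) / s n) \<longlonglongrightarrow> - (energy_momentum H (D y) \<bullet> jacobian X (at y))"
      using D(2)
    proof eventually_elim
      case (elim y)
      have "((\<lambda>t. F t y) has_real_derivative - (energy_momentum H (D y) \<bullet> jacobian X (at y))) (at 0)"
        unfolding F_def
      proof (rule pulled_density_derivative[OF der[OF elim] t0(1)])
        fix t assume "\<bar>t\<bar> \<le> t0"
        then show "det (mat 1 + t *\<^sub>R jacobian X (at y)) \<noteq> 0 \<and> norm (minv (mat 1 + t *\<^sub>R jacobian X (at y))) \<le> 18"
          using t0(3)[of t y] t0(5)[of t y] by auto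
      qed
      then have lim: "((\<lambda>h. (F h y - ?e y) / h) \<longlongrightarrow> - (energy_momentum H (D y) \<bullet> jacobian X (at y))) (at 0)"
        unfolding DERIV_def by (simp add: F_def pulled_density_one)
      have "filterlim s (at 0) sequentially"
        using s(1,2) by (simp add: filterlim_at)
      from filterlim_compose[OF lim this] show ?case .
    qed
    show "(\<lambda>y. - (energy_momentum H (D y) \<bullet> jacobian X (at y))) \<in> borel_measurable (lebesgue_on \<Omega>)"
    proof -
      \<comment> \<open>The limit is almost everywhere the pointwise limit of the difference
        quotients and inherits measurability from them.\<close>
      define f where "f = (\<lambda>n y. (F (s n) y - ?e y) / s n)"
      have fm: "f n \<in> borel_measurable (lebesgue_on \<Omega>)" for n
        unfolding f_def by (intro borel_measurable_divide borel_measurable_integrable[OF diff_int] s borel_measurable_const)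
      have "(\<lambda>y. lim (\<lambda>n. f n y)) \<in> borel_measurable (lebesgue_on \<Omega>)"
        by (rule borel_measurable_lim_metric[OF fm])
      then show ?thesis
        by (rule measurable_cong_AE_lebesgue_on[OF \<Omega>s])
          (use lim in \<open>auto elim!: eventually_mono simp: f_def limI\<close>)
    qed
  qed
  moreover have "(LINT y|lebesgue_on \<Omega>. (F (s n) y - ?e y) / s n) = ((LINT y|lebesgue_on \<Omega>. F (s n) y) - (LINT x|lebesgue_on \<Omega>. ?e x)) / s n" for n
    using Bochner_Integration.integral_diff[OF F_int[OF s(3)[of n]] e] by simp
  ultimately show "(\<lambda>n. ((LINT y|lebesgue_on \<Omega>. F (s n) y) - (LINT x|lebesgue_on \<Omega>. (norm (D x))\<^sup>2 + H (det (D x)))) / s n)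
      \<longlonglongrightarrow> - (LINT y|lebesgue_on \<Omega>. energy_momentum H (D y) \<bullet> jacobian X (at y))"
    by (simp only: Bochner_Integration.integral_minus)
qed

lemma energy_finite_integrable:
  assumes \<Omega>: "open \<Omega>" "bounded \<Omega>" and u: "u \<in> W12 \<Omega>"
    and det: "AE x in lebesgue_on \<Omega>. det (weak_gradient \<Omega> u x) > 0"
    and H: "continuous_on {0<..} H" "\<And>t. t > 0 \<Longrightarrow> H t \<ge> 0" and fin: "energy \<Omega> H u < \<infinity>"
  shows "integrable (lebesgue_on \<Omega>) (\<lambda>x. (norm (weak_gradient \<Omega> u x))\<^sup>2 + H (det (weak_gradient \<Omega> u x)))"
    and "energy \<Omega> H u = ennreal (LINT x|lebesgue_on \<Omega>. (norm (weak_gradient \<Omega> u x))\<^sup>2 + H (det (weak_gradient \<Omega> u x)))"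
proof -
  let ?D = "weak_gradient \<Omega> u"
  let ?e = "\<lambda>x. (norm (?D x))\<^sup>2 + H (det (?D x))"
  have \<Omega>s: "\<Omega> \<in> sets lebesgue" using \<Omega> by (simp add: borel_open)
  note d = W12D[OF u \<Omega>]
  have m: "?e \<in> borel_measurable (lebesgue_on \<Omega>)"
    by (intro borel_measurable_add borel_measurable_integrable[OF d(6)] measurable_compose_positive[OF \<Omega>s H(1)] measurable_det d(5) det)
  have nn: "AE x in lebesgue_on \<Omega>. 0 \<le> ?e x"
    using det by eventually_elim (simp add: H(2))
  show i: "integrable (lebesgue_on \<Omega>) ?e"
    by (rule integrableI_nonneg[OF m nn]) (use fin in \<open>simp add: energy_def\<close>)
  show "energy \<Omega> H u = ennreal (integral\<^sup>L (lebesgue_on \<Omega>) ?e)"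
    unfolding energy_def by (rule nn_integral_eq_integral[OF i nn])
qed

text \<open>By the bound on t H'(t), the term H'(det D) det D is at most a multiple of 1 + energy
  density, as are the remaining terms.\<close>

lemma energy_momentum_integrable:
  fixes D :: "real^3 \<Rightarrow> real^3^3"
  assumes \<Omega>: "open \<Omega>" "bounded \<Omega>"
    and D: "D \<in> borel_measurable (lebesgue_on \<Omega>)" "AE x in lebesgue_on \<Omega>. det (D x) > 0"
    and e: "integrable (lebesgue_on \<Omega>) (\<lambda>x. (norm (D x))\<^sup>2 + H (det (D x)))"
    and nonneg: "\<And>t. t > 0 \<Longrightarrow> H t \<ge> 0"
    and cont: "continuous_on {0<..} H" "continuous_on {0<..} (deriv H)"
    and C: "C > 0" "\<And>t. t > 0 \<Longrightarrow> \<bar>t * deriv H t\<bar> \<le> C * (1 + H t)"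
  shows "integrable (lebesgue_on \<Omega>) (\<lambda>x. energy_momentum H (D x))"
proof -
  have \<Omega>s: "\<Omega> \<in> sets lebesgue" using \<Omega> by (simp add: borel_open)
  let ?c = "\<lambda>x. deriv H (det (D x)) * det (D x) - (norm (D x))\<^sup>2 - H (det (D x))"
  have fin: "finite_measure (lebesgue_on \<Omega>)"
    by (intro finite_measure_lebesgue_on lmeasurable_open \<Omega>)
  have e1: "integrable (lebesgue_on \<Omega>) (\<lambda>x. 1 + ((norm (D x))\<^sup>2 + H (det (D x))))"
    by (rule Bochner_Integration.integrable_add[OF finite_measure.integrable_const[OF fin] e])
  note mH = measurable_compose_positive[OF \<Omega>s _ measurable_det[OF D(1)] D(2)]
  have mN: "(\<lambda>x. (norm (D x))\<^sup>2) \<in> borel_measurable (lebesgue_on \<Omega>)"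
    using D(1) by measurable
  have mc: "?c \<in> borel_measurable (lebesgue_on \<Omega>)"
    by (intro borel_measurable_diff borel_measurable_times mH cont measurable_det D mN)
  have ci: "integrable (lebesgue_on \<Omega>) ?c"
  proof (rule Bochner_Integration.integrable_bound[OF integrable_mult_right[OF e1, of "C + 1"] mc])
    show "AE x in lebesgue_on \<Omega>. norm (?c x) \<le> norm ((C + 1) * (1 + ((norm (D x))\<^sup>2 + H (det (D x)))))"
      using D(2)
    proof eventually_elim
      case (elim x)
      have "\<bar>deriv H (det (D x)) * det (D x)\<bar> \<le> C * (1 + H (det (D x)))"
        using C(2)[OF elim] by (simp add: mult.commute)
      also have "\<dots> \<le> C * (1 + ((norm (D x))\<^sup>2 + H (det (D x))))"
        using C(1) by (intro mult_left_mono) auto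
      finally have bd: "\<bar>deriv H (det (D x)) * det (D x)\<bar> \<le> C * (1 + ((norm (D x))\<^sup>2 + H (det (D x))))" .
      have "\<bar>?c x\<bar> \<le> (C + 1) * (1 + ((norm (D x))\<^sup>2 + H (det (D x))))"
      proof -
        have "\<bar>p - q - h\<bar> \<le> (C + 1) * (1 + (q + h))" if "\<bar>p\<bar> \<le> C * (1 + (q + h))" "0 \<le> q" "0 \<le> h" for p q h
        proof -
          have "(C + 1) * (1 + (q + h)) = C * (1 + (q + h)) + (1 + (q + h))" by (simp add: distrib_right)
          moreover have "\<bar>p - q - h\<bar> \<le> \<bar>p\<bar> + (1 + (q + h))" using that(2,3) by linarith
          ultimately show ?thesis using that(1) by linarith
        qed
        from this[OF bd zero_le_power2 nonneg[OF elim]] show ?thesis .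
      qed
      then show ?case by (auto intro: order_trans[OF _ abs_ge_self])
    qed
  qed
  have mat: "mat c = c *\<^sub>R (mat 1 :: real^3^3)" for c :: real by (simp add: scaleR_mat)
  have "integrable (lebesgue_on \<Omega>) (\<lambda>x. mat (?c x) :: real^3^3)"
    by (subst mat) (rule integrable_scaleR_left[OF ci])
  moreover
  obtain K where K: "K > 0" "\<And>(A :: real^3^3) (B :: real^3^3). norm (A ** B) \<le> norm A * norm B * K"
    using bounded_bilinear.pos_bounded[OF bounded_bilinear_matrix_mult] by blast
  have tr: "norm (transpose A) = norm A" for A :: "real^3^3"
    by (simp add: norm_vec_def L2_set_def transpose_def sum_3 sum_nonneg algebra_simps)
  have cT: "continuous_on UNIV (\<lambda>A :: real^3^3. transpose A ** A)"
    unfolding transpose_def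
    by (intro bounded_bilinear.continuous_on[OF bounded_bilinear_matrix_mult] continuous_on_vec_lambda
        continuous_on_component continuous_on_id)
  have "integrable (lebesgue_on \<Omega>) (\<lambda>x. transpose (D x) ** D x)"
  proof (rule Bochner_Integration.integrable_bound[OF integrable_mult_right[OF e1, of K]])
    show "(\<lambda>x. transpose (D x) ** D x) \<in> borel_measurable (lebesgue_on \<Omega>)"
      using measurable_compose[OF D(1) borel_measurable_continuous_onI[OF cT]] .
    show "AE x in lebesgue_on \<Omega>. norm (transpose (D x) ** D x) \<le> norm (K * (1 + ((norm (D x))\<^sup>2 + H (det (D x)))))"
      using D(2)
    proof eventually_elim
      case (elim x)
      have "norm (transpose (D x) ** D x) \<le> K * (norm (D x))\<^sup>2"
        using K(2)[of "transpose (D x)" "D x"] by (simp add: tr power2_eq_square algebra_simps)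
      also have "\<dots> \<le> K * (1 + ((norm (D x))\<^sup>2 + H (det (D x))))"
        using K(1) nonneg[OF elim] by (intro mult_left_mono) auto
      finally show ?case by (auto intro: order_trans[OF _ abs_ge_self])
    qed
  qed
  ultimately show ?thesis
    unfolding energy_momentum_def by (intro Bochner_Integration.integrable_add integrable_scaleR_right)
qed

text \<open>Minimality only gives an inequality for the first variation; both signs of \<open>t\<close> are needed.\<close>

lemma inner_variation_zero:
  fixes X :: "real^3 \<Rightarrow> real^3"
  assumes \<Omega>: "open \<Omega>" "bounded \<Omega>" and u: "u \<in> W12 \<Omega>"
    and det: "AE x in lebesgue_on \<Omega>. det (weak_gradient \<Omega> u x) > 0"
    and fin: "energy \<Omega> H u < \<infinity>"
    and nonneg: "\<And>t. t > 0 \<Longrightarrow> H t \<ge> 0"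
    and der: "\<And>t. t > 0 \<Longrightarrow> (H has_real_derivative deriv H t) (at t)"
    and C: "C > 0" "\<And>t. t > 0 \<Longrightarrow> \<bar>t * deriv H t\<bar> \<le> C * (1 + H t)"
    and X: "X \<in> test_functions \<Omega>"
    and minimal: "t1 > 0" "\<And>t. \<bar>t\<bar> \<le> t1 \<Longrightarrow> energy \<Omega> H u \<le> energy \<Omega> H (\<lambda>x. u (inv (\<lambda>x. x + t *\<^sub>R X x) x))"
  shows "(LINT x|lebesgue_on \<Omega>. energy_momentum H (weak_gradient \<Omega> u x) \<bullet> jacobian X (at x)) = 0"
proof -
  let ?D = "weak_gradient \<Omega> u"
  let ?E = "LINT x|lebesgue_on \<Omega>. (norm (?D x))\<^sup>2 + H (det (?D x))"
  let ?L = "LINT x|lebesgue_on \<Omega>. energy_momentum H (?D x) \<bullet> jacobian X (at x)"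
  let ?F = "\<lambda>t y. pulled_density H (?D y) (mat 1 + t *\<^sub>R jacobian X (at y))"
  note d = W12D[OF u \<Omega>]
  have Hc: "continuous_on {0<..} H"
    using der by (intro continuous_at_imp_continuous_on) (auto intro: DERIV_isCont)
  note e = energy_finite_integrable[OF \<Omega> u det Hc nonneg fin]
  have sX: "smooth_on UNIV X" using X by (auto simp: test_functions_def)
  obtain t0 \<beta> \<gamma> K where t0: "t0 > 0" "\<And>y. norm (jacobian X (at y)) \<le> \<beta>" "t0 * \<beta> \<le> 1 / 2"
    "\<And>t. \<bar>t\<bar> \<le> t0 \<Longrightarrow> smooth_diffeo \<Omega> (\<lambda>x. x + t *\<^sub>R X x) (inv (\<lambda>x. x + t *\<^sub>R X x)) 1 18"
    "\<And>t y. \<bar>t\<bar> \<le> t0 \<Longrightarrow> det (mat 1 + t *\<^sub>R jacobian X (at y)) \<in> {1/2..2}"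
    "\<And>t y. \<bar>t\<bar> \<le> t0 \<Longrightarrow> \<bar>det (mat 1 + t *\<^sub>R jacobian X (at y)) - 1\<bar> \<le> \<gamma> * \<bar>t\<bar>"
    "\<And>t y. \<bar>t\<bar> \<le> t0 \<Longrightarrow> norm (minv (mat 1 + t *\<^sub>R jacobian X (at y))) \<le> 18"
    "compact K" "K \<subseteq> \<Omega>" "\<And>t x. \<bar>t\<bar> \<le> t0 \<Longrightarrow> x \<notin> K \<Longrightarrow> inv (\<lambda>x. x + t *\<^sub>R X x) x = x"
    by (rule inner_variation_diffeo[OF X \<Omega>]) (rule that; assumption)
  note j = jacobian_id_add[OF sX]
  have mm: "(\<lambda>y. minv (mat 1 + t *\<^sub>R jacobian X (at y))) \<in> borel_measurable (lebesgue_on \<Omega>)" if "\<bar>t\<bar> \<le> t0" for t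
    using smooth_diffeo.continuous_minv_J[OF t0(4)[OF that]] \<Omega>
    unfolding j by (intro measurable_continuous_lebesgue_on) (simp_all add: borel_open)
  have step: "?E \<le> (LINT y|lebesgue_on \<Omega>. ?F t y)" if t: "\<bar>t\<bar> \<le> t0" "\<bar>t\<bar> \<le> t1" and i: "integrable (lebesgue_on \<Omega>) (?F t)" for t
  proof -
    have nn: "AE y in lebesgue_on \<Omega>. 0 \<le> ?F t y"
      using det
    proof eventually_elim
      case (elim y)
      have "det (mat 1 + t *\<^sub>R jacobian X (at y)) > 0" using t0(5)[OF t(1), of y] by auto
      then show ?case using elim nonneg unfolding pulled_density_def by simp
    qed
    have "energy \<Omega> H (\<lambda>x. u (inv (\<lambda>x. x + t *\<^sub>R X x) x)) = ennreal (LINT y|lebesgue_on \<Omega>. ?F t y)"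
      using smooth_diffeo.energy_push[OF t0(4)[OF t(1)] u refl, of H] i nn unfolding j by blast
    then have "ennreal ?E \<le> ennreal (LINT y|lebesgue_on \<Omega>. ?F t y)"
      using minimal(2)[OF t(2)] e(2) by simp
    moreover have "0 \<le> (LINT y|lebesgue_on \<Omega>. ?F t y)" by (rule integral_nonneg_AE[OF nn])
    ultimately show ?thesis by (simp add: ennreal_le_iff)
  qed
  \<comment> \<open>With \<epsilon> the sign of t, minimality makes \<epsilon> times the difference
    quotient nonnegative.\<close>
  have sign: "0 \<le> - \<epsilon> * ?L" if \<epsilon>: "\<bar>\<epsilon>\<bar> = 1" for \<epsilon>
  proof -
    define \<mu> where "\<mu> = min t0 t1"
    have m: "\<mu> > 0" "\<mu> \<le> t0" "\<mu> \<le> t1" using t0(1) minimal(1) by (simp_all add: \<mu>_def)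
    define s where "s = (\<lambda>n. \<epsilon> * (\<mu> / real (Suc n)))"
    have "\<bar>s n\<bar> \<le> \<mu>" for n
    proof -
      have "\<bar>s n\<bar> = \<mu> / real (Suc n)" using m(1) \<epsilon> by (simp add: s_def abs_mult)
      also have "\<dots> \<le> \<mu> / 1" using m(1) by (intro divide_left_mono) auto
      finally show ?thesis by simp
    qed
    then have sb: "\<bar>s n\<bar> \<le> t0" "\<bar>s n\<bar> \<le> t1" for n using m order_trans by blast+
    have s0: "s n \<noteq> 0" for n using m(1) \<epsilon> by (auto simp: s_def)
    have "(\<lambda>n. \<epsilon> * (\<mu> * inverse (real (Suc n)))) \<longlonglongrightarrow> \<epsilon> * (\<mu> * 0)"
      by (intro tendsto_intros LIMSEQ_inverse_real_of_nat)
    then have sl: "s \<longlonglongrightarrow> 0" by (simp add: s_def divide_inverse)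
    note lim = inner_variation_tendsto[OF \<Omega> d(5) det e(1) nonneg der C sX t0(1,2,5,6,7) mm sl s0 sb(1)]
    have "(\<lambda>n. \<epsilon> * (((LINT y|lebesgue_on \<Omega>. ?F (s n) y) - ?E) / s n)) \<longlonglongrightarrow> \<epsilon> * - ?L"
      by (intro tendsto_mult tendsto_const lim(2))
    moreover have "0 \<le> \<epsilon> * (((LINT y|lebesgue_on \<Omega>. ?F (s n) y) - ?E) / s n)" for n
    proof -
      have "\<epsilon> / s n > 0" using m(1) \<epsilon> by (auto simp: s_def)
      moreover have "0 \<le> (LINT y|lebesgue_on \<Omega>. ?F (s n) y) - ?E"
        using step[OF sb lim(1)] by simp
      ultimately have "0 \<le> (\<epsilon> / s n) * ((LINT y|lebesgue_on \<Omega>. ?F (s n) y) - ?E)"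
        by (rule mult_nonneg_nonneg[OF less_imp_le])
      then show ?thesis by (simp only: times_divide_eq_left times_divide_eq_right)
    qed
    ultimately have "0 \<le> \<epsilon> * - ?L"
      by (rule LIMSEQ_le_const[OF _ exI, rule_format])
    then show ?thesis by simp
  qed
  from sign[of 1] sign[of "-1"] show ?thesis by simp
qed

section \<open>Orthogonal symmetries\<close>

declare transpose_matrix_vector [simp del]

definition rotm :: "real \<Rightarrow> real^3^3" where
  "rotm \<theta> = vector [vector [cos \<theta>, - sin \<theta>, 0], vector [sin \<theta>, cos \<theta>, 0], vector [0, 0, 1]]"

text \<open>Reflection in the plane x_2 = 0, which contains the axis; the reflections in the other
  planes through the axis are its conjugates by rotations.\<close>

definition reflm :: "real^3^3" where
  "reflm = vector [vector [1, 0, 0], vector [0, - 1, 0], vector [0, 0, 1]]"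

lemma rotm_components:
  "rotm \<theta> $ 1 $ 1 = cos \<theta>" "rotm \<theta> $ 1 $ 2 = - sin \<theta>" "rotm \<theta> $ 1 $ 3 = 0"
  "rotm \<theta> $ 2 $ 1 = sin \<theta>" "rotm \<theta> $ 2 $ 2 = cos \<theta>" "rotm \<theta> $ 2 $ 3 = 0"
  "rotm \<theta> $ 3 $ 1 = 0" "rotm \<theta> $ 3 $ 2 = 0" "rotm \<theta> $ 3 $ 3 = 1"
  by (simp_all add: rotm_def vector_3)

lemma reflm_components:
  "reflm $ 1 $ 1 = 1" "reflm $ 1 $ 2 = 0" "reflm $ 1 $ 3 = 0"
  "reflm $ 2 $ 1 = 0" "reflm $ 2 $ 2 = - 1" "reflm $ 2 $ 3 = 0"
  "reflm $ 3 $ 1 = 0" "reflm $ 3 $ 2 = 0" "reflm $ 3 $ 3 = 1"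
  by (simp_all add: reflm_def vector_3)

lemma rot_z_eq: "rot_z \<theta> x = rotm \<theta> *v x"
  by (simp add: rot_z_def vec_eq_iff forall_3 vector_3 matrix_vector_mult_def sum_3 rotm_components)

lemma transpose_rotm: "transpose (rotm \<theta>) = rotm (- \<theta>)"
  by (simp add: transpose_def vec_eq_iff forall_3 rotm_components)

lemma transpose_reflm: "transpose reflm = reflm"
  by (simp add: transpose_def vec_eq_iff forall_3 reflm_components)

lemma rotm_mult: "rotm a ** rotm b = rotm (a + b)"
  by (simp add: matrix_matrix_mult_def vec_eq_iff forall_3 sum_3 rotm_components cos_add sin_add algebra_simps)

lemma rotm_0: "rotm 0 = mat 1"
  by (simp add: mat_def vec_eq_iff forall_3 rotm_components)

lemma reflm_mult: "reflm ** reflm = mat 1"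
  by (simp add: matrix_matrix_mult_def mat_def vec_eq_iff forall_3 sum_3 reflm_components)

lemma reflm_rotm: "reflm ** rotm \<theta> = rotm (- \<theta>) ** reflm"
  by (simp add: matrix_matrix_mult_def vec_eq_iff forall_3 sum_3 reflm_components rotm_components)

lemma orthogonal_rotm: "transpose (rotm \<theta>) ** rotm \<theta> = mat 1" "rotm \<theta> ** transpose (rotm \<theta>) = mat 1"
  by (simp_all add: transpose_rotm rotm_mult rotm_0)

lemma orthogonal_reflm: "transpose reflm ** reflm = mat 1" "reflm ** transpose reflm = mat 1"
  by (simp_all add: transpose_reflm reflm_mult)

lemma inner_mult_left:
  fixes A B R :: "real^3^3"
  shows "(R ** A) \<bullet> B = A \<bullet> (transpose R ** B)"
  by (simp add: inner_vec_def matrix_matrix_mult_def transpose_def sum_3 algebra_simps)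

lemma inner_mult_right:
  fixes A B R :: "real^3^3"
  shows "(A ** R) \<bullet> B = A \<bullet> (B ** transpose R)"
  by (simp add: inner_vec_def matrix_matrix_mult_def transpose_def sum_3 algebra_simps)

lemma inner_conjugate:
  fixes A B R Q :: "real^3^3"
  shows "(R ** A ** Q) \<bullet> B = A \<bullet> (transpose R ** B ** transpose Q)"
  by (subst inner_mult_right, subst inner_mult_left) (simp only: matrix_mul_assoc)

lemma inner_transpose: "transpose A \<bullet> transpose B = A \<bullet> (B :: real^3^3)"
  by (simp add: inner_vec_def transpose_def sum_3 algebra_simps)

lemma norm_conjugate:
  fixes A R :: "real^3^3"
  assumes "transpose R ** R = mat 1"
  shows "norm (R ** A ** transpose R) = norm A"
proof -
  have "(R ** A ** transpose R) \<bullet> (R ** A ** transpose R) = A \<bullet> (transpose R ** R ** A ** (transpose R ** R))"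
    by (simp only: inner_conjugate matrix_mul_assoc transpose_transpose)
  then show ?thesis by (simp add: assms norm_eq_sqrt_inner)
qed

text \<open>Isotropy and frame indifference of the density: conjugation by an orthogonal matrix
  keeps the determinant and the norm, and the Gram matrix \<open>transpose A ** A\<close> is
  conjugated along with A.\<close>

lemma energy_momentum_conjugate:
  assumes R: "transpose R ** R = mat 1" "R ** transpose R = (mat 1 :: real^3^3)"
  shows "energy_momentum H (R ** A ** transpose R) = R ** energy_momentum H A ** transpose R"
proof -
  have dR: "det R * det R = 1"
    using arg_cong[OF R(2), of det] by (simp add: det_mul det_transpose)
  have det: "det (R ** A ** transpose R) = det A"
    using dR by (simp add: det_mul det_transpose algebra_simps)
  have gram: "transpose (R ** A ** transpose R) ** (R ** A ** transpose R) = R ** (transpose A ** A) ** transpose R"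
  proof -
    have "transpose (R ** A ** transpose R) ** (R ** A ** transpose R) =
        R ** transpose A ** (transpose R ** R) ** A ** transpose R"
      by (simp add: matrix_transpose_mul matrix_mul_assoc)
    then show ?thesis by (simp add: R matrix_mul_assoc)
  qed
  note norm = norm_conjugate[OF R(1)]
  have mat: "R ** mat c ** transpose R = mat c" for c
  proof -
    have "mat c = c *\<^sub>R (mat 1 :: real^3^3)" by (simp add: scaleR_mat)
    then show ?thesis by (simp add: scaleR_matrix_mult R)
  qed
  show ?thesis
    unfolding energy_momentum_def det gram norm
    by (simp add: bounded_bilinear.add_left[OF bounded_bilinear_matrix_mult] bounded_bilinear.add_right[OF bounded_bilinear_matrix_mult]
        scaleR_matrix_mult mat)
qed

text \<open>The constant \<open>1 + norm R\<close> bounds both the determinant, of modulus 1, and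
  the inverse \<open>transpose R\<close>, of norm \<open>norm R\<close>. The orientation
  \<open>det R\<close> may be -1, which admits the reflection.\<close>

lemma orthogonal_diffeo:
  assumes R: "transpose R ** R = mat 1" "R ** transpose R = (mat 1 :: real^3^3)"
    and \<Omega>: "open \<Omega>" "bounded \<Omega>" "(\<lambda>x. R *v x) ` \<Omega> = \<Omega>"
  shows "smooth_diffeo \<Omega> (\<lambda>x. R *v x) (\<lambda>x. transpose R *v x) (det R) (1 + norm R)"
    and "jacobian (\<lambda>x. R *v x) (at x) = R" and "minv R = transpose R" and "\<bar>det R\<bar> = 1"
proof -
  have dR: "det R * det R = 1"
    using arg_cong[OF R(2), of det] by (simp add: det_mul det_transpose)
  then have "(det R - 1) * (det R + 1) = 0" by (simp add: algebra_simps)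
  then have d: "det R = 1 \<or> det R = - 1" by (simp add: add_eq_0_iff)
  then show d1: "\<bar>det R\<bar> = 1" by auto
  have "((\<lambda>x. R *v x) has_derivative (\<lambda>h. R *v h)) (at x)" for x
    by (simp add: bounded_linear_imp_has_derivative matrix_vector_mul_bounded_linear)
  then show j: "jacobian (\<lambda>x. R *v x) (at x) = R" for x by (rule jacobianI)
  show m: "minv R = transpose R" by (rule minv_unique[OF R(1)])
  have "norm (transpose R) = norm R"
    by (simp add: norm_eq_sqrt_inner inner_transpose)
  then show "smooth_diffeo \<Omega> (\<lambda>x. R *v x) (\<lambda>x. transpose R *v x) (det R) (1 + norm R)"
    using \<Omega> R d d1 dR
    by unfold_locales
      (auto simp: j m matrix_vector_mul_assoc smooth_linear matrix_vector_mul_bounded_linear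
        linear_continuous_on)
qed

section \<open>Equivariance of weak gradients and of the pairing with the stress\<close>

lemma has_weak_gradient_cong:
  assumes u: "has_weak_gradient \<Omega> u D" and eq: "AE x in lebesgue_on \<Omega>. u x = v x" and \<Omega>: "open \<Omega>"
  shows "has_weak_gradient \<Omega> v D"
proof -
  have \<Omega>s: "\<Omega> \<in> sets lebesgue" using \<Omega> by (simp add: borel_open)
  have "locally_integrable \<Omega> v"
    unfolding locally_integrable_def
  proof (intro allI impI)
    fix K assume K: "compact K \<and> K \<subseteq> \<Omega>"
    then have Ks: "K \<in> sets lebesgue" by (simp add: compact_imp_closed borel_closed)
    have "AE x in lebesgue_on K. u x = v x"
      using eq K unfolding AE_lebesgue_on_iff[OF \<Omega>s] AE_lebesgue_on_iff[OF Ks] by (auto elim!: eventually_mono)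
    moreover have "integrable (lebesgue_on K) u"
      using u K by (auto simp: has_weak_gradient_def locally_integrable_def)
    ultimately show "integrable (lebesgue_on K) v"
      using integral_cong_AE_lebesgue_on(1)[OF Ks] by blast
  qed
  moreover have "(LINT x|lebesgue_on \<Omega>. v x $ i * partial_deriv j \<phi> x) = (LINT x|lebesgue_on \<Omega>. u x $ i * partial_deriv j \<phi> x)" for i j \<phi>
    by (rule integral_cong_AE_lebesgue_on(2)[OF \<Omega>s]) (use eq in \<open>auto elim!: eventually_mono\<close>)
  ultimately show ?thesis using u by (simp add: has_weak_gradient_def)
qed

lemma has_weak_gradient_matrix:
  assumes u: "has_weak_gradient \<Omega> u D" and \<Omega>: "open \<Omega>"
    and i: "integrable (lebesgue_on \<Omega>) u" "integrable (lebesgue_on \<Omega>) D"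
  shows "has_weak_gradient \<Omega> (\<lambda>x. R *v u x) (\<lambda>x. R ** D x)"
proof -
  have \<Omega>s: "\<Omega> \<in> sets lebesgue" using \<Omega> by (simp add: borel_open)
  have "bounded_linear (\<lambda>x :: real^3. R *v x)" by (rule matrix_vector_mul_bounded_linear)
  from integrable_bounded_linear[OF this i(1)] have 1: "integrable (lebesgue_on \<Omega>) (\<lambda>x. R *v u x)" .
  have "bounded_linear (\<lambda>A :: real^3^3. R ** A)"
    by (rule bounded_bilinear.bounded_linear_right[OF bounded_bilinear_matrix_mult])
  from integrable_bounded_linear[OF this i(2)] have 2: "integrable (lebesgue_on \<Omega>) (\<lambda>x. R ** D x)" .
  have "(LINT x|lebesgue_on \<Omega>. (R *v u x) $ a * partial_deriv b \<phi> x) = - (LINT x|lebesgue_on \<Omega>. (R ** D x) $ a $ b * \<phi> x)"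
    if \<phi>: "\<phi> \<in> test_functions \<Omega>" for \<phi> a b
  proof -
    obtain Q where Q: "smooth_on UNIV \<phi>" "compact Q" "Q \<subseteq> \<Omega>" "\<And>x. x \<notin> Q \<Longrightarrow> \<phi> x = 0"
      using test_functionsE[OF \<phi>] by metis
    have iu: "integrable (lebesgue_on \<Omega>) (\<lambda>x. u x $ k * partial_deriv b \<phi> x)" for k
      by (rule integrable_mult_compact_support[OF integrable_component[OF i(1)] \<Omega>s
          smooth_continuous[OF smooth_partial_deriv[OF Q(1)]] Q(2) partial_deriv_zero_outside_support[OF Q(1,2,4)]])
    have iD: "integrable (lebesgue_on \<Omega>) (\<lambda>x. D x $ k $ b * \<phi> x)" for k
      by (rule integrable_mult_compact_support[OF integrable_entry[OF i(2)] \<Omega>s smooth_continuous[OF Q(1)] Q(2,4)])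
    have "(LINT x|lebesgue_on \<Omega>. (R *v u x) $ a * partial_deriv b \<phi> x) =
        (LINT x|lebesgue_on \<Omega>. (\<Sum>k\<in>UNIV. R $ a $ k * (u x $ k * partial_deriv b \<phi> x)))"
      by (simp add: matrix_vector_mult_def sum_distrib_right mult.assoc)
    also have "\<dots> = (\<Sum>k\<in>UNIV. R $ a $ k * (LINT x|lebesgue_on \<Omega>. u x $ k * partial_deriv b \<phi> x))"
      by (subst Bochner_Integration.integral_sum) (auto intro: integrable_mult_right iu)
    also have "\<dots> = - (\<Sum>k\<in>UNIV. R $ a $ k * (LINT x|lebesgue_on \<Omega>. D x $ k $ b * \<phi> x))"
      using u \<phi> by (simp add: has_weak_gradient_def sum_negf)
    also have "(\<Sum>k\<in>UNIV. R $ a $ k * (LINT x|lebesgue_on \<Omega>. D x $ k $ b * \<phi> x)) =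
        (LINT x|lebesgue_on \<Omega>. (\<Sum>k\<in>UNIV. R $ a $ k * (D x $ k $ b * \<phi> x)))"
      by (subst Bochner_Integration.integral_sum) (auto intro: integrable_mult_right iD)
    also have "\<dots> = (LINT x|lebesgue_on \<Omega>. (R ** D x) $ a $ b * \<phi> x)"
      by (simp add: matrix_matrix_mult_def sum_distrib_right mult.assoc)
    finally show ?thesis .
  qed
  then show ?thesis
    using 1 2 \<Omega> by (auto simp: has_weak_gradient_def intro: locally_integrable_if_integrable)
qed

text \<open>The two sides of u(Rx) = R u(x) have the explicit weak gradients Du(Rx) R and R Du(x);
  uniqueness identifies them almost everywhere.\<close>

lemma weak_gradient_equivariant:
  assumes R: "transpose R ** R = mat 1" "R ** transpose R = (mat 1 :: real^3^3)"
    and \<Omega>: "open \<Omega>" "bounded \<Omega>" "(\<lambda>x. R *v x) ` \<Omega> = \<Omega>" and u: "u \<in> W12 \<Omega>"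
    and eq: "AE x in lebesgue_on \<Omega>. u (R *v x) = R *v u x"
  shows "AE x in lebesgue_on \<Omega>. weak_gradient \<Omega> u (R *v x) = R ** weak_gradient \<Omega> u x ** transpose R"
proof -
  let ?D = "weak_gradient \<Omega> u"
  have R': "transpose (transpose R) ** transpose R = mat 1" "transpose R ** transpose (transpose R) = mat 1"
    using R by simp_all
  have "(\<lambda>x. transpose R *v x) ` \<Omega> = (\<lambda>x. transpose R *v x) ` (\<lambda>x. R *v x) ` \<Omega>" using \<Omega>(3) by simp
  also have "\<dots> = \<Omega>" by (simp add: image_image matrix_vector_mul_assoc R)
  finally have \<Omega>R: "(\<lambda>x. transpose R *v x) ` \<Omega> = \<Omega>" .
  note o = orthogonal_diffeo[OF R' \<Omega>(1,2) \<Omega>R]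
  \<comment> \<open>The inverse of R is taken for \<psi>, so that composition with \<eta> produces
    u(Rx).\<close>
  interpret smooth_diffeo \<Omega> "\<lambda>x. transpose R *v x" "\<lambda>x. transpose (transpose R) *v x" "det (transpose R)" "1 + norm (transpose R)"
    by (rule o(1))
  note d = W12D[OF u \<Omega>(1,2)]
  have "has_weak_gradient \<Omega> (\<lambda>x. u (R *v x)) (push_gradient ?D)"
    using has_weak_gradient_push[OF d(4,3,7)] by simp
  from has_weak_gradient_cong[OF this eq \<Omega>(1)]
  have "AE x in lebesgue_on \<Omega>. push_gradient ?D x = R ** ?D x"
    using has_weak_gradient_unique[OF \<Omega>(1) _ has_weak_gradient_matrix[OF d(4) \<Omega>(1) d(3,7)]] by blast
  then show ?thesis
  proof eventually_elim
    case (elim x)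
    have "push_gradient ?D x = ?D (R *v x) ** R"
      unfolding push_gradient_def o(2,3) by simp
    with elim have "?D (R *v x) ** R ** transpose R = R ** ?D x ** transpose R" by simp
    then show ?case by (simp add: matrix_mul_assoc[symmetric] R)
  qed
qed

lemma jacobian_conjugate:
  fixes X :: "real^3 \<Rightarrow> real^3"
  assumes X: "smooth_on UNIV X"
  shows "jacobian (\<lambda>x. R *v X (Q *v x)) (at x) = R ** jacobian X (at (Q *v x)) ** Q"
proof (rule jacobianI)
  have Q: "((\<lambda>x. Q *v x) has_derivative (\<lambda>h. Q *v h)) (at x)"
    by (simp add: bounded_linear_imp_has_derivative matrix_vector_mul_bounded_linear)
  have "((\<lambda>x. R *v X (Q *v x)) has_derivative (\<lambda>h. R *v (jacobian X (at (Q *v x)) *v (Q *v h)))) (at x)"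
    by (rule bounded_linear.has_derivative[OF matrix_vector_mul_bounded_linear
        has_derivative_compose[OF Q smooth_jacobian(1)[OF X]]])
  then show "((\<lambda>x. R *v X (Q *v x)) has_derivative (\<lambda>h. (R ** jacobian X (at (Q *v x)) ** Q) *v h)) (at x)"
    by (simp add: matrix_vector_mul_assoc matrix_mul_assoc)
qed

text \<open>The substitution x -> Rx has |det R| = 1 and turns both T and the Jacobian of the field
  into conjugates by R; conjugation preserves the inner product of matrices.\<close>

lemma stress_functional_conjugate:
  fixes X :: "real^3 \<Rightarrow> real^3" and T :: "real^3 \<Rightarrow> real^3^3"
  assumes R: "transpose R ** R = mat 1" "R ** transpose R = (mat 1 :: real^3^3)"
    and \<Omega>: "open \<Omega>" "bounded \<Omega>" "(\<lambda>x. R *v x) ` \<Omega> = \<Omega>" and X: "smooth_on UNIV X"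
    and T: "AE x in lebesgue_on \<Omega>. T (R *v x) = R ** T x ** transpose R"
  shows "(LINT x|lebesgue_on \<Omega>. T x \<bullet> jacobian (\<lambda>x. R *v X (transpose R *v x)) (at x)) =
    (LINT x|lebesgue_on \<Omega>. T x \<bullet> jacobian X (at x))"
proof -
  note o = orthogonal_diffeo[OF R \<Omega>]
  interpret smooth_diffeo \<Omega> "\<lambda>x. R *v x" "\<lambda>x. transpose R *v x" "det R" "1 + norm R"
    by (rule o(1))
  have "(LINT x|lebesgue_on \<Omega>. T x \<bullet> jacobian (\<lambda>x. R *v X (transpose R *v x)) (at x)) =
      (LINT x|lebesgue_on \<Omega>. T (R *v x) \<bullet> (R ** jacobian X (at x) ** transpose R))"
    by (subst cov(2)) (simp add: jacobian_conjugate[OF X] o(2,4) matrix_vector_mul_assoc R)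
  also have "\<dots> = (LINT x|lebesgue_on \<Omega>. T x \<bullet> jacobian X (at x))"
  proof (rule integral_cong_AE_lebesgue_on(2)[OF dom_sets], use T in eventually_elim)
    case (elim x)
    have "(R ** T x ** transpose R) \<bullet> (R ** jacobian X (at x) ** transpose R) =
        T x \<bullet> ((transpose R ** R) ** jacobian X (at x) ** (transpose R ** R))"
      by (simp only: inner_conjugate matrix_mul_assoc transpose_transpose)
    then show ?case by (simp add: elim R)
  qed
  finally show ?thesis .
qed

section \<open>Averaging over rotations\<close>

text \<open>The span of cos and sin is closed under differentiation, so the induction runs over all
  linear combinations.\<close>

lemma smooth_cos_sin: "smooth_on UNIV (cos :: real \<Rightarrow> real)" "smooth_on UNIV (sin :: real \<Rightarrow> real)"
proof -
  have "Ck_on k UNIV (\<lambda>x. a * cos x + b * sin x)" for k and a b :: real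
  proof (induction k arbitrary: a b)
    case 0
    show ?case by (auto intro!: continuous_intros)
  next
    case (Suc k)
    show ?case
    proof (rule Ck_on_SucI)
      show "((\<lambda>x. a * cos x + b * sin x) has_derivative (\<lambda>v. (b * v) * cos x + (- a * v) * sin x)) (at x)" for x
        by (auto intro!: derivative_eq_intros simp: algebra_simps)
    qed (rule Suc)
  qed
  from this[of _ 1 0] this[of _ 0 1] show "smooth_on UNIV (cos :: real \<Rightarrow> real)" "smooth_on UNIV (sin :: real \<Rightarrow> real)"
    by (simp_all add: smooth_on_def)
qed

lemma smooth_rotm:
  assumes "smooth_on UNIV f"
  shows "smooth_on UNIV (\<lambda>p. rotm (f p) $ i $ j)"
proof -
  have "\<forall>i j. smooth_on UNIV (\<lambda>p. rotm (f p) $ i $ j)"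
    using smooth_compose[OF smooth_cos_sin(1) assms] smooth_compose[OF smooth_cos_sin(2) assms]
      smooth_diff[OF smooth_const smooth_compose[OF smooth_cos_sin(2) assms], of 0]
    by (simp add: forall_3 rotm_components smooth_const)
  then show ?thesis by blast
qed

lemma smooth_matrix_vector_mult:
  fixes A :: "'a::real_normed_vector \<Rightarrow> real^3^3"
  assumes "\<And>i j. smooth_on UNIV (\<lambda>p. A p $ i $ j)" "smooth_on UNIV f"
  shows "smooth_on UNIV (\<lambda>p. A p *v f p)"
  unfolding matrix_vector_mult_def
  by (intro smooth_vec_lambda smooth_sum smooth_mult assms smooth_bounded_linear[OF bounded_linear_vec_nth])

lemma continuous_rotm:
  fixes f :: "'a::t2_space \<Rightarrow> real"
  assumes f: "continuous_on S f"
  shows "continuous_on S (\<lambda>p. rotm (f p))"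
proof -
  have "\<forall>i j. continuous_on S (\<lambda>p. rotm (f p) $ i $ j)"
    unfolding forall_3 rotm_components
    by (intro conjI continuous_on_cos continuous_on_sin continuous_on_minus continuous_on_const f)
  then have "continuous_on S (\<lambda>p. \<chi> i j. rotm (f p) $ i $ j)"
    by (intro continuous_on_vec_lambda) blast
  then show ?thesis by simp
qed

text \<open>The integral over [0, p + a] is cut once at a and once at p; by periodicity the pieces
  over [0, a] and [p, p + a] agree.\<close>

lemma integral_periodic_shift:
  fixes f :: "real \<Rightarrow> 'b::banach"
  assumes f: "continuous_on UNIV f" and per: "\<And>\<theta>. f (\<theta> + p) = f \<theta>" and "p \<ge> 0" "a \<ge> 0"
  shows "integral {0..p} (\<lambda>\<theta>. f (\<theta> + a)) = integral {0..p} f"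
proof -
  have i: "f integrable_on {c..d}" for c d
    by (intro integrable_continuous_interval continuous_on_subset[OF f]) auto
  have shift: "integral {c..d} (\<lambda>\<theta>. f (\<theta> + b)) = integral {c + b..d + b} f" for b c d
  proof -
    have "(f has_integral integral {c + b..d + b} f) (cbox (c + b) (d + b))"
      using i[of "c + b" "d + b"] by (simp add: integrable_integral)
    from has_integral_affinity'[OF this, of 1 b] show ?thesis by (simp add: integral_unique)
  qed
  have "integral {0..a} f + integral {a..p + a} f = integral {0..p} f + integral {p..p + a} f"
    using Henstock_Kurzweil_Integration.integral_combine[OF _ _ i, of 0 a "p + a"]
      Henstock_Kurzweil_Integration.integral_combine[OF _ _ i, of 0 p "p + a"] assms(3,4) by simp
  moreover have "integral {p..p + a} f = integral {0..a} f"
    using shift[of 0 a p] per by (simp add: add.commute)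
  ultimately show ?thesis using shift[of 0 p a] by simp
qed

text \<open>The push-forward of the vector field X under the rotation by \<theta>; a field commutes
  with that rotation exactly when this leaves it fixed.\<close>

definition rotated :: "(real^3 \<Rightarrow> real^3) \<Rightarrow> real \<Rightarrow> real^3 \<Rightarrow> real^3" where
  "rotated X \<theta> x = rotm \<theta> *v X (rotm (- \<theta>) *v x)"

definition rotation_average :: "(real^3 \<Rightarrow> real^3) \<Rightarrow> real^3 \<Rightarrow> real^3" where
  "rotation_average X x = (1 / (2 * pi)) *\<^sub>R integral {0..2 * pi} (\<lambda>\<theta>. rotated X \<theta> x)"

lemma smooth_rotated:
  assumes X: "smooth_on UNIV X"
  shows "smooth_on UNIV (\<lambda>p. rotated X (snd p) (fst p))"
  unfolding rotated_def
  by (intro smooth_matrix_vector_mult smooth_rotm smooth_linear bounded_linear_snd bounded_linear_fst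
      smooth_compose[OF X] smooth_bounded_linear[OF bounded_linear_minus[OF bounded_linear_ident]])

lemma smooth_rotation_average:
  assumes X: "smooth_on UNIV X"
  shows "smooth_on UNIV (rotation_average X)"
proof -
  have "smooth_on UNIV (\<lambda>x. integral (cbox 0 (2 * pi)) (\<lambda>\<theta>. (1::real) *\<^sub>R (\<lambda>p. rotated X (snd p) (fst p)) (x, \<theta>)))"
    by (rule smooth_parametric_integral[OF _ smooth_rotated[OF X]]) auto
  then have "smooth_on UNIV (\<lambda>x. (1 / (2 * pi)) *\<^sub>R integral {0..2 * pi} (\<lambda>\<theta>. rotated X \<theta> x))"
    by (intro smooth_scaleR smooth_const) simp
  then show ?thesis by (simp add: rotation_average_def[abs_def])
qed

lemma jacobian_rotated:
  assumes X: "smooth_on UNIV X"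
  shows "jacobian (rotated X \<theta>) (at x) = rotm \<theta> ** jacobian X (at (rotm (- \<theta>) *v x)) ** rotm (- \<theta>)"
  unfolding rotated_def[abs_def] by (rule jacobian_conjugate[OF X])

lemma smooth_rotated_fixed: "smooth_on UNIV X \<Longrightarrow> smooth_on UNIV (rotated X \<theta>)"
  unfolding rotated_def[abs_def]
  by (rule smooth_matrix_vector_mult[OF smooth_const smooth_compose[OF _ smooth_linear[OF matrix_vector_mul_bounded_linear]]])

lemma continuous_jacobian_rotated:
  assumes X: "smooth_on UNIV X"
  shows "continuous_on UNIV (\<lambda>p. jacobian (rotated X (snd p)) (at (fst p)))"
proof -
  have "continuous_on UNIV (\<lambda>p. rotm (- snd p) *v fst p :: real^3)"
    by (intro smooth_continuous smooth_matrix_vector_mult smooth_rotm smooth_linear bounded_linear_snd bounded_linear_fst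
      smooth_bounded_linear[OF bounded_linear_minus[OF bounded_linear_ident]])
  then show ?thesis
    unfolding jacobian_rotated[OF X]
    by (intro bounded_bilinear.continuous_on[OF bounded_bilinear_matrix_mult] continuous_rotm
        continuous_on_compose2[OF continuous_jacobian[OF X]] continuous_on_minus continuous_on_snd continuous_on_id) auto
qed

lemma jacobian_rotation_average:
  assumes X: "smooth_on UNIV X"
  shows "jacobian (rotation_average X) (at x) = (1 / (2 * pi)) *\<^sub>R integral {0..2 * pi} (\<lambda>\<theta>. jacobian (rotated X \<theta>) (at x))"
proof (rule jacobianI)
  let ?G = "\<lambda>x \<theta>. jacobian (rotated X \<theta>) (at x)"
  have cG: "continuous_on S (\<lambda>p. ?G (fst p) (snd p))" for S
    using continuous_jacobian_rotated[OF X] continuous_on_subset by blast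
  have cF: "continuous_on S (\<lambda>\<theta>. rotated X \<theta> x)" for S x
  proof -
    have "continuous_on S (\<lambda>\<theta>. (\<lambda>p. rotated X (snd p) (fst p)) (x, \<theta>))"
      by (rule continuous_on_compose2[OF smooth_continuous[OF smooth_rotated[OF X]]]) (auto intro!: continuous_intros)
    then show ?thesis by simp
  qed
  have "((\<lambda>x. integral (cbox 0 (2 * pi)) (\<lambda>\<theta>. (1::real) *\<^sub>R rotated X \<theta> x)) has_derivative
      (\<lambda>v. integral (cbox 0 (2 * pi)) (\<lambda>\<theta>. (1::real) *\<^sub>R (?G x \<theta> *v v)))) (at x)"
  proof (rule parametric_integral_derivative)
    show "((\<lambda>x. rotated X \<theta> x) has_derivative (\<lambda>h. ?G x \<theta> *v h)) (at x)" for x \<theta>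
      by (rule smooth_jacobian(1)[OF smooth_rotated_fixed[OF X]])
    show "continuous_on (UNIV \<times> cbox 0 (2 * pi)) (\<lambda>(x, \<theta>). ?G x \<theta> *v v)" for v
      unfolding split_beta by (intro continuous_on_matrix_vector_mult cG)
  qed (auto intro: cF)
  then have d: "((\<lambda>x. integral {0..2 * pi} (\<lambda>\<theta>. rotated X \<theta> x)) has_derivative
      (\<lambda>v. integral {0..2 * pi} (\<lambda>\<theta>. ?G x \<theta> *v v))) (at x)" by simp
  have iG: "?G x integrable_on {0..2 * pi}"
  proof (rule integrable_continuous_interval)
    have "continuous_on {0..2 * pi} (\<lambda>\<theta>. (\<lambda>p. ?G (fst p) (snd p)) (x, \<theta>))"
      by (rule continuous_on_compose2[OF cG[of UNIV]]) (auto intro!: continuous_intros)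
    then show "continuous_on {0..2 * pi} (?G x)" by simp
  qed
  have "integral {0..2 * pi} (\<lambda>\<theta>. ?G x \<theta> *v v) = integral {0..2 * pi} (?G x) *v v" for v
  proof -
    have "linear (\<lambda>A :: real^3^3. A *v v)"
      by (rule linearI) (simp_all add: matrix_vector_mult_add_rdistrib scaleR_matrix_vector_assoc)
    then have "bounded_linear (\<lambda>A :: real^3^3. A *v v)" by (simp add: linear_conv_bounded_linear)
    from integral_linear[OF iG this] show ?thesis by (simp add: o_def)
  qed
  with d have "((\<lambda>x. (1 / (2 * pi)) *\<^sub>R integral {0..2 * pi} (\<lambda>\<theta>. rotated X \<theta> x)) has_derivative
      (\<lambda>v. (1 / (2 * pi)) *\<^sub>R (integral {0..2 * pi} (?G x) *v v))) (at x)"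
    by (intro has_derivative_scaleR_right) simp
  then show "(rotation_average X has_derivative (\<lambda>v. ((1 / (2 * pi)) *\<^sub>R integral {0..2 * pi} (?G x)) *v v)) (at x)"
    by (simp add: rotation_average_def[abs_def] scaleR_matrix_vector_assoc)
qed

text \<open>Fubini over \<Omega> x [0, 2 pi] with majorant \<beta> |T|: conjugation by rotations
  keeps the norm of DX, so one \<beta> serves for every angle. The null set in the equivariance of T
  may depend on the angle; this is harmless because, for each angle, the equivariance is used under
  the integral in x.\<close>

lemma stress_functional_average:
  fixes X :: "real^3 \<Rightarrow> real^3" and T :: "real^3 \<Rightarrow> real^3^3"
  assumes \<Omega>: "open \<Omega>" "bounded \<Omega>" "\<And>\<theta>. (\<lambda>x. rotm \<theta> *v x) ` \<Omega> = \<Omega>" and X: "X \<in> test_functions \<Omega>"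
    and Ti: "integrable (lebesgue_on \<Omega>) T"
    and T: "\<And>\<theta>. AE x in lebesgue_on \<Omega>. T (rotm \<theta> *v x) = rotm \<theta> ** T x ** transpose (rotm \<theta>)"
  shows "(LINT x|lebesgue_on \<Omega>. T x \<bullet> jacobian (rotation_average X) (at x)) =
    (LINT x|lebesgue_on \<Omega>. T x \<bullet> jacobian X (at x))"
proof -
  obtain Q where Q: "smooth_on UNIV X" "compact Q" "Q \<subseteq> \<Omega>" "\<And>x. x \<notin> Q \<Longrightarrow> X x = 0"
    using test_functionsE[OF X] by metis
  let ?I = "{0..2 * pi} :: real set"
  let ?G = "\<lambda>x \<theta>. jacobian (rotated X \<theta>) (at x)"
  let ?M1 = "lebesgue_on \<Omega>" and ?M2 = "lebesgue_on ?I"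
  let ?L = "LINT x|lebesgue_on \<Omega>. T x \<bullet> jacobian X (at x)"
  have \<Omega>s: "\<Omega> \<in> sets lebesgue" using \<Omega> by (simp add: borel_open)
  have cG: "continuous_on UNIV (\<lambda>p. ?G (fst p) (snd p))"
    by (rule continuous_jacobian_rotated[OF Q(1)])
  have cG1: "continuous_on S (?G x)" for S x
  proof -
    have "continuous_on S (\<lambda>\<theta>. (\<lambda>p. ?G (fst p) (snd p)) (x, \<theta>))"
      by (rule continuous_on_compose2[OF cG]) (auto intro!: continuous_intros)
    then show ?thesis by simp
  qed
  have G0: "jacobian X (at y) = 0" if "y \<notin> Q" for y
    by (rule jacobian_zero_outside_support[OF Q(1,2,4) that])
  obtain \<beta> where \<beta>: "\<beta> > 0" "\<And>y. norm (jacobian X (at y)) \<le> \<beta>"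
    using test_function_bounded[OF continuous_jacobian[OF Q(1)] Q(2)] G0 by blast
  have Gb: "norm (?G x \<theta>) \<le> \<beta>" for x \<theta>
    unfolding jacobian_rotated[OF Q(1)] transpose_rotm[symmetric] norm_conjugate[OF orthogonal_rotm(1)] by (rule \<beta>(2))
  have b: "\<bar>T x \<bullet> ?G x \<theta>\<bar> \<le> \<beta> * norm (T x)" for x \<theta>
    using Cauchy_Schwarz_ineq2[of "T x" "?G x \<theta>"] mult_left_mono[OF Gb[of \<theta> x] norm_ge_zero[of "T x"]]
    by (simp add: mult.commute)
  interpret M1: finite_measure ?M1
    by (intro finite_measure_lebesgue_on lmeasurable_open \<Omega>)
  interpret M2: finite_measure ?M2
    by (intro finite_measure_lebesgue_on) simp
  interpret pair_sigma_finite ?M1 ?M2 ..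
  define f where "f = (\<lambda>p. T (fst p) \<bullet> ?G (fst p) (snd p))"
  have m1: "fst \<in> borel_measurable (?M1 \<Otimes>\<^sub>M ?M2)"
    by (rule measurable_compose[OF measurable_fst measurable_continuous_lebesgue_on[OF continuous_on_id \<Omega>s]])
  have m2: "snd \<in> borel_measurable (?M1 \<Otimes>\<^sub>M ?M2)"
    by (rule measurable_compose[OF measurable_snd measurable_continuous_lebesgue_on[OF continuous_on_id]]) simp
  have mG: "(\<lambda>p. ?G (fst p) (snd p)) \<in> borel_measurable (?M1 \<Otimes>\<^sub>M ?M2)"
    by (rule borel_measurable_continuous_Pair[OF m1 m2 cG])
  have mT: "(\<lambda>p. T (fst p)) \<in> borel_measurable (?M1 \<Otimes>\<^sub>M ?M2)"
    by (rule measurable_compose[OF measurable_fst borel_measurable_integrable[OF Ti]])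
  have mf: "f \<in> borel_measurable (?M1 \<Otimes>\<^sub>M ?M2)"
    unfolding f_def by (rule borel_measurable_inner[OF mT mG])
  have prod: "integrable (?M1 \<Otimes>\<^sub>M ?M2) (\<lambda>p. \<beta> * norm (T (fst p)))"
  proof (rule Fubini_integrable)
    show "(\<lambda>p. \<beta> * norm (T (fst p))) \<in> borel_measurable (?M1 \<Otimes>\<^sub>M ?M2)"
      using mT by measurable
    show "integrable ?M1 (\<lambda>x. \<integral>y. norm (\<beta> * norm (T (fst (x, y)))) \<partial>?M2)"
      using Ti by simp
  qed simp
  have fi: "integrable (?M1 \<Otimes>\<^sub>M ?M2) f"
  proof (rule Bochner_Integration.integrable_bound[OF prod mf])
    show "AE p in ?M1 \<Otimes>\<^sub>M ?M2. norm (f p) \<le> norm (\<beta> * norm (T (fst p)))"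
      using b \<beta>(1) by (intro AE_I2) (simp add: f_def abs_mult)
  qed
  have inner: "T x \<bullet> jacobian (rotation_average X) (at x) = (1 / (2 * pi)) * (LINT \<theta>|?M2. f (x, \<theta>))" for x
  proof -
    have iG: "?G x integrable_on ?I" by (rule integrable_continuous_interval[OF cG1])
    have "T x \<bullet> jacobian (rotation_average X) (at x) = (1 / (2 * pi)) * (T x \<bullet> integral ?I (?G x))"
      by (simp add: jacobian_rotation_average[OF Q(1)])
    also have "T x \<bullet> integral ?I (?G x) = integral ?I (\<lambda>\<theta>. T x \<bullet> ?G x \<theta>)"
      using integral_linear[OF iG bounded_linear_inner_right[of "T x"]] by (simp add: o_def)
    also have "\<dots> = (LINT \<theta>|?M2. T x \<bullet> ?G x \<theta>)"
    proof (rule lebesgue_integral_eq_integral[symmetric])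
      show "integrable ?M2 (\<lambda>\<theta>. T x \<bullet> ?G x \<theta>)"
        by (intro continuous_imp_integrable_real continuous_on_inner continuous_on_const cG1)
    qed simp
    finally show ?thesis by (simp add: f_def)
  qed
  have outer: "(LINT x|?M1. f (x, \<theta>)) = ?L" for \<theta>
    unfolding f_def fst_conv snd_conv rotated_def[abs_def] transpose_rotm[symmetric]
    by (rule stress_functional_conjugate[OF orthogonal_rotm \<Omega>(1,2,3) Q(1) T])
  have "(LINT x|lebesgue_on \<Omega>. T x \<bullet> jacobian (rotation_average X) (at x)) = (1 / (2 * pi)) * (LINT x|?M1. (LINT \<theta>|?M2. f (x, \<theta>)))"
    unfolding inner by simp
  also have "(LINT x|?M1. (LINT \<theta>|?M2. f (x, \<theta>))) = (LINT \<theta>|?M2. (LINT x|?M1. f (x, \<theta>)))"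
    using Fubini_integral[where f = "\<lambda>x \<theta>. f (x, \<theta>)"] fi by simp
  also have "\<dots> = 2 * pi * ?L"
    unfolding outer by (simp add: measure_restrict_space)
  finally show ?thesis by simp
qed

text \<open>A rotation by a shifts the angle of integration by a, and the integrand has period 2 pi.
  Negative angles are reduced to positive ones by applying the inverse rotation.\<close>

lemma rotation_average_equivariant:
  assumes X: "smooth_on UNIV X"
  shows "rotation_average X (rotm a *v x) = rotm a *v rotation_average X x"
proof -
  have cF: "continuous_on S (\<lambda>\<theta>. rotated X \<theta> x)" for S x
  proof -
    have "continuous_on S (\<lambda>\<theta>. (\<lambda>p. rotated X (snd p) (fst p)) (x, \<theta>))"
      by (rule continuous_on_compose2[OF smooth_continuous[OF smooth_rotated[OF X]]]) (auto intro!: continuous_intros)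
    then show ?thesis by simp
  qed
  have pos: "rotm a *v rotation_average X (rotm (- a) *v x) = rotation_average X x" if "a \<ge> 0" for a x
  proof -
    have i: "(\<lambda>\<theta>. rotated X \<theta> (rotm (- a) *v x)) integrable_on {0..2 * pi}"
      by (rule integrable_continuous_interval[OF cF])
    have r: "rotm a *v rotated X \<theta> (rotm (- a) *v x) = rotated X (\<theta> + a) x" for \<theta>
      by (simp add: rotated_def matrix_vector_mul_assoc rotm_mult add.commute)
    have per: "rotated X (\<theta> + 2 * pi) x = rotated X \<theta> x" for \<theta>
    proof -
      have "rotm (\<theta> + 2 * pi) = rotm \<theta>" "rotm (- (\<theta> + 2 * pi)) = rotm (- \<theta>)"
        by (simp_all add: vec_eq_iff forall_3 rotm_components cos_diff sin_diff cos_add sin_add)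
      then show ?thesis by (simp add: rotated_def)
    qed
    have bl: "bounded_linear (\<lambda>x :: real^3. rotm a *v x)" by (rule matrix_vector_mul_bounded_linear)
    have "rotm a *v rotation_average X (rotm (- a) *v x) = (1 / (2 * pi)) *\<^sub>R integral {0..2 * pi} (\<lambda>\<theta>. rotated X (\<theta> + a) x)"
      using integral_linear[OF i bl]
      by (simp add: rotation_average_def o_def r matrix_vector_mult_scaleR)
    also have "\<dots> = rotation_average X x"
      using integral_periodic_shift[OF cF per _ that] by (simp add: rotation_average_def)
    finally show ?thesis .
  qed
  show ?thesis
  proof (cases "a \<ge> 0")
    case True
    then show ?thesis using pos[of a "rotm a *v x"] by (simp add: matrix_vector_mul_assoc rotm_mult rotm_0)
  next
    case False
    then have "rotm a *v (rotm (- a) *v rotation_average X (rotm a *v x)) = rotm a *v rotation_average X x"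
      using pos[of "- a" x] by simp
    then show ?thesis by (simp add: matrix_vector_mul_assoc rotm_mult rotm_0)
  qed
qed

text \<open>The average vanishes off the set swept out by Q under the rotations, which is the
  continuous image of a compact product and stays in the invariant set \<Omega>.\<close>

lemma rotation_average_test_function:
  assumes \<Omega>: "\<And>\<theta>. (\<lambda>x. rotm \<theta> *v x) ` \<Omega> = \<Omega>" and X: "X \<in> test_functions \<Omega>"
  shows "rotation_average X \<in> test_functions \<Omega>"
proof -
  obtain Q where Q: "smooth_on UNIV X" "compact Q" "Q \<subseteq> \<Omega>" "\<And>x. x \<notin> Q \<Longrightarrow> X x = 0"
    using test_functionsE[OF X] by metis
  let ?C = "(\<lambda>p. rotm (snd p) *v fst p) ` (Q \<times> {0..2 * pi})"
  show ?thesis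
  proof (rule test_functionsI[OF smooth_rotation_average[OF Q(1)]])
    have "continuous_on UNIV (\<lambda>p. rotm (snd p) *v fst p :: real^3)"
      by (intro smooth_continuous smooth_matrix_vector_mult smooth_rotm smooth_linear bounded_linear_snd bounded_linear_fst)
    then show "compact ?C"
      by (intro compact_continuous_image compact_Times Q(2)) (auto intro: continuous_on_subset)
    show "?C \<subseteq> \<Omega>" using Q(3) \<Omega> by fastforce
    fix x assume x: "x \<notin> ?C"
    have "rotated X \<theta> x = 0" if "\<theta> \<in> {0..2 * pi}" for \<theta>
    proof -
      have "rotm (- \<theta>) *v x \<notin> Q"
      proof
        assume "rotm (- \<theta>) *v x \<in> Q"
        then have "rotm \<theta> *v (rotm (- \<theta>) *v x) \<in> ?C" using that by force
        then show False using x by (simp add: matrix_vector_mul_assoc rotm_mult rotm_0)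
      qed
      then show ?thesis using Q(4) by (simp add: rotated_def)
    qed
    then have "integral {0..2 * pi} (\<lambda>\<theta>. rotated X \<theta> x) = integral {0..2 * pi} (\<lambda>\<theta>. 0)"
      by (intro integral_cong)
    then show "rotation_average X x = 0" by (simp add: rotation_average_def)
  qed
qed

text \<open>The reflection conjugates the rotation by \<theta> to the one by -\<theta>
  (\<open>reflm_rotm\<close>), so the reflected average \<open>B\<close> is still rotation
  equivariant, and the mean of \<open>A\<close> and \<open>B\<close> commutes with the reflection as
  well. Neither average changes the pairing with T.\<close>

lemma symmetrization:
  fixes X :: "real^3 \<Rightarrow> real^3" and T :: "real^3 \<Rightarrow> real^3^3"
  assumes \<Omega>: "open \<Omega>" "bounded \<Omega>" "\<And>\<theta>. (\<lambda>x. rotm \<theta> *v x) ` \<Omega> = \<Omega>" "(\<lambda>x. reflm *v x) ` \<Omega> = \<Omega>"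
    and X: "X \<in> test_functions \<Omega>" and Ti: "integrable (lebesgue_on \<Omega>) T"
    and T: "\<And>\<theta>. AE x in lebesgue_on \<Omega>. T (rotm \<theta> *v x) = rotm \<theta> ** T x ** transpose (rotm \<theta>)"
      "AE x in lebesgue_on \<Omega>. T (reflm *v x) = reflm ** T x ** transpose reflm"
  obtains Y where "Y \<in> test_functions \<Omega>" "\<And>\<theta> x. Y (rotm \<theta> *v x) = rotm \<theta> *v Y x" "\<And>x. Y (reflm *v x) = reflm *v Y x"
    "(LINT x|lebesgue_on \<Omega>. T x \<bullet> jacobian Y (at x)) = (LINT x|lebesgue_on \<Omega>. T x \<bullet> jacobian X (at x))"
proof -
  have \<Omega>s: "\<Omega> \<in> sets lebesgue" using \<Omega> by (simp add: borel_open)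
  define A where "A = rotation_average X"
  define B where "B = (\<lambda>x. reflm *v A (reflm *v x))"
  define Y where "Y = (\<lambda>x. (1/2) *\<^sub>R A x + (1/2) *\<^sub>R B x)"
  have A: "A \<in> test_functions \<Omega>" unfolding A_def by (rule rotation_average_test_function[OF \<Omega>(3) X])
  have sX: "smooth_on UNIV X" using X by (auto simp: test_functions_def)
  obtain Q where Q: "smooth_on UNIV A" "compact Q" "Q \<subseteq> \<Omega>" "\<And>x. x \<notin> Q \<Longrightarrow> A x = 0"
    using test_functionsE[OF A] by metis
  have rr: "reflm *v (reflm *v x) = x" for x by (simp add: matrix_vector_mul_assoc reflm_mult)
  have lin: "bounded_linear (\<lambda>x :: real^3. reflm *v x)" by (rule matrix_vector_mul_bounded_linear)
  have sB: "smooth_on UNIV B"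
    unfolding B_def by (intro smooth_bounded_linear[OF lin] smooth_compose[OF Q(1)] smooth_linear[OF lin])
  have sY: "smooth_on UNIV Y"
    unfolding Y_def by (intro smooth_add smooth_scaleR smooth_const Q(1) sB)
  show ?thesis
  proof (rule that)
    show "Y \<in> test_functions \<Omega>"
    proof (rule test_functionsI[OF sY])
      show "compact (Q \<union> (\<lambda>x. reflm *v x) ` Q)"
        by (intro compact_Un compact_continuous_image linear_continuous_on lin Q(2))
      show "Q \<union> (\<lambda>x. reflm *v x) ` Q \<subseteq> \<Omega>" using Q(3) \<Omega>(4) by blast
      fix x assume x: "x \<notin> Q \<union> (\<lambda>x. reflm *v x) ` Q"
      then have "reflm *v x \<notin> Q" using rr by (metis UnCI imageI)
      then show "Y x = 0" using x Q(4) by (simp add: Y_def B_def)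
    qed
    have eA: "A (rotm \<theta> *v x) = rotm \<theta> *v A x" for \<theta> x
      unfolding A_def by (rule rotation_average_equivariant[OF sX])
    have "B (rotm \<theta> *v x) = rotm \<theta> *v B x" for \<theta> x
    proof -
      have "reflm *v (rotm \<theta> *v x) = rotm (- \<theta>) *v (reflm *v x)"
        by (simp add: matrix_vector_mul_assoc reflm_rotm)
      then have "B (rotm \<theta> *v x) = reflm *v (rotm (- \<theta>) *v A (reflm *v x))"
        by (simp only: B_def eA)
      also have "\<dots> = rotm \<theta> *v (reflm *v A (reflm *v x))"
        by (simp add: matrix_vector_mul_assoc reflm_rotm)
      finally show ?thesis by (simp only: B_def)
    qed
    then show "Y (rotm \<theta> *v x) = rotm \<theta> *v Y x" for \<theta> x
      by (simp add: Y_def eA matrix_vector_right_distrib matrix_vector_mult_scaleR)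
    show "Y (reflm *v x) = reflm *v Y x" for x
      by (simp add: Y_def B_def rr matrix_vector_right_distrib matrix_vector_mult_scaleR add.commute)
    have jY: "jacobian Y (at x) = (1/2) *\<^sub>R jacobian A (at x) + (1/2) *\<^sub>R jacobian B (at x)" for x
    proof (rule jacobianI)
      show "(Y has_derivative (\<lambda>h. ((1/2) *\<^sub>R jacobian A (at x) + (1/2) *\<^sub>R jacobian B (at x)) *v h)) (at x)"
        unfolding Y_def matrix_vector_mult_add_rdistrib scaleR_matrix_vector_assoc[symmetric]
        by (intro has_derivative_add has_derivative_scaleR_right smooth_jacobian(1) Q(1) sB)
    qed
    have int: "integrable (lebesgue_on \<Omega>) (\<lambda>x. T x \<bullet> jacobian Z (at x))"
      if Z: "smooth_on UNIV Z" "compact K" "\<And>x. x \<notin> K \<Longrightarrow> Z x = 0" for Z and K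
    proof -
      have "jacobian Z (at y) = 0" if "y \<notin> K" for y
        by (rule jacobian_zero_outside_support[OF Z that])
      then obtain b where b: "b > 0" "\<And>y. norm (jacobian Z (at y)) \<le> b"
        using test_function_bounded[OF continuous_jacobian[OF Z(1)] Z(2)] by blast
      show ?thesis
      proof (rule Bochner_Integration.integrable_bound[OF integrable_mult_right[OF integrable_norm[OF Ti], of b]])
        show "(\<lambda>x. T x \<bullet> jacobian Z (at x)) \<in> borel_measurable (lebesgue_on \<Omega>)"
          by (intro borel_measurable_inner borel_measurable_integrable[OF Ti] measurable_continuous_lebesgue_on
              continuous_jacobian Z(1) \<Omega>s)
        have "\<bar>T x \<bullet> jacobian Z (at x)\<bar> \<le> b * norm (T x)" for x
          using Cauchy_Schwarz_ineq2[of "T x" "jacobian Z (at x)"] mult_left_mono[OF b(2)[of x] norm_ge_zero[of "T x"]]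
          by (simp add: mult.commute)
        then show "AE x in lebesgue_on \<Omega>. norm (T x \<bullet> jacobian Z (at x)) \<le> norm (b * norm (T x))"
          using b(1) by (simp add: abs_mult)
      qed
    qed
    have iA: "integrable (lebesgue_on \<Omega>) (\<lambda>x. T x \<bullet> jacobian A (at x))"
      using int[OF Q(1,2,4)] by blast
    have iB: "integrable (lebesgue_on \<Omega>) (\<lambda>x. T x \<bullet> jacobian B (at x))"
    proof (rule int[OF sB])
      show "compact ((\<lambda>x. reflm *v x) ` Q)" by (intro compact_continuous_image linear_continuous_on lin Q(2))
      fix x assume "x \<notin> (\<lambda>x. reflm *v x) ` Q"
      then have "reflm *v x \<notin> Q" using rr by (metis imageI)
      then show "B x = 0" using Q(4) by (simp add: B_def)
    qed
    have LB: "(LINT x|lebesgue_on \<Omega>. T x \<bullet> jacobian B (at x)) = (LINT x|lebesgue_on \<Omega>. T x \<bullet> jacobian A (at x))"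
      using stress_functional_conjugate[OF orthogonal_reflm \<Omega>(1,2,4) Q(1) T(2)] unfolding transpose_reflm B_def .
    have "(LINT x|lebesgue_on \<Omega>. T x \<bullet> jacobian Y (at x)) =
        (LINT x|lebesgue_on \<Omega>. (1/2) * (T x \<bullet> jacobian A (at x)) + (1/2) * (T x \<bullet> jacobian B (at x)))"
      by (simp add: jY inner_add_right)
    also have "\<dots> = (1/2) * (LINT x|lebesgue_on \<Omega>. T x \<bullet> jacobian A (at x)) + (1/2) * (LINT x|lebesgue_on \<Omega>. T x \<bullet> jacobian B (at x))"
      using iA iB by (subst Bochner_Integration.integral_add) auto
    also have "\<dots> = (LINT x|lebesgue_on \<Omega>. T x \<bullet> jacobian X (at x))"
      unfolding LB unfolding A_def stress_functional_average[OF \<Omega>(1,2,3) X Ti T(1)] by simp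
    finally show "(LINT x|lebesgue_on \<Omega>. T x \<bullet> jacobian Y (at x)) = (LINT x|lebesgue_on \<Omega>. T x \<bullet> jacobian X (at x))" .
  qed
qed

section \<open>Axisymmetric competitors\<close>

definition cyl :: "real \<Rightarrow> real \<Rightarrow> real \<Rightarrow> real^3" where
  "cyl r \<theta> z = vector [r * cos \<theta>, r * sin \<theta>, z]"

lemma cyl_components: "cyl r \<theta> z $ 1 = r * cos \<theta>" "cyl r \<theta> z $ 2 = r * sin \<theta>" "cyl r \<theta> z $ 3 = z"
  by (simp_all add: cyl_def vector_3)

lemma rotm_cyl: "rotm a *v cyl r \<theta> z = cyl r (\<theta> + a) z"
  by (simp add: vec_eq_iff forall_3 matrix_vector_mult_def sum_3 rotm_components cyl_components cos_add sin_add algebra_simps)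

lemma reflm_cyl: "reflm *v cyl r \<theta> z = cyl r (- \<theta>) z"
  by (simp add: vec_eq_iff forall_3 matrix_vector_mult_def sum_3 reflm_components cyl_components)

lemma cyl_exists: "\<exists>r \<theta>. r \<ge> 0 \<and> x = cyl r \<theta> (x $ 3)"
proof -
  define r where "r = sqrt ((x $ 1)\<^sup>2 + (x $ 2)\<^sup>2)"
  show ?thesis
  proof (cases "r = 0")
    case True
    then have "x $ 1 = 0" "x $ 2 = 0" by (auto simp: r_def)
    then show ?thesis by (intro exI[of _ 0]) (simp add: vec_eq_iff forall_3 cyl_components)
  next
    case False
    moreover have "r \<ge> 0" by (simp add: r_def)
    ultimately have r: "r > 0" by simp
    have "(x $ 1 / r)\<^sup>2 + (x $ 2 / r)\<^sup>2 = ((x $ 1)\<^sup>2 + (x $ 2)\<^sup>2) / r\<^sup>2"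
      by (simp add: power_divide add_divide_distrib)
    also have "(x $ 1)\<^sup>2 + (x $ 2)\<^sup>2 = r\<^sup>2" by (simp add: r_def)
    also have "r\<^sup>2 / r\<^sup>2 = 1" using r by simp
    finally obtain \<theta> where "x $ 1 / r = cos \<theta>" "x $ 2 / r = sin \<theta>"
      using sincos_total_2pi by metis
    then have "x = cyl r \<theta> (x $ 3)"
      using r by (simp add: vec_eq_iff forall_3 cyl_components field_simps)
    then show ?thesis using r by (intro exI[of _ r] exI[of _ \<theta>]) auto
  qed
qed

lemma axisymmetric_set_rotm: "axisymmetric_set \<Omega> \<Longrightarrow> (\<lambda>x. rotm \<theta> *v x) ` \<Omega> = \<Omega>"
  by (simp add: axisymmetric_set_def rot_z_eq[abs_def])

text \<open>At a single point the reflection agrees with the rotation by minus twice its angle, so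
  rotational invariance of the set suffices.\<close>

lemma axisymmetric_set_reflm:
  assumes "axisymmetric_set \<Omega>"
  shows "(\<lambda>x. reflm *v x) ` \<Omega> = \<Omega>"
proof -
  have mem: "reflm *v x \<in> \<Omega>" if "x \<in> \<Omega>" for x
  proof -
    obtain r \<theta> where x: "x = cyl r \<theta> (x $ 3)" using cyl_exists by blast
    have "reflm *v x = rotm (- 2 * \<theta>) *v x"
      by (subst (1 2) x) (simp add: reflm_cyl rotm_cyl)
    then show ?thesis using axisymmetric_set_rotm[OF assms, of "- 2 * \<theta>"] that by blast
  qed
  show ?thesis
  proof (intro set_eqI iffI)
    fix x assume "x \<in> \<Omega>"
    then have "reflm *v (reflm *v x) \<in> (\<lambda>x. reflm *v x) ` \<Omega>" using mem by blast
    then show "x \<in> (\<lambda>x. reflm *v x) ` \<Omega>" by (simp add: matrix_vector_mul_assoc reflm_mult)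
  qed (use mem in auto)
qed

definition axi_value :: "(real \<times> real \<Rightarrow> real) \<Rightarrow> (real \<times> real \<Rightarrow> real) \<Rightarrow> real \<Rightarrow> real \<Rightarrow> real \<Rightarrow> real^3" where
  "axi_value v1 v2 r \<theta> z = v1 (r, z) *\<^sub>R (cos \<theta> *\<^sub>R axis 1 1 + sin \<theta> *\<^sub>R axis 2 1) + v2 (r, z) *\<^sub>R axis 3 1"

text \<open>An axisymmetric map keeps the angle and acts on (r, z) alone, while the symmetries only
  shift or negate the angle.\<close>

lemma axi_value_cyl: "axi_value v1 v2 r \<theta> z = cyl (v1 (r, z)) \<theta> (v2 (r, z))"
  by (simp add: axi_value_def vec_eq_iff forall_3 cyl_components axis_def)

lemma axisymmetric_map_alt:
  "axisymmetric_map \<Omega> u \<longleftrightarrow> (\<exists>v1 v2. (AE p in lebesgue_on (meridian \<Omega>). v1 p \<ge> 0) \<and>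
     (AE x in lebesgue_on \<Omega>. \<forall>r \<theta> z. r > 0 \<and> x = cyl r \<theta> z \<longrightarrow> u x = cyl (v1 (r, z)) \<theta> (v2 (r, z))))"
  unfolding axisymmetric_map_def axi_value_cyl[symmetric] axi_value_def cyl_def ..

text \<open>The whole plane x_1 = 0 is discarded, a null set that contains the axis; off it the
  cylindrical radius is positive.\<close>

lemma AE_off_axis:
  assumes "\<Omega> \<in> sets lebesgue"
  shows "AE x in lebesgue_on \<Omega>. (x :: real^3) $ 1 \<noteq> 0"
  unfolding AE_lebesgue_on_iff[OF assms] eventually_ae_filter_negligible
  using negligible_standard_hyperplane_cart[of "1 :: 3"] by (intro exI[of _ "{x. x $ 1 = 0}"]) auto

text \<open>The representation of u holds at almost every x and, by
  \<open>AE_lebesgue_on_preimage\<close>, at the image of almost every x; the two are compared in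
  cylindrical coordinates.\<close>

lemma axisymmetric_map_equivariant:
  assumes u: "axisymmetric_map \<Omega> u" and \<Omega>: "open \<Omega>" "axisymmetric_set \<Omega>"
  shows "AE x in lebesgue_on \<Omega>. u (rotm a *v x) = rotm a *v u x"
    and "AE x in lebesgue_on \<Omega>. u (reflm *v x) = reflm *v u x"
proof -
  have \<Omega>s: "\<Omega> \<in> sets lebesgue" using \<Omega> by (simp add: borel_open)
  obtain v1 v2 where v: "AE x in lebesgue_on \<Omega>. \<forall>r \<theta> z. r > 0 \<and> x = cyl r \<theta> z \<longrightarrow> u x = cyl (v1 (r, z)) \<theta> (v2 (r, z))"
    using u unfolding axisymmetric_map_alt by blast
  have lin: "(\<lambda>x :: real^3. A *v x) differentiable_on UNIV" for A :: "real^3^3"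
    by (intro linear_imp_differentiable_on) simp
  have cyl: "\<exists>r \<theta>. r > 0 \<and> x = cyl r \<theta> (x $ 3)" if "x $ 1 \<noteq> 0" for x
    using cyl_exists[of x] that by (metis cyl_components(1) less_le mult_eq_0_iff)
  have "rotm a *v x \<in> \<Omega>" if "x \<in> \<Omega>" for x
    using axisymmetric_set_rotm[OF \<Omega>(2), of a] that by blast
  then have "AE x in lebesgue_on \<Omega>. \<forall>r \<theta> z. r > 0 \<and> rotm a *v x = cyl r \<theta> z \<longrightarrow> u (rotm a *v x) = cyl (v1 (r, z)) \<theta> (v2 (r, z))"
    by (rule AE_lebesgue_on_preimage[OF \<Omega>s v lin[of "rotm (- a)"]])
      (auto simp: matrix_vector_mul_assoc rotm_mult rotm_0)
  with v AE_off_axis[OF \<Omega>s] show "AE x in lebesgue_on \<Omega>. u (rotm a *v x) = rotm a *v u x"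
  proof eventually_elim
    case (elim x)
    obtain r \<theta> where r: "r > 0" and x: "x = cyl r \<theta> (x $ 3)" using cyl[OF elim(2)] by blast
    have "rotm a *v x = cyl r (\<theta> + a) (x $ 3)" by (subst x) (rule rotm_cyl)
    then have "u (rotm a *v x) = cyl (v1 (r, x $ 3)) (\<theta> + a) (v2 (r, x $ 3))" using elim(3) r by blast
    moreover have "u x = cyl (v1 (r, x $ 3)) \<theta> (v2 (r, x $ 3))" using elim(1) r x by blast
    ultimately show ?case by (simp add: rotm_cyl)
  qed
  have "reflm *v x \<in> \<Omega>" if "x \<in> \<Omega>" for x
    using axisymmetric_set_reflm[OF \<Omega>(2)] that by blast
  then have "AE x in lebesgue_on \<Omega>. \<forall>r \<theta> z. r > 0 \<and> reflm *v x = cyl r \<theta> z \<longrightarrow> u (reflm *v x) = cyl (v1 (r, z)) \<theta> (v2 (r, z))"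
    by (rule AE_lebesgue_on_preimage[OF \<Omega>s v lin[of reflm]])
      (auto simp: matrix_vector_mul_assoc reflm_mult)
  with v AE_off_axis[OF \<Omega>s] show "AE x in lebesgue_on \<Omega>. u (reflm *v x) = reflm *v u x"
  proof eventually_elim
    case (elim x)
    obtain r \<theta> where r: "r > 0" and x: "x = cyl r \<theta> (x $ 3)" using cyl[OF elim(2)] by blast
    have "reflm *v x = cyl r (- \<theta>) (x $ 3)" by (subst x) (rule reflm_cyl)
    then have "u (reflm *v x) = cyl (v1 (r, x $ 3)) (- \<theta>) (v2 (r, x $ 3))" using elim(3) r by blast
    moreover have "u x = cyl (v1 (r, x $ 3)) \<theta> (v2 (r, x $ 3))" using elim(1) r x by blast
    ultimately show ?case by (simp add: reflm_cyl)
  qed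
qed

context smooth_diffeo
begin

text \<open>The positive Jacobian of \<psi> keeps the determinant positive, the exceptional set for
  injectivity becomes its image under \<psi>, and the identity off K keeps the boundary
  values.\<close>

lemma admissible_nc_push:
  assumes u: "u \<in> admissible_nc \<Omega> g M" and \<sigma>: "\<sigma> = 1" and g: "C1_on_closed (closure \<Omega>) g"
    and K: "compact K" "K \<subseteq> \<Omega>" "\<And>x. x \<notin> K \<Longrightarrow> \<eta> x = x"
  shows "(\<lambda>x. u (\<eta> x)) \<in> admissible_nc \<Omega> g M"
proof -
  let ?D = "weak_gradient \<Omega> u" and ?w = "\<lambda>x. u (\<eta> x)"
  from u have W: "u \<in> W12 \<Omega>" and tr: "same_trace \<Omega> u g" and bd: "AE x in lebesgue_on \<Omega>. norm (u x) \<le> M"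
    and det: "AE x in lebesgue_on \<Omega>. det (?D x) > 0" and inj: "one_to_one_ae \<Omega> u"
    and di: "integrable (lebesgue_on \<Omega>) (\<lambda>x. det (?D x))" and se: "surface_energy \<Omega> u = 0"
    by (auto simp: admissible_nc_def admissible_def)
  have dJ: "det (J x) > 0" for x
  proof -
    have "0 < \<bar>det (J x)\<bar>" using det_nonzero[of x] by simp
    then show ?thesis using sign[of x] \<sigma> by simp
  qed
  have pd: "det (push_gradient ?D x) = det (?D (\<eta> x)) / det (J (\<eta> x))" for x
    by (simp add: push_gradient_def det_mul det_minv det_nonzero)
  note W' = W12_push[OF W]
  have det': "AE x in lebesgue_on \<Omega>. det (weak_gradient \<Omega> ?w x) > 0"
    using W'(2) AE_\<eta>[OF det] by eventually_elim (simp add: pd dJ)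
  have i: "integrable (lebesgue_on \<Omega>) (\<lambda>x. det (push_gradient ?D x))"
  proof -
    have "\<bar>det (J x)\<bar> * det (push_gradient ?D (\<psi> x)) = det (?D x)" for x
      using dJ[of x] by (simp add: pd)
    then show ?thesis using di cov(1)[of "\<lambda>x. det (push_gradient ?D x)"] by simp
  qed
  have "AE x in lebesgue_on \<Omega>. det (push_gradient ?D x) = det (weak_gradient \<Omega> ?w x)"
    using W'(2) by eventually_elim simp
  from integral_cong_AE_lebesgue_on(1)[OF dom_sets this] i
  have di': "integrable (lebesgue_on \<Omega>) (\<lambda>x. det (weak_gradient \<Omega> ?w x))" by (rule iffD1)
  have inj': "one_to_one_ae \<Omega> ?w"
  proof -
    obtain N where N: "negligible N" "inj_on u (\<Omega> - N)" using inj by (auto simp: one_to_one_ae_def)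
    have "negligible (\<psi> ` N)"
      by (rule negligible_differentiable_image_negligible[OF _ N(1)])
        (auto intro: differentiable_on_subset[OF differentiable(1)])
    moreover have "inj_on ?w (\<Omega> - \<psi> ` N)"
    proof (rule inj_onI)
      fix x y assume x: "x \<in> \<Omega> - \<psi> ` N" and y: "y \<in> \<Omega> - \<psi> ` N" and eq: "u (\<eta> x) = u (\<eta> y)"
      have mem: "\<eta> z \<in> \<Omega> - N" if "z \<in> \<Omega> - \<psi> ` N" for z
      proof -
        have "\<eta> z \<notin> N" using that imageI[of "\<eta> z" N \<psi>] by auto
        then show ?thesis using that \<eta>_mem by blast
      qed
      from inj_onD[OF N(2) eq mem[OF x] mem[OF y]] show "x = y"
        by (metis right_inverse)
    qed
    ultimately show ?thesis unfolding one_to_one_ae_def by blast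
  qed
  show ?thesis
    using W'(1) same_trace_push[OF tr g K] AE_\<eta>[OF bd] det' inj' di' surface_energy_push[OF W det \<sigma> se]
    by (simp add: admissible_nc_def admissible_def)
qed

text \<open>Commuting with the reflection, \<psi> preserves its fixed plane x_2 = 0, and
  \<open>pos\<close> excludes an exchange of the two half planes. Hence \<eta> induces a map
  \<open>\<Phi>\<close> of the meridian section, and commuting with rotations makes
  \<open>v1\<close> and \<open>v2\<close> composed with \<open>\<Phi>\<close> the profile of the new
  map.\<close>

lemma axisymmetric_map_push:
  assumes u: "axisymmetric_map \<Omega> u"
    and rot: "\<And>\<theta> x. \<psi> (rotm \<theta> *v x) = rotm \<theta> *v \<psi> x" and refl: "\<And>x. \<psi> (reflm *v x) = reflm *v \<psi> x"
    and pos: "\<And>r z. r > 0 \<Longrightarrow> \<psi> (cyl r 0 z) $ 1 > 0"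
  shows "axisymmetric_map \<Omega> (\<lambda>x. u (\<eta> x))"
proof -
  obtain v1 v2 where v: "AE p in lebesgue_on (meridian \<Omega>). v1 p \<ge> 0"
    "AE x in lebesgue_on \<Omega>. \<forall>r \<theta> z. r > 0 \<and> x = cyl r \<theta> z \<longrightarrow> u x = cyl (v1 (r, z)) \<theta> (v2 (r, z))"
    using u unfolding axisymmetric_map_alt by blast
  have rot\<eta>: "\<eta> (rotm \<theta> *v x) = rotm \<theta> *v \<eta> x" for \<theta> x
    using rot[of \<theta> "\<eta> x"] by (metis left_inverse right_inverse)
  have refl\<eta>: "\<eta> (reflm *v x) = reflm *v \<eta> x" for x
    using refl[of "\<eta> x"] by (metis left_inverse right_inverse)
  have fix_refl: "x = cyl (x $ 1) 0 (x $ 3)" if "reflm *v x = x" for x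
  proof -
    have "(reflm *v x) $ 2 = - x $ 2"
      by (simp add: matrix_vector_mult_def sum_3 reflm_components)
    then show ?thesis using that by (simp add: vec_eq_iff forall_3 cyl_components)
  qed
  have plane: "\<psi> (cyl r 0 z) = cyl (\<psi> (cyl r 0 z) $ 1) 0 (\<psi> (cyl r 0 z) $ 3)"
    "\<eta> (cyl r 0 z) = cyl (\<eta> (cyl r 0 z) $ 1) 0 (\<eta> (cyl r 0 z) $ 3)" for r z
    using fix_refl[of "\<psi> (cyl r 0 z)"] fix_refl[of "\<eta> (cyl r 0 z)"] refl[of "cyl r 0 z"] refl\<eta>[of "cyl r 0 z"]
    by (simp_all add: reflm_cyl)
  \<comment> \<open>Suppose \<eta> led to a first coordinate a \<le> 0. If a < 0, the rotation by pi
    and \<open>pos\<close> at -a make r negative; if a = 0, the same rotation gives r = -r.\<close>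
  have pos\<eta>: "\<eta> (cyl r 0 z) $ 1 > 0" if r: "r > 0" for r z
  proof (rule ccontr)
    define a c where "a = \<eta> (cyl r 0 z) $ 1" and "c = \<eta> (cyl r 0 z) $ 3"
    assume "\<not> \<eta> (cyl r 0 z) $ 1 > 0"
    then have a: "a \<le> 0" by (simp add: a_def)
    have \<psi>a: "\<psi> (cyl a 0 c) = cyl r 0 z" using plane(2)[of r z] by (metis a_def c_def right_inverse)
    have "cyl a 0 c = rotm pi *v cyl (- a) 0 c"
      by (simp add: rotm_cyl vec_eq_iff forall_3 cyl_components)
    then have "cyl r 0 z = rotm pi *v \<psi> (cyl (- a) 0 c)" using \<psi>a rot by metis
    then have "r = - \<psi> (cyl (- a) 0 c) $ 1"
      by (simp add: vec_eq_iff forall_3 cyl_components matrix_vector_mult_def sum_3 rotm_components)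
    moreover have "\<psi> (cyl (- a) 0 c) $ 1 > 0" if "a < 0" using pos[of "- a" c] that by simp
    moreover have "\<psi> (cyl (- a) 0 c) $ 1 = r" if "a = 0" using \<psi>a that by (simp add: cyl_components)
    ultimately show False using a r by (cases "a = 0") auto
  qed
  \<comment> \<open>The sign of v1 is an almost everywhere statement in the two-dimensional meridian
    section, so its null set is moved by the differentiable planar map \<open>\<Psi>\<close>, with
    \<open>\<Phi>\<close> as right inverse.\<close>
  define \<Psi> where "\<Psi> = (\<lambda>p. (\<psi> (cyl (fst p) 0 (snd p)) $ 1, \<psi> (cyl (fst p) 0 (snd p)) $ 3))"
  define \<Phi> where "\<Phi> = (\<lambda>p. (\<eta> (cyl (fst p) 0 (snd p)) $ 1, \<eta> (cyl (fst p) 0 (snd p)) $ 3))"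
  have emb: "cyl (fst p) 0 (snd p) = fst p *\<^sub>R axis 1 1 + snd p *\<^sub>R axis 3 1" for p
    by (simp add: vec_eq_iff forall_3 cyl_components axis_def)
  have mer: "meridian \<Omega> = {p. fst p > 0 \<and> cyl (fst p) 0 (snd p) \<in> \<Omega>}"
    by (auto simp: meridian_def cyl_def)
  have cemb: "continuous_on UNIV (\<lambda>p. cyl (fst p) 0 (snd p))"
    unfolding emb by (intro continuous_intros)
  have "open (meridian \<Omega>)"
  proof -
    have "meridian \<Omega> = {p. 0 < fst p} \<inter> (\<lambda>p. cyl (fst p) 0 (snd p)) -` \<Omega>" unfolding mer by auto
    moreover have "open ((\<lambda>p. cyl (fst p) 0 (snd p)) -` \<Omega>)"
      using cemb open_dom by (rule open_vimage[rotated])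
    moreover have "open {p :: real \<times> real. 0 < fst p}"
      by (intro open_Collect_less continuous_intros)
    ultimately show ?thesis by (simp add: open_Int)
  qed
  then have ms: "meridian \<Omega> \<in> sets lebesgue" by (simp add: borel_open)
  have "smooth_on UNIV (\<lambda>p. \<psi> (cyl (fst p) 0 (snd p)))"
    unfolding emb by (intro smooth_compose[OF smooth] smooth_add smooth_scaleR smooth_const smooth_linear
        bounded_linear_fst bounded_linear_snd)
  note sd = smooth_has_derivative[OF this]
  have "(\<Psi> has_derivative (\<lambda>h. (frechet_derivative (\<lambda>p. \<psi> (cyl (fst p) 0 (snd p))) (at p) h $ 1,
      frechet_derivative (\<lambda>p. \<psi> (cyl (fst p) 0 (snd p))) (at p) h $ 3))) (at p)" for p
    unfolding \<Psi>_def by (intro has_derivative_Pair bounded_linear.has_derivative[OF bounded_linear_vec_nth sd])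
  then have d\<Psi>: "\<Psi> differentiable_on UNIV"
    unfolding differentiable_on_def differentiable_def by (auto simp del: split_paired_All)
  have \<Phi>_emb: "cyl (fst (\<Phi> p)) 0 (snd (\<Phi> p)) = \<eta> (cyl (fst p) 0 (snd p))" for p
    using plane(2)[of "fst p" "snd p"] by (simp add: \<Phi>_def)
  have "AE p in lebesgue_on (meridian \<Omega>). v1 (\<Phi> p) \<ge> 0"
  proof (rule AE_lebesgue_on_preimage[OF ms v(1) d\<Psi>])
    fix p assume p: "p \<in> meridian \<Omega>"
    then show "\<Phi> p \<in> meridian \<Omega>"
      unfolding mer mem_Collect_eq \<Phi>_emb using \<eta>_mem pos\<eta>[of "fst p" "snd p"] by (simp add: \<Phi>_def)
    show "\<Psi> (\<Phi> p) = p"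
      unfolding \<Psi>_def \<Phi>_emb by (simp add: cyl_components)
  qed
  moreover have "AE x in lebesgue_on \<Omega>. \<forall>r \<theta> z. r > 0 \<and> x = cyl r \<theta> z \<longrightarrow>
      u (\<eta> x) = cyl (v1 (\<Phi> (r, z))) \<theta> (v2 (\<Phi> (r, z)))"
    using AE_\<eta>[OF v(2)]
  proof eventually_elim
    case (elim x)
    show ?case
    proof (intro allI impI)
      fix r \<theta> z assume x: "r > 0 \<and> x = cyl r \<theta> z"
      have "\<eta> x = \<eta> (rotm \<theta> *v cyl r 0 z)" using x by (simp add: rotm_cyl)
      also have "\<dots> = rotm \<theta> *v cyl (fst (\<Phi> (r, z))) 0 (snd (\<Phi> (r, z)))"
        unfolding rot\<eta> \<Phi>_emb by simp
      also have "\<dots> = cyl (fst (\<Phi> (r, z))) \<theta> (snd (\<Phi> (r, z)))" by (simp add: rotm_cyl)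
      finally have "\<eta> x = cyl (fst (\<Phi> (r, z))) \<theta> (snd (\<Phi> (r, z)))" .
      moreover have "fst (\<Phi> (r, z)) > 0" using pos\<eta> x by (simp add: \<Phi>_def)
      ultimately have "u (\<eta> x) = cyl (v1 (fst (\<Phi> (r, z)), snd (\<Phi> (r, z)))) \<theta> (v2 (fst (\<Phi> (r, z)), snd (\<Phi> (r, z))))"
        using elim by blast
      then show "u (\<eta> x) = cyl (v1 (\<Phi> (r, z))) \<theta> (v2 (\<Phi> (r, z)))" by simp
    qed
  qed
  ultimately show ?thesis
    unfolding axisymmetric_map_alt
    by (intro exI[of _ "\<lambda>p. v1 (\<Phi> p)"] exI[of _ "\<lambda>p. v2 (\<Phi> p)"]) auto
qed

end

text \<open>The point is that x + t Y(x) keeps the half plane r > 0. The rotation by pi forces the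
  first component of Y to vanish on the axis, so at distance r it is at most \<beta> r, and t0
  \<beta> \<le> 1/2 leaves the first coordinate positive.\<close>

lemma equivariant_competitor:
  assumes \<Omega>: "open \<Omega>" "bounded \<Omega>" and u: "u \<in> admissible_nc_axi \<Omega> g M" and g: "C1_on_closed (closure \<Omega>) g"
    and Y: "Y \<in> test_functions \<Omega>" "\<And>\<theta> x. Y (rotm \<theta> *v x) = rotm \<theta> *v Y x" "\<And>x. Y (reflm *v x) = reflm *v Y x"
  obtains t1 where "t1 > 0"
    "\<And>t. \<bar>t\<bar> \<le> t1 \<Longrightarrow> (\<lambda>x. u (inv (\<lambda>x. x + t *\<^sub>R Y x) x)) \<in> admissible_nc_axi \<Omega> g M"
proof -
  have sY: "smooth_on UNIV Y" using Y(1) by (auto simp: test_functions_def)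
  obtain t0 \<beta> \<gamma> K where t0: "t0 > 0" "\<And>y. norm (jacobian Y (at y)) \<le> \<beta>" "t0 * \<beta> \<le> 1 / 2"
    "\<And>t. \<bar>t\<bar> \<le> t0 \<Longrightarrow> smooth_diffeo \<Omega> (\<lambda>x. x + t *\<^sub>R Y x) (inv (\<lambda>x. x + t *\<^sub>R Y x)) 1 18"
    "\<And>t y. \<bar>t\<bar> \<le> t0 \<Longrightarrow> det (mat 1 + t *\<^sub>R jacobian Y (at y)) \<in> {1/2..2}"
    "\<And>t y. \<bar>t\<bar> \<le> t0 \<Longrightarrow> \<bar>det (mat 1 + t *\<^sub>R jacobian Y (at y)) - 1\<bar> \<le> \<gamma> * \<bar>t\<bar>"
    "\<And>t y. \<bar>t\<bar> \<le> t0 \<Longrightarrow> norm (minv (mat 1 + t *\<^sub>R jacobian Y (at y))) \<le> 18"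
    "compact K" "K \<subseteq> \<Omega>" "\<And>t x. \<bar>t\<bar> \<le> t0 \<Longrightarrow> x \<notin> K \<Longrightarrow> inv (\<lambda>x. x + t *\<^sub>R Y x) x = x"
    by (rule inner_variation_diffeo[OF Y(1) \<Omega>]) (rule that; assumption)
  have \<beta>: "\<beta> \<ge> 0" using t0(2)[of 0] norm_ge_zero order_trans by blast
  show ?thesis
  proof (rule that[OF t0(1)])
    fix t assume t: "\<bar>t\<bar> \<le> t0"
    interpret smooth_diffeo \<Omega> "\<lambda>x. x + t *\<^sub>R Y x" "inv (\<lambda>x. x + t *\<^sub>R Y x)" 1 18
      by (rule t0(4)[OF t])
    have nc: "(\<lambda>x. u (inv (\<lambda>x. x + t *\<^sub>R Y x) x)) \<in> admissible_nc \<Omega> g M"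
      using u by (intro admissible_nc_push[OF _ refl g t0(8,9) t0(10)[OF t]]) (auto simp: admissible_nc_axi_def)
    have "axisymmetric_map \<Omega> (\<lambda>x. u (inv (\<lambda>x. x + t *\<^sub>R Y x) x))"
    proof (rule axisymmetric_map_push)
      show "axisymmetric_map \<Omega> u" using u by (simp add: admissible_nc_axi_def)
      show "rotm \<theta> *v x + t *\<^sub>R Y (rotm \<theta> *v x) = rotm \<theta> *v (x + t *\<^sub>R Y x)" for \<theta> x
        by (simp add: Y(2) matrix_vector_right_distrib matrix_vector_mult_scaleR)
      show "reflm *v x + t *\<^sub>R Y (reflm *v x) = reflm *v (x + t *\<^sub>R Y x)" for x
        by (simp add: Y(3) matrix_vector_right_distrib matrix_vector_mult_scaleR)
      fix r z :: real assume r: "r > 0"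
      have "rotm pi *v cyl 0 0 z = cyl 0 0 z" by (simp add: rotm_cyl vec_eq_iff forall_3 cyl_components)
      then have "Y (cyl 0 0 z) = rotm pi *v Y (cyl 0 0 z)" using Y(2) by metis
      then have "Y (cyl 0 0 z) $ 1 = (rotm pi *v Y (cyl 0 0 z)) $ 1" by simp
      then have Y0: "Y (cyl 0 0 z) $ 1 = 0"
        by (simp add: matrix_vector_mult_def sum_3 rotm_components)
      have "cyl r 0 z - cyl 0 0 z = r *\<^sub>R axis 1 1"
        by (simp add: vec_eq_iff forall_3 cyl_components axis_def)
      then have "norm (cyl r 0 z - cyl 0 0 z) = r" using r by simp
      then have "norm (Y (cyl r 0 z) - Y (cyl 0 0 z)) \<le> \<beta> * r"
        using lipschitz_jacobian_bound[OF sY t0(2), of "cyl r 0 z" "cyl 0 0 z"] by simp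
      moreover have "\<bar>(Y (cyl r 0 z) - Y (cyl 0 0 z)) $ 1\<bar> \<le> norm (Y (cyl r 0 z) - Y (cyl 0 0 z))"
        by (rule component_le_norm_cart)
      ultimately have Yr: "\<bar>Y (cyl r 0 z) $ 1\<bar> \<le> \<beta> * r" using Y0 by simp
      have "\<bar>t * Y (cyl r 0 z) $ 1\<bar> \<le> t0 * (\<beta> * r)"
        unfolding abs_mult using t t0(1) by (intro mult_mono Yr) auto
      also have "\<dots> \<le> 1 / 2 * r"
        using mult_right_mono[OF t0(3), of r] r by (simp add: mult.assoc)
      finally show "(cyl r 0 z + t *\<^sub>R Y (cyl r 0 z)) $ 1 > 0"
        using r by (simp add: cyl_components abs_le_iff)
    qed
    with nc show "(\<lambda>x. u (inv (\<lambda>x. x + t *\<^sub>R Y x) x)) \<in> admissible_nc_axi \<Omega> g M"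
      by (simp add: admissible_nc_axi_def)
  qed
qed

section \<open>From vector fields to the distributional divergence\<close>

lemma energy_momentum_symmetric: "energy_momentum H A $ i $ j = energy_momentum H A $ j $ i"
proof -
  have "\<forall>i j. energy_momentum H A $ i $ j = energy_momentum H A $ j $ i"
    by (simp add: energy_momentum_def forall_3 matrix_matrix_mult_def transpose_def mat_def sum_3 algebra_simps)
  then show ?thesis by blast
qed

text \<open>The Jacobian of \<phi> e_j has the gradient of \<phi> as its j-th row, so the pairing
  gives the sum of T_ji times the i-th derivative of \<phi>; by symmetry of T this is the j-th
  component of Div T tested with \<phi>, up to sign.\<close>

lemma Div_zero_if_stress_functional_zero:
  assumes \<Omega>: "open \<Omega>" and T: "integrable (lebesgue_on \<Omega>) T" "\<And>x i j. T x $ i $ j = T x $ j $ i"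
    and zero: "\<And>X :: real^3 \<Rightarrow> real^3. X \<in> test_functions \<Omega> \<Longrightarrow> (LINT x|lebesgue_on \<Omega>. T x \<bullet> jacobian X (at x)) = 0"
  shows "distributional_Div_zero \<Omega> T"
  unfolding distributional_Div_zero_def
proof (intro conjI allI ballI)
  have \<Omega>s: "\<Omega> \<in> sets lebesgue" using \<Omega> by (simp add: borel_open)
  show "locally_integrable \<Omega> T" by (rule locally_integrable_if_integrable[OF T(1) \<Omega>])
  fix j and \<phi> :: "real^3 \<Rightarrow> real" assume \<phi>: "\<phi> \<in> test_functions \<Omega>"
  obtain Q where Q: "smooth_on UNIV \<phi>" "compact Q" "Q \<subseteq> \<Omega>" "\<And>x. x \<notin> Q \<Longrightarrow> \<phi> x = 0"
    using test_functionsE[OF \<phi>] by metis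
  define X where "X = (\<lambda>x. \<phi> x *\<^sub>R (axis j 1 :: real^3))"
  have sX: "smooth_on UNIV X" unfolding X_def by (intro smooth_scaleR Q(1) smooth_const)
  have X: "X \<in> test_functions \<Omega>"
    by (rule test_functionsI[OF sX Q(2,3)]) (simp add: X_def Q(4))
  have jX: "jacobian X (at x) $ a $ b = (if a = j then partial_deriv b \<phi> x else 0)" for x a b
  proof -
    have "(X has_derivative (\<lambda>h. frechet_derivative \<phi> (at x) h *\<^sub>R axis j 1)) (at x)"
      unfolding X_def by (rule has_derivative_scaleR_left[OF smooth_has_derivative[OF Q(1)]])
    from fun_cong[OF frechet_derivative_at[OF this], of "axis b 1"]
    have "frechet_derivative X (at x) (axis b 1) = partial_deriv b \<phi> x *\<^sub>R axis j 1"
      by (simp add: partial_deriv_def)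
    then have "jacobian X (at x) $ a $ b = (partial_deriv b \<phi> x *\<^sub>R (axis j 1 :: real^3)) $ a"
      by (simp only: jacobian_component)
    then show ?thesis by (simp add: axis_def)
  qed
  have eq: "T x \<bullet> jacobian X (at x) = (\<Sum>i\<in>UNIV. T x $ i $ j * partial_deriv i \<phi> x)" for x
  proof -
    have "T x \<bullet> jacobian X (at x) = (\<Sum>a\<in>UNIV. if a = j then (\<Sum>b\<in>UNIV. T x $ a $ b * partial_deriv b \<phi> x) else 0)"
      unfolding inner_vec_def jX by (intro sum.cong) auto
    then show ?thesis using T(2) by simp
  qed
  have int: "integrable (lebesgue_on \<Omega>) (\<lambda>x. T x $ i $ j * partial_deriv i \<phi> x)" for i
    by (rule integrable_mult_compact_support[OF integrable_entry[OF T(1)] \<Omega>s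
        smooth_continuous[OF smooth_partial_deriv[OF Q(1)]] Q(2) partial_deriv_zero_outside_support[OF Q(1,2,4)]])
  have "(\<Sum>i\<in>UNIV. LINT x|lebesgue_on \<Omega>. T x $ i $ j * partial_deriv i \<phi> x) = (LINT x|lebesgue_on \<Omega>. T x \<bullet> jacobian X (at x))"
    unfolding eq by (rule Bochner_Integration.integral_sum[symmetric]) (rule int)
  then show "(\<Sum>i\<in>UNIV. LINT x|lebesgue_on \<Omega>. T x $ i $ j * partial_deriv i \<phi> x) = 0"
    using zero[OF X] by simp
qed

theorem theorem1p2:
  fixes \<Omega> \<Omega>' :: "(real^3) set"
    and g u :: "real^3 \<Rightarrow> real^3"
    and H :: "real \<Rightarrow> real"
    and M s c1 c2 d0 \<tau> c3 c4 d1 :: real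
  defines "Du \<equiv> weak_gradient \<Omega> u"
  assumes dom: "smooth_bounded_domain \<Omega>" "axisymmetric_set \<Omega>"
    and dom': "smooth_bounded_domain \<Omega>'" "axisymmetric_set \<Omega>'"
    and g: "C1_diffeomorphism (closure \<Omega>) (closure \<Omega>') g" "axisymmetric_map \<Omega> g"
    and M: "M > 0"
    and inf_energy: "0 < (INF w \<in> admissible_nc_axi \<Omega> g M. energy \<Omega> H w)"
      "(INF w \<in> admissible_nc_axi \<Omega> g M. energy \<Omega> H w) < \<infinity>"
    and off_axis: "(INF x \<in> \<Omega>. sqrt ((x$1)\<^sup>2 + (x$2)\<^sup>2)) > 0"
    and H_nonneg: "\<And>t. t > 0 \<Longrightarrow> H t \<ge> 0"
    and H_C1: "H C1_differentiable_on {0<..}"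
    and H_convex: "convex_on {0<..} H"
    and H_at_top: "filterlim (\<lambda>t. H t / t) at_top at_top"
    and H_at_0: "filterlim H at_top (at_right 0)"
    and consts0: "s > 0" "c1 > 0" "c2 > 0" "d0 > 0"
    and H_growth0: "\<And>k t. k \<in> {0, 1::nat} \<Longrightarrow> 0 < t \<Longrightarrow> t < d0 \<Longrightarrow>
      c1 * t powr (- s - real k) \<le> (-1) ^ k * (deriv ^^ k) H t \<and>
      (-1) ^ k * (deriv ^^ k) H t \<le> c2 * t powr (- s - real k)"
    and consts1: "\<tau> > 0" "c3 > 0" "c4 > 0" "d1 > 0"
    and H_growth1: "\<And>t. t \<ge> d1 \<Longrightarrow>
      c3 * t powr (\<tau> + 1) \<le> deriv H t \<and> deriv H t \<le> c4 * t powr (\<tau> + 1)"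
    and min: "is_minimizer (energy \<Omega> H) (admissible_nc_axi \<Omega> g M) u"
  shows "distributional_Div_zero \<Omega> (\<lambda>x.
      2 *\<^sub>R (transpose (Du x) ** Du x) +
      mat (deriv H (det (Du x)) * det (Du x) - (norm (Du x))\<^sup>2 - H (det (Du x))))"
proof -
  from dom(1) have \<Omega>: "open \<Omega>" "bounded \<Omega>" by (auto simp: smooth_bounded_domain_def)
  note rot = axisymmetric_set_rotm[OF dom(2)] and ref = axisymmetric_set_reflm[OF dom(2)]
  \<comment> \<open>\<open>C1_differentiable_on\<close> provides some continuous derivative; on the
    open half line it coincides with \<open>deriv H\<close>, which occurs in the statement.\<close>
  obtain D where D: "\<And>t. t > 0 \<Longrightarrow> (H has_vector_derivative D t) (at t)" "continuous_on {0<..} D"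
    using H_C1 by (auto simp: C1_differentiable_on_def)
  have D': "(H has_real_derivative D t) (at t)" if "t > 0" for t
    using D(1)[OF that] by (simp add: has_real_derivative_iff_has_vector_derivative)
  then have dH: "deriv H t = D t" if "t > 0" for t using that by (simp add: DERIV_imp_deriv)
  have der: "(H has_real_derivative deriv H t) (at t)" if "t > 0" for t
    using D'[OF that] dH[OF that] by simp
  have contD: "continuous_on {0<..} (deriv H)"
    by (rule continuous_on_eq[OF D(2)]) (simp add: dH)
  have contH: "continuous_on {0<..} H"
    using der by (intro continuous_at_imp_continuous_on) (auto intro: DERIV_isCont)
  have near0: "c1 * t powr (- s) \<le> H t" "\<bar>deriv H t\<bar> \<le> c2 * t powr (- s - 1)" if "0 < t" "t < d0" for t
  proof -
    show "c1 * t powr (- s) \<le> H t" using H_growth0[of 0 t] that by simp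
    have "0 \<le> c1 * t powr (- s - 1)" using consts0 by simp
    then show "\<bar>deriv H t\<bar> \<le> c2 * t powr (- s - 1)" using H_growth0[of 1 t] that by simp
  qed
  \<comment> \<open>The growth conditions at 0 and at infinity enter the argument through this
    bound.\<close>
  obtain C where C: "C > 0" "\<And>t. t > 0 \<Longrightarrow> \<bar>t * deriv H t\<bar> \<le> C * (1 + H t)"
    using logarithmic_derivative_bound[OF H_nonneg der contD near0 consts0(2-4) consts1(2-4) consts1(1)] H_growth1
    by metis
  have uA: "u \<in> admissible_nc_axi \<Omega> g M" and uM: "\<And>w. w \<in> admissible_nc_axi \<Omega> g M \<Longrightarrow> energy \<Omega> H u \<le> energy \<Omega> H w"
    using min by (auto simp: is_minimizer_def)
  then have W: "u \<in> W12 \<Omega>" and det: "AE x in lebesgue_on \<Omega>. det (Du x) > 0" and axi: "axisymmetric_map \<Omega> u"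
    by (auto simp: admissible_nc_axi_def admissible_nc_def admissible_def Du_def)
  have gC: "C1_on_closed (closure \<Omega>) g" using g(1) by (auto simp: C1_diffeomorphism_def)
  \<comment> \<open>The energy of a minimizer is a lower bound over the class, hence at most the
    infimum, which is finite by assumption.\<close>
  have fin: "energy \<Omega> H u < \<infinity>"
    using inf_energy(2) INF_greatest[of "admissible_nc_axi \<Omega> g M" "energy \<Omega> H u" "energy \<Omega> H"] uM
    by (meson le_less_trans)
  note e = energy_finite_integrable[OF \<Omega> W det[unfolded Du_def] contH H_nonneg fin, folded Du_def]
  note m = W12D(5)[OF W \<Omega>, folded Du_def]
  let ?T = "\<lambda>x. energy_momentum H (Du x)"
  have Ti: "integrable (lebesgue_on \<Omega>) ?T"
    by (rule energy_momentum_integrable[OF \<Omega> m det e(1) H_nonneg contH contD C])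
  \<comment> \<open>Equivariance passes from u to Du by uniqueness of weak gradients, and from Du to
    T by isotropy.\<close>
  have equi: "AE x in lebesgue_on \<Omega>. ?T (R *v x) = R ** ?T x ** transpose R"
    if R: "transpose R ** R = mat 1" "R ** transpose R = mat 1" "(\<lambda>x. R *v x) ` \<Omega> = \<Omega>"
      "AE x in lebesgue_on \<Omega>. u (R *v x) = R *v u x" for R
    using weak_gradient_equivariant[OF R(1,2) \<Omega> R(3) W R(4)]
    unfolding Du_def by eventually_elim (simp add: energy_momentum_conjugate[OF R(1,2)])
  note T_rot = equi[OF orthogonal_rotm rot axisymmetric_map_equivariant(1)[OF axi \<Omega>(1) dom(2)]]
  note T_ref = equi[OF orthogonal_reflm ref axisymmetric_map_equivariant(2)[OF axi \<Omega>(1) dom(2)]]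
  have "(LINT x|lebesgue_on \<Omega>. ?T x \<bullet> jacobian X (at x)) = 0" if X: "X \<in> test_functions \<Omega>" for X :: "real^3 \<Rightarrow> real^3"
  proof -
    \<comment> \<open>Competitors are available for equivariant fields only, so X is replaced by a
      symmetrized field with the same pairing.\<close>
    obtain Y where Y: "Y \<in> test_functions \<Omega>" "\<And>\<theta> x. Y (rotm \<theta> *v x) = rotm \<theta> *v Y x" "\<And>x. Y (reflm *v x) = reflm *v Y x"
      "(LINT x|lebesgue_on \<Omega>. ?T x \<bullet> jacobian Y (at x)) = (LINT x|lebesgue_on \<Omega>. ?T x \<bullet> jacobian X (at x))"
      by (rule symmetrization[OF \<Omega> rot ref X Ti T_rot T_ref]) (rule that; assumption)
    obtain t1 where t1: "t1 > 0"
      "\<And>t. \<bar>t\<bar> \<le> t1 \<Longrightarrow> (\<lambda>x. u (inv (\<lambda>x. x + t *\<^sub>R Y x) x)) \<in> admissible_nc_axi \<Omega> g M"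
      using equivariant_competitor[OF \<Omega> uA gC Y(1-3)] by blast
    have "(LINT x|lebesgue_on \<Omega>. ?T x \<bullet> jacobian Y (at x)) = 0"
      unfolding Du_def
      by (rule inner_variation_zero[OF \<Omega> W det[unfolded Du_def] fin H_nonneg der C Y(1) t1(1) uM[OF t1(2)]])
    then show ?thesis using Y(4) by simp
  qed
  then have "distributional_Div_zero \<Omega> ?T"
    by (rule Div_zero_if_stress_functional_zero[OF \<Omega>(1) Ti energy_momentum_symmetric])
  then show ?thesis by (simp only: energy_momentum_def)
qed

end
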